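(* Let $P$ be a set of $n\ge 5$ points in convex position in the plane, let $G(P)$ be its path graph, and let $N=|V(G(P))|$. There is an algorithm that, given $G(P)$ as an abstract graph, computes in time $O(N\log N)$ an assignment $v\mapsto \phi(v)$ of a set of edges of $K(P)$ to every vertex $v$ of $G(P)$ such that, for some automorphism $\sigma$ of $K(P)$ as a geometric graph, $\phi(v)=\sigma(P(v))$ for all $v$, where $P(v)$ is the edge set of the path represented by $v$. (That is, the edges of all paths represented by vertices of $G(P)$ are recovered, up to an automorphism of $K(P)$, in time $O(N\log N)$.)
   Context: For a finite set $P$ of points in the plane, $K(P)$ is the complete geometric graph on $P$ (edges are straight segments). The path graph $G(P)$ is the abstract graph whose vertices are the non-crossing spanning paths of $K(P)$, two adjacent iff one is obtained from the other by deleting one edge and adding another edge. An automorphism of $K(P)$ as a geometric graph is a graph automorphism of $K(P)$ mapping crossing pairs of edges to crossing pairs and non-crossing pairs to non-crossing pairs; any such automorphism induces an automorphism of $G(P)$, so recovery is only possible up to such an automorphism. It is known that $N=n2^{n-3}$. *)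

theory Defs
  imports "HOL-Analysis.Analysis" "HOL-Library.Landau_Symbols"
begin

section \<open>Points in convex position\<close>

type_synonym point = "real ^ 2"

definition convex_position :: "point set \<Rightarrow> bool" where
  "convex_position P \<longleftrightarrow> (\<forall>x\<in>P. x \<notin> convex hull (P - {x}))"

text \<open>Twice the signed area of the triangle; it is positive iff the triangle is oriented
  counterclockwise.\<close>

definition orient :: "point \<Rightarrow> point \<Rightarrow> point \<Rightarrow> real" where
  "orient a b c = (b $ 1 - a $ 1) * (c $ 2 - a $ 2) - (b $ 2 - a $ 2) * (c $ 1 - a $ 1)"

text \<open>\<open>ps\<close> lists the points of \<open>P\<close> in the order in which they are met on a counterclockwise
  tour around the convex hull of \<open>P\<close>.\<close>

definition ccw_order :: "point set \<Rightarrow> point list \<Rightarrow> bool" where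
  "ccw_order P ps \<longleftrightarrow> distinct ps \<and> set ps = P \<and>
     (\<forall>i j k. i < j \<and> j < k \<and> k < length ps \<longrightarrow> orient (ps ! i) (ps ! j) (ps ! k) > 0)"


section \<open>The complete geometric graph and the path graph\<close>

text \<open>The edge joining \<open>x\<close> and \<open>y\<close> is represented by the set \<open>{x, y}\<close> of its endpoints.\<close>

definition K_edges :: "point set \<Rightarrow> point set set" where
  "K_edges P = {{x, y} | x y. x \<in> P \<and> y \<in> P \<and> x \<noteq> y}"

definition crossing :: "point set \<Rightarrow> point set \<Rightarrow> bool" where
  "crossing e f \<longleftrightarrow> e \<noteq> f \<and>
     (\<exists>a b c d. e = {a, b} \<and> f = {c, d} \<and> open_segment a b \<inter> open_segment c d \<noteq> {})"

definition path_edges :: "point list \<Rightarrow> point set set" where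
  "path_edges xs = {{xs ! i, xs ! Suc i} | i. Suc i < length xs}"

text \<open>A spanning path is identified with its set of edges, so that a sequence of points and its
  reversal give the same path.\<close>

definition path_graph_verts :: "point set \<Rightarrow> point set set set" where
  "path_graph_verts P = {path_edges xs | xs. distinct xs \<and> set xs = P \<and>
     (\<forall>e\<in>path_edges xs. \<forall>f\<in>path_edges xs. \<not> crossing e f)}"

definition path_graph_adj :: "point set set \<Rightarrow> point set set \<Rightarrow> bool" where
  "path_graph_adj A B \<longleftrightarrow> (\<exists>e f. e \<in> A \<and> f \<notin> A \<and> B = insert f (A - {e}))"

text \<open>Every permutation of the points is a graph automorphism of the complete graph, so only
  crossings have to be considered.\<close>

definition geometric_automorphism :: "point set \<Rightarrow> (point \<Rightarrow> point) \<Rightarrow> bool" where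
  "geometric_automorphism P \<sigma> \<longleftrightarrow> bij_betw \<sigma> P P \<and>
     (\<forall>e\<in>K_edges P. \<forall>f\<in>K_edges P. crossing (\<sigma> ` e) (\<sigma> ` f) \<longleftrightarrow> crossing e f)"


section \<open>A word RAM\<close>

text \<open>The model is a unit-cost random access machine with \<open>w\<close>-bit words, programmed in a
  while language. A program is a finite text, hence uses only finitely many variables and
  arrays, and these can be interleaved in one memory at constant cost per access.
  Evaluating each node of an expression takes one time unit. Subtraction is truncated at \<open>0\<close>;
  all arithmetic results are reduced modulo \<open>2 ^ w\<close>. On inputs of size \<open>N\<close> the words must be
  allowed to have \<open>O(log N)\<close> bits, i.e. an algorithm has to work for all \<open>w\<close> with \<open>2 ^ w \<ge> N ^ c\<close>,
  for some constant \<open>c\<close>.\<close>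

type_synonym name = string

datatype binop = Add | Sub | Mul | Div | Mod | Less | Equal

datatype expr = Const nat | Var name | Elem name expr | Op binop expr expr

datatype com =
    Skip
  | Assign name expr
  | Store name expr expr
  | Seq com com
  | If expr com com
  | While expr com

record state =
  vars :: "name \<Rightarrow> nat"
  arrays :: "name \<Rightarrow> nat \<Rightarrow> nat"

fun apply_op :: "nat \<Rightarrow> binop \<Rightarrow> nat \<Rightarrow> nat \<Rightarrow> nat" where
  "apply_op w Add x y = (x + y) mod 2 ^ w"
| "apply_op w Sub x y = (x - y) mod 2 ^ w"
| "apply_op w Mul x y = (x * y) mod 2 ^ w"
| "apply_op w Div x y = (x div y) mod 2 ^ w"
| "apply_op w Mod x y = (x mod y) mod 2 ^ w"
| "apply_op w Less x y = (if x < y then 1 else 0)"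
| "apply_op w Equal x y = (if x = y then 1 else 0)"

fun eval :: "nat \<Rightarrow> expr \<Rightarrow> state \<Rightarrow> nat" where
  "eval w (Const k) s = k mod 2 ^ w"
| "eval w (Var x) s = vars s x"
| "eval w (Elem a e) s = arrays s a (eval w e s)"
| "eval w (Op f d e) s = apply_op w f (eval w d s) (eval w e s)"

fun cost :: "expr \<Rightarrow> nat" where
  "cost (Const k) = 1"
| "cost (Var x) = 1"
| "cost (Elem a e) = 1 + cost e"
| "cost (Op f d e) = 1 + cost d + cost e"

text \<open>\<open>run w c s t s'\<close>: with word length \<open>w\<close>, the program \<open>c\<close> started in state \<open>s\<close> halts after
  exactly \<open>t\<close> time units in state \<open>s'\<close>.\<close>

inductive run :: "nat \<Rightarrow> com \<Rightarrow> state \<Rightarrow> nat \<Rightarrow> state \<Rightarrow> bool" for w where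
  Skip: "run w Skip s 1 s"
| Assign: "run w (Assign x e) s (1 + cost e) (s\<lparr>vars := (vars s)(x := eval w e s)\<rparr>)"
| Store: "run w (Store a d e) s (1 + cost d + cost e)
     (s\<lparr>arrays := (arrays s)(a := (arrays s a)(eval w d s := eval w e s))\<rparr>)"
| Seq: "run w c s t s' \<Longrightarrow> run w d s' t' s'' \<Longrightarrow> run w (Seq c d) s (t + t') s''"
| IfTrue: "eval w b s \<noteq> 0 \<Longrightarrow> run w c s t s' \<Longrightarrow> run w (If b c d) s (1 + cost b + t) s'"
| IfFalse: "eval w b s = 0 \<Longrightarrow> run w d s t s' \<Longrightarrow> run w (If b c d) s (1 + cost b + t) s'"
| WhileFalse: "eval w b s = 0 \<Longrightarrow> run w (While b c) s (1 + cost b) s"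
| WhileTrue: "eval w b s \<noteq> 0 \<Longrightarrow> run w c s t s' \<Longrightarrow> run w (While b c) s' t' s'' \<Longrightarrow>
     run w (While b c) s (1 + cost b + t + t') s''"

inductive_cases run_SkipE: "run w Skip s t s'"
inductive_cases run_AssignE: "run w (Assign x e) s t s'"
inductive_cases run_StoreE: "run w (Store a d e) s t s'"
inductive_cases run_SeqE: "run w (Seq c d) s t s'"
inductive_cases run_IfE: "run w (If b c d) s t s'"
inductive_cases run_WhileE: "run w (While b c) s t s'"

lemma run_deterministic:
  "run w c s t s' \<Longrightarrow> run w c s u r \<Longrightarrow> u = t \<and> r = s'"
proof (induction arbitrary: u r rule: run.induct)
  case Skip then show ?case by (auto elim: run_SkipE)
next
  case Assign then show ?case by (auto elim: run_AssignE)
next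
  case Store then show ?case by (auto elim: run_StoreE)
next
  case (Seq c s t s' d t' s'')
  obtain t1 t2 r1 where r: "run w c s t1 r1" "run w d r1 t2 r" "u = t1 + t2"
    using Seq.prems by (rule run_SeqE)
  with Seq.IH(1)[OF r(1)] Seq.IH(2)[of t2 r] show ?case by simp
next
  case (IfTrue b s c t s' d)
  obtain t1 where r: "run w c s t1 r" "u = 1 + cost b + t1"
    using IfTrue.prems by (rule run_IfE) (use IfTrue.hyps(1) in simp_all)
  with IfTrue.IH[OF r(1)] show ?case by simp
next
  case (IfFalse b s d t s' c)
  obtain t1 where r: "run w d s t1 r" "u = 1 + cost b + t1"
    using IfFalse.prems by (rule run_IfE) (use IfFalse.hyps(1) in simp_all)
  with IfFalse.IH[OF r(1)] show ?case by simp
next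
  case (WhileFalse b s c)
  from WhileFalse.prems show ?case
    by (rule run_WhileE) (use WhileFalse.hyps(1) in simp_all)
next
  case (WhileTrue b s c t s' t' s'')
  obtain t1 t2 r1 where r: "run w c s t1 r1" "run w (While b c) r1 t2 r"
      "u = 1 + cost b + t1 + t2"
    using WhileTrue.prems by (rule run_WhileE) (use WhileTrue.hyps(1) in simp_all)
  with WhileTrue.IH(1)[OF r(1)] WhileTrue.IH(2)[of t2 r] show ?case by simp
qed


section \<open>Input and output\<close>

text \<open>\<open>vs\<close> is a numbering of the vertex set \<open>V\<close>, and \<open>A\<close> lists, for every vertex number, the
  numbers of the neighbours in some order. Both the numbering and the orders are arbitrary.\<close>

definition adjacency_lists ::
    "'v set \<Rightarrow> ('v \<Rightarrow> 'v \<Rightarrow> bool) \<Rightarrow> 'v list \<Rightarrow> nat list list \<Rightarrow> bool" where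
  "adjacency_lists V adj vs A \<longleftrightarrow> distinct vs \<and> set vs = V \<and> length A = length vs \<and>
     (\<forall>v < length vs. distinct (A ! v) \<and>
        set (A ! v) = {u. u < length vs \<and> adj (vs ! v) (vs ! u)})"

text \<open>The initial memory: the neighbours of vertex \<open>v\<close> occupy the positions from \<open>off[v]\<close> up to,
  but not including, \<open>off[v+1]\<close> of the array \<open>adj\<close>. Every other cell contains \<open>0\<close>.\<close>

definition input_state :: "nat list list \<Rightarrow> state" where
  "input_state A = \<lparr>
     vars = (\<lambda>_. 0)(''N'' := length A),
     arrays = (\<lambda>_ _. 0)(
       ''off'' := (\<lambda>v. if v \<le> length A then length (concat (take v A)) else 0),
       ''adj'' := (\<lambda>k. if k < length (concat A) then concat A ! k else 0))\<rparr>"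

text \<open>The final memory: the edges assigned to vertex \<open>v\<close> occupy the positions from \<open>eoff[v]\<close> up
  to, but not including, \<open>eoff[v+1]\<close> of the arrays \<open>ea\<close> and \<open>eb\<close>, which contain the numbers of
  the two endpoints. Point numbers refer to the cyclic order of the points around the convex
  hull.\<close>

definition output_pairs :: "state \<Rightarrow> nat \<Rightarrow> (nat \<times> nat) set" where
  "output_pairs s v = {(arrays s ''ea'' k, arrays s ''eb'' k) | k.
     arrays s ''eoff'' v \<le> k \<and> k < arrays s ''eoff'' (Suc v)}"

definition output_edges :: "point list \<Rightarrow> state \<Rightarrow> nat \<Rightarrow> point set set" where
  "output_edges ps s v = {{ps ! i, ps ! j} | i j. (i, j) \<in> output_pairs s v}"


section \<open>Every finite set in convex position has a counterclockwise order\<close>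

lemma ex_sorted_wrt:
  assumes "finite S"
    and "\<And>x y. x \<in> S \<Longrightarrow> y \<in> S \<Longrightarrow> x \<noteq> y \<Longrightarrow> R x y \<or> R y x"
    and "\<And>x y z. x \<in> S \<Longrightarrow> y \<in> S \<Longrightarrow> z \<in> S \<Longrightarrow> R x y \<Longrightarrow> R y z \<Longrightarrow> R x z"
  shows "\<exists>xs. distinct xs \<and> set xs = S \<and> sorted_wrt R xs"
  using assms
proof (induction S rule: finite_induct)
  case empty
  show ?case by simp
next
  case (insert a S)
  have "\<exists>xs. distinct xs \<and> set xs = S \<and> sorted_wrt R xs"
    by (rule insert.IH) (use insert.prems in blast)+
  then obtain xs where xs: "distinct xs" "set xs = S" "sorted_wrt R xs" by blast
  define l where "l = filter (\<lambda>x. R x a) xs"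
  define r where "r = filter (\<lambda>x. \<not> R x a) xs"
  have r: "R a x" if "x \<in> set r" for x
    using that insert.prems(1)[of x a] insert.hyps(2) by (auto simp: r_def xs)
  have "sorted_wrt R (l @ a # r)"
    unfolding sorted_wrt_append sorted_wrt.simps
  proof (intro conjI ballI)
    show "sorted_wrt R l" "sorted_wrt R r"
      unfolding l_def r_def using xs(3) by (simp_all add: sorted_wrt_filter)
    fix x assume x: "x \<in> set r"
    show "R a x" by (rule r[OF x])
  next
    fix x y assume x: "x \<in> set l" and y: "y \<in> set (a # r)"
    have xa: "R x a" "x \<in> S" using x by (auto simp: l_def xs)
    show "R x y"
    proof (cases "y = a")
      case False
      then have y': "y \<in> set r" using y by simp
      then have "y \<in> S" by (simp add: r_def xs)
      then show ?thesis using insert.prems(2)[of x a y] xa r[OF y'] by blast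
    qed (use xa in simp)
  qed
  moreover have "distinct (l @ a # r)" "set (l @ a # r) = insert a S"
    using xs insert.hyps(2) by (auto simp: l_def r_def)
  ultimately show ?case by blast
qed

definition lex_less :: "point \<Rightarrow> point \<Rightarrow> bool" where
  "lex_less a b \<longleftrightarrow> a $ 1 < b $ 1 \<or> (a $ 1 = b $ 1 \<and> a $ 2 < b $ 2)"

lemma orient_trans:
  assumes "lex_less a b" "lex_less a c" "lex_less a d" "orient a b c > 0" "orient a c d > 0"
  shows "orient a b d > 0"
proof -
  define ux uy vx vy zx zy where u: "ux = b $ 1 - a $ 1" "uy = b $ 2 - a $ 2"
    "vx = c $ 1 - a $ 1" "vy = c $ 2 - a $ 2" "zx = d $ 1 - a $ 1" "zy = d $ 2 - a $ 2"
  have h: "ux > 0 \<or> (ux = 0 \<and> uy > 0)" "vx > 0 \<or> (vx = 0 \<and> vy > 0)" "zx > 0 \<or> (zx = 0 \<and> zy > 0)"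
    using assms(1-3) by (auto simp: lex_less_def u)
  have c: "ux * vy - uy * vx > 0" "vx * zy - vy * zx > 0"
    using assms(4,5) by (auto simp: orient_def u)
  have id: "(ux * zy - uy * zx) * vx = (ux * vy - uy * vx) * zx + (vx * zy - vy * zx) * ux"
    by algebra
  have "vx > 0"
  proof (rule ccontr)
    assume "\<not> vx > 0"
    then have "vx = 0" "vy > 0" using h(2) by auto
    then have "vy * zx < 0" using c(2) by simp
    then show False using h(3) \<open>vy > 0\<close> by (auto simp: mult_less_0_iff)
  qed
  have "ux > 0 \<or> zx > 0"
  proof (rule ccontr)
    assume "\<not> ?thesis"
    then have "ux = 0" "uy > 0" using h by auto
    then have "uy * vx < 0" using c(1) by simp
    then show False using \<open>vx > 0\<close> \<open>uy > 0\<close> by (auto simp: mult_less_0_iff)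
  qed
  moreover have "ux \<ge> 0" "zx \<ge> 0" using h by auto
  ultimately have "(ux * vy - uy * vx) * zx + (vx * zy - vy * zx) * ux > 0"
    using c by (auto intro: add_nonneg_pos add_pos_nonneg)
  then have "(ux * zy - uy * zx) * vx > 0" using id by simp
  then have "ux * zy - uy * zx > 0" using \<open>vx > 0\<close> by (simp add: zero_less_mult_iff)
  then show ?thesis by (simp add: orient_def u)
qed

lemma orient_zero_segment:
  assumes "lex_less a b" "lex_less a c" "orient a b c = 0"
  shows "b \<in> closed_segment a c \<or> c \<in> closed_segment a b"
proof -
  have scale: "b \<in> closed_segment a c"
    if "t \<ge> 0" "t \<le> 1" "b $ 1 - a $ 1 = t * (c $ 1 - a $ 1)" "b $ 2 - a $ 2 = t * (c $ 2 - a $ 2)"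
    for b c :: point and t
  proof -
    have "b = (1 - t) *\<^sub>R a + t *\<^sub>R c"
      using that by (simp add: vec_eq_iff forall_2 algebra_simps)
    then show ?thesis using that by (auto simp: closed_segment_def)
  qed
  define ux uy vx vy where u: "ux = b $ 1 - a $ 1" "uy = b $ 2 - a $ 2"
    "vx = c $ 1 - a $ 1" "vy = c $ 2 - a $ 2"
  have h: "ux > 0 \<or> (ux = 0 \<and> uy > 0)" "vx > 0 \<or> (vx = 0 \<and> vy > 0)"
    using assms by (auto simp: lex_less_def u)
  have c: "ux * vy = uy * vx"
    using assms by (auto simp: orient_def u)
  consider "ux > 0" "vx > 0" | "ux = 0" "vx = 0" "uy > 0" "vy > 0"
    using h c by (cases "ux > 0"; cases "vx > 0") auto
  then show ?thesis
  proof cases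
    case 1
    show ?thesis
    proof (cases "ux \<le> vx")
      case True
      then have "b \<in> closed_segment a c"
        using 1 c by (intro scale[of "ux / vx"]) (auto simp flip: u simp: field_simps)
      then show ?thesis ..
    next
      case False
      then have "c \<in> closed_segment a b"
        using 1 c by (intro scale[of "vx / ux"]) (auto simp flip: u simp: field_simps)
      then show ?thesis ..
    qed
  next
    case 2
    show ?thesis
    proof (cases "uy \<le> vy")
      case True
      then have "b \<in> closed_segment a c"
        using 2 by (intro scale[of "uy / vy"]) (auto simp flip: u simp: field_simps)
      then show ?thesis ..
    next
      case False
      then have "c \<in> closed_segment a b"
        using 2 by (intro scale[of "vy / uy"]) (auto simp flip: u simp: field_simps)
      then show ?thesis ..
    qed
  qed
qed

lemma orient_triangle:
  assumes "orient a b c > 0" "orient a c d > 0" "orient a b d > 0" "orient b c d \<le> 0"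
  shows "c \<in> convex hull {a, b, d}"
proof -
  define D where "D = orient a b d"
  define v where "v = orient a c d / D"
  define z where "z = orient a b c / D"
  have D: "D > 0" using assms by (simp add: D_def)
  have id: "orient b c d = orient a b c + orient a c d - D"
    by (simp add: orient_def D_def algebra_simps)
  have "v + z \<le> 1" using assms(4) D by (simp add: v_def z_def id field_simps)
  moreover have "v \<ge> 0" "z \<ge> 0" using assms D by (auto simp: v_def z_def)
  moreover have "c = (1 - v - z) *\<^sub>R a + v *\<^sub>R b + z *\<^sub>R d"
  proof -
    have Dv: "D * v = orient a c d" "D * z = orient a b c" using D by (auto simp: v_def z_def)
    have "D * (c $ i) = D * (((1 - v - z) *\<^sub>R a + v *\<^sub>R b + z *\<^sub>R d) $ i)"
      if "i = 1 \<or> i = 2" for i :: 2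
    proof -
      have "D * (((1 - v - z) *\<^sub>R a + v *\<^sub>R b + z *\<^sub>R d) $ i)
          = (D - D * v - D * z) * a $ i + (D * v) * b $ i + (D * z) * d $ i"
        by (simp add: algebra_simps)
      also have "\<dots> = D * (c $ i)"
        unfolding Dv unfolding D_def orient_def using that by (auto simp: algebra_simps)
      finally show ?thesis by (rule sym)
    qed
    then have "c $ i = ((1 - v - z) *\<^sub>R a + v *\<^sub>R b + z *\<^sub>R d) $ i" if "i = 1 \<or> i = 2" for i :: 2
      using that D by (metis mult_left_cancel less_irrefl)
    then show ?thesis unfolding vec_eq_iff forall_2 by blast
  qed
  ultimately show ?thesis
    unfolding convex_hull_3
    by (intro CollectI exI[of _ "1 - v - z"] exI[of _ v] exI[of _ z] conjI) simp_all
qed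

lemma ex_ccw_order:
  assumes "finite P" and cp: "convex_position P"
  shows "\<exists>ps. ccw_order P ps"
proof (cases "P = {}")
  case True
  then show ?thesis by (intro exI[of _ "[]"]) (simp add: ccw_order_def)
next
  case False
  have not_hull: "x \<notin> convex hull S" if "x \<in> P" "S \<subseteq> P - {x}" for x S
    using that cp hull_mono[OF that(2), of convex] unfolding convex_position_def by blast
  have lex_total: "lex_less x y \<or> lex_less y x" if "x \<noteq> y" for x y
    using that by (auto simp: lex_less_def vec_eq_iff forall_2)
  have lex_trans: "lex_less x z" if "lex_less x y" "lex_less y z" for x y z
    using that by (auto simp: lex_less_def)
  obtain qs where qs: "distinct qs" "set qs = P" "sorted_wrt lex_less qs"
    using ex_sorted_wrt[of P lex_less] assms(1) lex_total lex_trans by blast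
  then obtain a rs where "qs = a # rs" using False by (cases qs) auto
  then have a: "a \<in> P" "\<And>x. x \<in> P - {a} \<Longrightarrow> lex_less a x" using qs by auto
  have "\<exists>xs. distinct xs \<and> set xs = P - {a} \<and> sorted_wrt (\<lambda>b c. orient a b c > 0) xs"
  proof (rule ex_sorted_wrt)
    show "finite (P - {a})" using assms(1) by simp
  next
    fix x y assume xy: "x \<in> P - {a}" "y \<in> P - {a}" "x \<noteq> y"
    have "orient a x y \<noteq> 0"
    proof
      assume "orient a x y = 0"
      then have "x \<in> convex hull {a, y} \<or> y \<in> convex hull {a, x}"
        using orient_zero_segment[of a x y] a xy by (simp add: segment_convex_hull)
      then show False using not_hull[of x "{a, y}"] not_hull[of y "{a, x}"] a xy by auto
    qed
    moreover have "orient a y x = - orient a x y" by (simp add: orient_def algebra_simps)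
    ultimately show "orient a x y > 0 \<or> orient a y x > 0" by linarith
  next
    fix x y z assume "x \<in> P - {a}" "y \<in> P - {a}" "z \<in> P - {a}" "orient a x y > 0" "orient a y z > 0"
    then show "orient a x z > 0" using orient_trans[of a x y z] a by blast
  qed
  then obtain xs where xs: "distinct xs" "set xs = P - {a}"
    "sorted_wrt (\<lambda>b c. orient a b c > 0) xs" by blast
  have sorted: "orient a (xs ! i) (xs ! j) > 0" if "i < j" "j < length xs" for i j
    using xs(3) that by (simp add: sorted_wrt_iff_nth_less)
  have "orient ((a # xs) ! i) ((a # xs) ! j) ((a # xs) ! k) > 0"
    if ijk: "i < j" "j < k" "k < length (a # xs)" for i j k
  proof (cases i)
    case 0
    then show ?thesis using ijk sorted[of "j - 1" "k - 1"] by (cases j; cases k) auto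
  next
    case (Suc i')
    then obtain j' k' where jk: "j = Suc j'" "k = Suc k'" using ijk by (cases j; cases k) auto
    have lt: "i' < j'" "j' < k'" "k' < length xs" using ijk Suc jk by auto
    let ?b = "xs ! i'" and ?c = "xs ! j'" and ?d = "xs ! k'"
    have mem: "?b \<in> P - {a}" "?c \<in> P - {a}" "?d \<in> P - {a}"
      using lt nth_mem[of _ xs] xs(2) by auto
    have "?b \<noteq> ?c" "?c \<noteq> ?d" using lt xs(1) by (auto simp: nth_eq_iff_index_eq)
    then have "?c \<notin> convex hull {a, ?b, ?d}" using mem a by (intro not_hull) auto
    then have "orient ?b ?c ?d > 0"
      using orient_triangle[of a ?b ?c ?d] sorted[of i' j'] sorted[of j' k'] sorted[of i' k'] lt
      by linarith
    then show ?thesis by (simp add: Suc jk)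
  qed
  then have "ccw_order P (a # xs)" using xs a by (auto simp: ccw_order_def)
  then show ?thesis ..
qed

end

theory Submission
  imports Defs
begin

text \<open>Number the points along the hull and put a path into layer \<open>d\<close> if it has \<open>d\<close> diagonals.
  The paths without diagonals are exactly the vertices of maximal degree in the path graph. Two of
  them omit adjacent hull edges iff they have no common neighbour in layer 1, so the cyclic order
  of the hull edges can be read off from the graph. Every path in a layer \<open>d > 0\<close> has exactly two
  neighbours in layer \<open>d - 1\<close>, its parents; the hull edges that it misses are those missed by one of
  its parents. If \<open>d > 1\<close>, its diagonals are determined by those of the parents as well. A path
  in layer 1 that misses the hull edges \<open>{k, k + 1}\<close> and \<open>{l, l + 1}\<close> may contain \<open>{k, l}\<close> or
  \<open>{k + 1, l + 1}\<close>; which of the two is the case follows from the cyclic order of the gaps of any of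
  its neighbours in layer 2. All of this takes \<open>O(N n)\<close> steps, and \<open>N \<ge> 2 ^ (n - 2)\<close>
  gives \<open>n = O(log N)\<close>.\<close>

text \<open>A diagonal of a non-crossing spanning path has the part of the path before it on one
  side and the part after it on the other. Trading a diagonal for a hull edge reverses an end part
  of the path, and this part must then consist of hull edges. So only the first and the last
  diagonal can be traded: this gives the two parents. If these diagonals differ, the two trades
  commute, which is what allows a path to be rebuilt from its parents. Layer 1 is the exception: the
  two paths with the same two gaps have the same parents, so nothing below tells them apart. In
  layer 2 the parents have gaps \<open>{a, s}\<close> and \<open>{b, s}\<close>; some point would
  get three edges unless their diagonals are of opposite kinds, and the ban on crossings decides
  which is which. Layer 0 is recognised because its vertices have degree \<open>3 * n - 7\<close>,
  all others at most \<open>2 * n - 3\<close>; this is smaller as soon as \<open>n\<close> is at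
  least 5. The labels found differ from the true numbers by an unknown rotation or reflection. It is
  absorbed by renaming the paths, so that the analysis of the edges may assume true labels.\<close>

fun pedges :: "'a list \<Rightarrow> 'a set set" where
  "pedges (x # y # zs) = insert {x, y} (pedges (y # zs))"
| "pedges _ = {}"

section \<open>Edge sets of vertex sequences\<close>

lemma pedges_append:
  "xs \<noteq> [] \<Longrightarrow> ys \<noteq> [] \<Longrightarrow>
    pedges (xs @ ys) = insert {last xs, hd ys} (pedges xs \<union> pedges ys)"
proof (induction xs rule: pedges.induct)
  case (1 x y zs)
  then show ?case by auto
next
  case ("2_2" v)
  then show ?case by (cases ys) auto
qed simp

lemma pedges_append_subset: "pedges xs \<subseteq> pedges (xs @ ys)" "pedges ys \<subseteq> pedges (xs @ ys)"
  by (cases "xs = [] \<or> ys = []"; auto simp: pedges_append)+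

lemma pedges_rev [simp]: "pedges (rev xs) = pedges xs"
proof (induction xs rule: pedges.induct)
  case (1 x y zs)
  have "pedges (rev (x # y # zs)) = pedges (rev (y # zs) @ [x])" by simp
  also have "\<dots> = insert {y, x} (pedges (rev (y # zs)))"
    by (subst pedges_append) auto
  finally show ?case using 1 by (simp add: insert_commute)
qed auto

lemma pedges_map: "pedges (map f xs) = (`) f ` pedges xs"
  by (induction xs rule: pedges.induct) auto

lemma pedges_subset_set: "e \<in> pedges xs \<Longrightarrow> e \<subseteq> set xs"
  by (induction xs rule: pedges.induct) auto

lemma finite_pedges [simp]: "finite (pedges xs)"
  by (induction xs rule: pedges.induct) auto

lemma card_pedges: "distinct xs \<Longrightarrow> card (pedges xs) = length xs - 1"
proof (induction xs rule: pedges.induct)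
  case (1 x y zs)
  have "{x, y} \<notin> pedges (y # zs)"
    using 1(2) pedges_subset_set by fastforce
  with 1 show ?case by simp
qed auto

text \<open>Every edge is handled as the place where the sequence is cut into a front and a back
  part.\<close>

lemma pedges_split:
  "e \<in> pedges xs \<Longrightarrow> \<exists>as bs. xs = as @ bs \<and> as \<noteq> [] \<and> bs \<noteq> [] \<and> e = {last as, hd bs}"
proof (induction xs rule: pedges.induct)
  case (1 x y zs)
  show ?case
  proof (cases "e = {x, y}")
    case True
    then show ?thesis by (intro exI[of _ "[x]"] exI[of _ "y # zs"]) simp
  next
    case False
    with 1 obtain as bs where "y # zs = as @ bs" "as \<noteq> []" "bs \<noteq> []" "e = {last as, hd bs}"
      by auto
    then show ?thesis by (intro exI[of _ "x # as"] exI[of _ bs]) simp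
  qed
qed auto

lemma pedges_doubleton:
  assumes "e \<in> pedges xs" "distinct xs"
  shows "\<exists>x y. e = {x, y} \<and> x \<noteq> y \<and> x \<in> set xs \<and> y \<in> set xs"
proof -
  obtain as bs where *: "xs = as @ bs" "as \<noteq> []" "bs \<noteq> []" "e = {last as, hd bs}"
    using pedges_split[OF assms(1)] by blast
  have "last as \<in> set as" "hd bs \<in> set bs" using * by auto
  moreover from this have "last as \<noteq> hd bs" using * assms(2) by (metis disjoint_iff distinct_append)
  ultimately show ?thesis using * by (intro exI[of _ "last as"] exI[of _ "hd bs"]) simp
qed

lemma pedges_crossing_edge:
  assumes "distinct (as @ bs)" "{x, y} \<in> pedges (as @ bs)" "x \<in> set as" "y \<in> set bs"
  shows "x = last as \<and> y = hd bs"
proof -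
  have ne: "as \<noteq> []" "bs \<noteq> []" using assms by auto
  have "{x, y} \<notin> pedges as" "{x, y} \<notin> pedges bs"
    using assms pedges_subset_set by fastforce+
  then have "{x, y} = {last as, hd bs}" using assms(2) ne by (auto simp: pedges_append)
  moreover have "last as \<in> set as" "hd bs \<in> set bs" using ne by auto
  ultimately show ?thesis using assms by (auto simp: doubleton_eq_iff)
qed

lemma pedges_remove:
  assumes "distinct (as @ bs)" "as \<noteq> []" "bs \<noteq> []"
  shows "pedges (as @ bs) - {{last as, hd bs}} = pedges as \<union> pedges bs"
proof -
  have "last as \<in> set as" "hd bs \<in> set bs" using assms by auto
  then have "\<not> {last as, hd bs} \<subseteq> set as" "\<not> {last as, hd bs} \<subseteq> set bs" using assms(1) by auto
  then have "{last as, hd bs} \<notin> pedges as" "{last as, hd bs} \<notin> pedges bs"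
    using pedges_subset_set by blast+
  then show ?thesis using assms by (auto simp: pedges_append)
qed

text \<open>A walk that meets two classes has a step that changes class. If the first step does not,
  both classes are still met by the rest of the walk.\<close>

lemma pedges_connected:
  assumes "set ys = A \<union> B" "A \<inter> B = {}" "A \<noteq> {}" "B \<noteq> {}"
  shows "\<exists>x y. {x, y} \<in> pedges ys \<and> x \<in> A \<and> y \<in> B"
  using assms
proof (induction ys arbitrary: A B rule: pedges.induct)
  case (1 x y zs)
  show ?case
  proof (cases "{x, y} \<subseteq> A \<or> {x, y} \<subseteq> B")
    case False
    then have "x \<in> A \<and> y \<in> B \<or> y \<in> A \<and> x \<in> B" using "1.prems" by auto
    then show ?thesis by (auto simp: insert_commute)
  next
    case True
    define A' B' where AB': "A' = A \<inter> set (y # zs)" "B' = B \<inter> set (y # zs)"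
    have sub: "set (y # zs) \<subseteq> A \<union> B" using "1.prems"(1) by auto
    have un: "set (y # zs) = A' \<union> B'" using sub unfolding AB' by blast
    have dis: "A' \<inter> B' = {}" using "1.prems"(2) unfolding AB' by blast
    obtain a b where ab: "a \<in> A" "b \<in> B" using "1.prems"(3,4) by blast
    then have "a \<in> set (x # y # zs)" "b \<in> set (x # y # zs)" using "1.prems"(1) by blast+
    then have ne: "A' \<noteq> {}" "B' \<noteq> {}" using True ab "1.prems"(2) unfolding AB' by auto
    show ?thesis using "1.IH"[OF un dis ne] unfolding AB' by auto
  qed
next
  case "2_1"
  then show ?case by simp
next
  case ("2_2" v)
  then have "A \<subseteq> {v}" "B \<subseteq> {v}" by auto
  then have "A = {v}" "B = {v}" using "2_2.prems" by blast+
  then show ?case using "2_2.prems" by blast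
qed

section \<open>Degrees in a path and replacement of an edge\<close>

lemma pedges_degree: "distinct xs \<Longrightarrow> card {e \<in> pedges xs. x \<in> e} \<le> 2"
proof (induction xs rule: pedges.induct)
  case (1 a b zs)
  have fin: "finite {e \<in> pedges (b # zs). x \<in> e}" by simp
  show ?case
  proof (cases "x = a")
    case True
    then have "{e \<in> pedges (b # zs). x \<in> e} = {}" using 1(2) pedges_subset_set by fastforce
    moreover have "{e \<in> pedges (a # b # zs). x \<in> e} \<subseteq> insert {a, b} {e \<in> pedges (b # zs). x \<in> e}"
      by auto
    ultimately have "{e \<in> pedges (a # b # zs). x \<in> e} \<subseteq> {{a, b}}" by blast
    then have "card {e \<in> pedges (a # b # zs). x \<in> e} \<le> card {{a, b}}" by (intro card_mono) auto
    then show ?thesis by simp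
  next
    case xa: False
    show ?thesis
    proof (cases "x = b")
      case True
      have "{e \<in> pedges (a # b # zs). x \<in> e} \<subseteq> {{a, b}, {b, hd zs}}"
      proof
        fix e assume e: "e \<in> {e \<in> pedges (a # b # zs). x \<in> e}"
        show "e \<in> {{a, b}, {b, hd zs}}"
        proof (cases zs)
          case (Cons c cs)
          have "e \<notin> pedges (c # cs)" using e True 1(2) Cons pedges_subset_set by fastforce
          then show ?thesis using e Cons by auto
        qed (use e in auto)
      qed
      then have "card {e \<in> pedges (a # b # zs). x \<in> e} \<le> card {{a, b}, {b, hd zs}}"
        by (intro card_mono) auto
      also have "\<dots> \<le> 2" by (simp add: card_insert_if)
      finally show ?thesis .
    next
      case False
      then have "{e \<in> pedges (a # b # zs). x \<in> e} = {e \<in> pedges (b # zs). x \<in> e}"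
        using xa by auto
      then show ?thesis using 1 by simp
    qed
  qed
qed auto

lemma pedges_degree3:
  assumes "distinct xs" "{x, a} \<in> pedges xs" "{x, b} \<in> pedges xs" "{x, c} \<in> pedges xs"
    and "a \<noteq> b" "a \<noteq> c" "b \<noteq> c"
  shows False
proof -
  have "card {{x, a}, {x, b}, {x, c}} \<le> card {e \<in> pedges xs. x \<in> e}"
    by (rule card_mono) (use assms in auto)
  moreover have "card {{x, a}, {x, b}, {x, c}} = 3"
    using assms(5-7) by (auto simp: card_insert_if doubleton_eq_iff)
  ultimately show False using pedges_degree[OF assms(1), of x] by simp
qed

lemma interior_edges:
  assumes "x \<in> set xs" "x \<noteq> hd xs" "x \<noteq> last xs" "distinct xs"
  shows "\<exists>a b. {x, a} \<in> pedges xs \<and> {x, b} \<in> pedges xs \<and> a \<noteq> b"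
proof -
  obtain us vs where xs: "xs = us @ x # vs" using assms(1) by (meson split_list)
  then have ne: "us \<noteq> []" "vs \<noteq> []" using assms by auto
  have "pedges xs = insert {last us, x} (pedges us \<union> insert {x, hd vs} (pedges vs))"
    using ne pedges_append[of us "x # vs"] pedges_append[of "[x]" vs] xs by auto
  moreover have "last us \<in> set us" "hd vs \<in> set vs" using ne by auto
  ultimately show ?thesis using assms(4) xs
    by (intro exI[of _ "last us"] exI[of _ "hd vs"]) (auto simp: insert_commute)
qed

text \<open>The edge that replaces a removed edge must join an end of one half to an end of the other
  half, because no vertex may get degree \<open>3\<close>.\<close>

lemma exchange_forms:
  assumes d: "distinct (as @ bs)" "as \<noteq> []" "bs \<noteq> []"
    and ys: "distinct ys" "set ys = set (as @ bs)" "pedges ys = insert f (pedges as \<union> pedges bs)"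
    and f: "f \<noteq> {last as, hd bs}"
  shows "f = {hd as, hd bs} \<or> f = {last as, last bs} \<or> f = {hd as, last bs}"
proof -
  \<comment> \<open>The new path is connected, and \<open>f\<close> is the only edge in it that can
    join the two halves.\<close>
  have "\<exists>x y. {x, y} \<in> pedges ys \<and> x \<in> set as \<and> y \<in> set bs"
    by (rule pedges_connected) (use d ys(2) in auto)
  then obtain x y where xy: "{x, y} \<in> pedges ys" "x \<in> set as" "y \<in> set bs" by blast
  have "{x, y} \<notin> pedges as" "{x, y} \<notin> pedges bs" using xy d(1) pedges_subset_set by fastforce+
  then have fxy: "f = {x, y}" using xy(1) ys(3) by auto
  have "x = hd as \<or> x = last as"
  proof (rule ccontr)
    assume "\<not> ?thesis"
    then obtain a b where ab: "{x, a} \<in> pedges as" "{x, b} \<in> pedges as" "a \<noteq> b"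
      using interior_edges[of x as] xy d by auto
    then have "a \<in> set as" "b \<in> set as" using pedges_subset_set by blast+
    then have "y \<noteq> a" "y \<noteq> b" using xy(3) d(1) by auto
    then show False using pedges_degree3[of ys x a b y] ab ys fxy by auto
  qed
  moreover have "y = hd bs \<or> y = last bs"
  proof (rule ccontr)
    assume "\<not> ?thesis"
    then obtain a b where ab: "{y, a} \<in> pedges bs" "{y, b} \<in> pedges bs" "a \<noteq> b"
      using interior_edges[of y bs] xy d by auto
    then have "a \<in> set bs" "b \<in> set bs" using pedges_subset_set by blast+
    then have "x \<noteq> a" "x \<noteq> b" using xy(2) d(1) by auto
    then show False using pedges_degree3[of ys y a b x] ab ys fxy by (auto simp: insert_commute)
  qed
  ultimately show ?thesis using f fxy by auto
qed

section \<open>Non-crossing paths on cyclically ordered points\<close>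

text \<open>Two chords of a convex polygon whose corners are numbered around it cross iff their ends
  alternate. The inequalities are strict, so chords with a common end do not cross.\<close>

definition interleaved :: "nat \<Rightarrow> nat \<Rightarrow> nat \<Rightarrow> nat \<Rightarrow> bool" where
  "interleaved a b c d \<longleftrightarrow>
     min a b < c \<and> c < max a b \<and> (d < min a b \<or> max a b < d) \<or>
     min a b < d \<and> d < max a b \<and> (c < min a b \<or> max a b < c)"

lemma interleaved_commute:
  "interleaved b a c d = interleaved a b c d" "interleaved a b d c = interleaved a b c d"
  by (auto simp: interleaved_def min.commute max.commute)

lemma interleaved_sym: "interleaved c d a b = interleaved a b c d"
  unfolding interleaved_def min_def max_def by (auto split: if_splits)

definition crosses :: "nat set \<Rightarrow> nat set \<Rightarrow> bool" where
  "crosses e f \<longleftrightarrow> (\<exists>a b c d. e = {a, b} \<and> f = {c, d} \<and> interleaved a b c d)"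

lemma crosses_doubleton [simp]: "crosses {a, b} {c, d} = interleaved a b c d"
  unfolding crosses_def by (auto simp: doubleton_eq_iff interleaved_commute)

lemma crosses_sym: "crosses e f \<Longrightarrow> crosses f e"
  unfolding crosses_def using interleaved_sym by metis

text \<open>The successor modulo \<open>n\<close>, written as a case distinction so that linear
  arithmetic can settle statements about the cycle.\<close>

definition next_pt :: "nat \<Rightarrow> nat \<Rightarrow> nat" where
  "next_pt n x = (if Suc x = n then 0 else Suc x)"

definition hull_edge :: "nat \<Rightarrow> nat \<Rightarrow> nat set" where
  "hull_edge n k = {k, next_pt n k}"

definition hull_edges :: "nat \<Rightarrow> nat set set" where
  "hull_edges n = hull_edge n ` {..<n}"

definition spanning_paths :: "nat \<Rightarrow> nat set set set" where
  "spanning_paths n = {pedges xs | xs. distinct xs \<and> set xs = {..<n}}"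

definition ncpaths :: "nat \<Rightarrow> nat set set set" where
  "ncpaths n = {S \<in> spanning_paths n. \<forall>e\<in>S. \<forall>f\<in>S. \<not> crosses e f}"

text \<open>Adjacency in the path graph for edges of any type, so that it can be transported along
  injective maps of the edges.\<close>

definition exchange :: "'a set \<Rightarrow> 'a set \<Rightarrow> bool" where
  "exchange A B \<longleftrightarrow> (\<exists>e f. e \<in> A \<and> f \<notin> A \<and> B = insert f (A - {e}))"

lemma nx_lt: "x < n \<Longrightarrow> next_pt n x < n" by (auto simp: next_pt_def)

lemma nx_inj: "x < n \<Longrightarrow> y < n \<Longrightarrow> next_pt n x = next_pt n y \<longleftrightarrow> x = y" by (auto simp: next_pt_def)

lemma nx_neq: "2 \<le> n \<Longrightarrow> next_pt n x \<noteq> x" by (auto simp: next_pt_def)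

lemma nx_mod: "x < n \<Longrightarrow> next_pt n x = Suc x mod n" by (auto simp: next_pt_def)

lemma hull_edges_iff:
  "{x, y} \<in> hull_edges n \<longleftrightarrow> x < n \<and> y < n \<and> (y = next_pt n x \<or> x = next_pt n y)"
  unfolding hull_edges_def hull_edge_def using nx_lt
  by (auto simp: image_iff doubleton_eq_iff) 

lemma he_inj: "3 \<le> n \<Longrightarrow> k < n \<Longrightarrow> l < n \<Longrightarrow> hull_edge n k = hull_edge n l \<longleftrightarrow> k = l"
  by (auto simp: hull_edge_def doubleton_eq_iff next_pt_def split: if_splits)

lemma card_hull_edges: "3 \<le> n \<Longrightarrow> card (hull_edges n) = n"
  unfolding hull_edges_def by (subst card_image) (auto simp: inj_on_def he_inj)

lemma he_in_hull [simp]: "k < n \<Longrightarrow> hull_edge n k \<in> hull_edges n" by (simp add: hull_edges_def)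

lemma finite_hull_edges [simp]: "finite (hull_edges n)" by (simp add: hull_edges_def)

text \<open>One of the two arcs between consecutive points is empty, so no chord can have an end
  strictly inside each arc.\<close>

lemma hull_not_interleaved:
  "{a, b} \<in> hull_edges n \<Longrightarrow> c < n \<Longrightarrow> d < n \<Longrightarrow> \<not> interleaved a b c d"
  unfolding hull_edges_iff interleaved_def next_pt_def by (auto split: if_splits)

lemma hull_third:
  assumes "{y, a} \<in> hull_edges n" "{y, b} \<in> hull_edges n" "{y, c} \<in> hull_edges n"
    and "a \<noteq> b" "a \<noteq> c" "b \<noteq> c"
  shows False
  using assms unfolding hull_edges_iff next_pt_def by (auto split: if_splits)

text \<open>The successor and the predecessor of \<open>b\<close> differ from \<open>a\<close>,
  because the chord is a diagonal, and they lie on different arcs between \<open>a\<close> and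
  \<open>b\<close>.\<close>

lemma diagonal_separates_neighbours:
  assumes "a < n" "b < n" "a \<noteq> b" "{a, b} \<notin> hull_edges n"
  shows "\<exists>y z. y < n \<and> z < n \<and> {y, b} \<in> hull_edges n \<and> {z, b} \<in> hull_edges n \<and> interleaved a b y z"
proof -
  define z where "z = (if b = 0 then n - 1 else b - 1)"
  show ?thesis
    by (rule exI[of _ "next_pt n b"], rule exI[of _ z])
       (use assms in \<open>auto simp: hull_edges_iff interleaved_def z_def next_pt_def split: if_splits\<close>)
qed

text \<open>The chord \<open>{x, z}\<close> cuts off the single point \<open>y\<close>, so a chord
  that crosses it has to end there.\<close>

lemma ear_interleaved:
  assumes "{x, y} \<in> hull_edges n" "{y, z} \<in> hull_edges n" "x \<noteq> z" "interleaved x z c d" "c < n" "d < n"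
  shows "c = y \<or> d = y"
  using assms unfolding hull_edges_iff interleaved_def next_pt_def by (auto split: if_splits)

text \<open>With only three points the chord would be the third hull edge, hence
  \<open>4 \<le> n\<close>.\<close>

lemma ear_not_hull:
  assumes "{x, y} \<in> hull_edges n" "{y, z} \<in> hull_edges n" "x \<noteq> z" "4 \<le> n"
  shows "{x, z} \<notin> hull_edges n"
  using assms unfolding hull_edges_iff next_pt_def by (auto split: if_splits)

text \<open>Away from the ends of a chord, crossing it means changing sides, and the side is a truth
  value. Hence crossings compose by exclusive or.\<close>

lemma interleaved_side:
  assumes "x \<noteq> a" "x \<noteq> b" "y \<noteq> a" "y \<noteq> b"
  shows "interleaved a b x y \<longleftrightarrow>
    (min a b < x \<and> x < max a b) \<noteq> (min a b < y \<and> y < max a b)"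
proof -
  have "x \<noteq> min a b" "x \<noteq> max a b" "y \<noteq> min a b" "y \<noteq> max a b" "min a b \<le> max a b"
    using assms by (auto simp: min_def max_def)
  then show ?thesis unfolding interleaved_def by linarith
qed

lemma interleaved_side_trans:
  assumes "x \<noteq> a" "x \<noteq> b" "y \<noteq> a" "y \<noteq> b" "z \<noteq> a" "z \<noteq> b"
  shows "interleaved a b x z \<longleftrightarrow> (interleaved a b x y \<noteq> interleaved a b y z)"
  using interleaved_side[of x a b y] interleaved_side[of y a b z] interleaved_side[of x a b z] assms
  by blast

lemma spanning_paths_edge:
  assumes "S \<in> spanning_paths n" "e \<in> S"
  obtains x y where "e = {x, y}" "x \<noteq> y" "x < n" "y < n"
proof -
  obtain xs where xs: "S = pedges xs" "distinct xs" "set xs = {..<n}"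
    using assms by (auto simp: spanning_paths_def)
  with pedges_doubleton[of e xs] assms(2) that show thesis by auto
qed

lemma hull_not_crosses:
  assumes "e \<in> hull_edges n" "f \<in> hull_edges n \<or> f \<in> S" "S \<in> spanning_paths n"
  shows "\<not> crosses e f" "\<not> crosses f e"
proof -
  obtain a where e: "e = {a, next_pt n a}" "a < n" using assms(1) by (auto simp: hull_edges_def hull_edge_def)
  have "\<exists>c d. f = {c, d} \<and> c < n \<and> d < n"
    using assms(2)
  proof
    assume "f \<in> hull_edges n"
    then show ?thesis using nx_lt by (auto simp: hull_edges_def hull_edge_def)
  next
    assume "f \<in> S"
    then show ?thesis using spanning_paths_edge[OF assms(3)] by blast
  qed
  then obtain c d where f: "f = {c, d}" "c < n" "d < n" by blast
  have "\<not> interleaved a (next_pt n a) c d"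
    by (rule hull_not_interleaved) (use e f assms(1) in auto)
  then show "\<not> crosses e f" "\<not> crosses f e" using e f interleaved_sym by auto
qed

text \<open>Hull edges cross nothing, so replacing edges of a non-crossing path by hull edges cannot
  create a crossing.\<close>

lemma ncpathsI:
  assumes S: "S \<in> spanning_paths n" and T: "T \<in> ncpaths n" and sub: "S \<subseteq> T \<union> hull_edges n"
  shows "S \<in> ncpaths n"
proof -
  have T': "T \<in> spanning_paths n" using T by (simp add: ncpaths_def)
  have "\<not> crosses e f" if "e \<in> S" "f \<in> S" for e f
    using that sub T hull_not_crosses[OF _ _ T'] unfolding ncpaths_def by blast
  then show ?thesis using S by (simp add: ncpaths_def)
qed

text \<open>A single diagonal crosses neither hull edges nor itself.\<close>

lemma ncpathsI1:
  assumes S: "S \<in> spanning_paths n" and sub: "S \<subseteq> insert f (hull_edges n)"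
  shows "S \<in> ncpaths n"
proof -
  have "\<not> crosses e g" if eg: "e \<in> S" "g \<in> S" for e g
  proof (cases "e \<in> hull_edges n \<or> g \<in> hull_edges n")
    case True
    then show ?thesis using hull_not_crosses[OF _ _ S] eg by blast
  next
    case False
    then have "e = f" "g = f" using eg sub by auto
    moreover obtain x y where "e = {x, y}" using spanning_paths_edge[OF S eg(1)] by blast
    moreover have "\<not> interleaved x y x y" by (simp add: interleaved_def)
    ultimately show ?thesis by (metis crosses_doubleton)
  qed
  then show ?thesis using S by (simp add: ncpaths_def)
qed

text \<open>The elements of \<open>ncpaths\<close> are edge sets, which have no direction. Arguments
  about a first and a last diagonal need a sequence, which this predicate provides.\<close>

definition noncrossing :: "nat \<Rightarrow> nat list \<Rightarrow> bool" where
  "noncrossing n xs \<longleftrightarrow> distinct xs \<and> set xs = {..<n} \<and> (\<forall>e\<in>pedges xs. \<forall>f\<in>pedges xs. \<not> crosses e f)"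

lemma nc_rev: "noncrossing n xs \<Longrightarrow> noncrossing n (rev xs)"
  by (simp add: noncrossing_def)

lemma nc_append_rev: "noncrossing n (as @ bs) \<Longrightarrow> noncrossing n (rev bs @ rev as)"
  using nc_rev[of n "as @ bs"] by simp

lemma ncpaths_nc: "v \<in> ncpaths n \<longleftrightarrow> (\<exists>xs. v = pedges xs \<and> noncrossing n xs)"
  unfolding ncpaths_def spanning_paths_def noncrossing_def by blast

section \<open>Diagonals separate the two ends of a path\<close>

lemma interleaved_distinct:
  "interleaved a b c d \<Longrightarrow> c \<noteq> a \<and> c \<noteq> b \<and> d \<noteq> a \<and> d \<noteq> b"
  unfolding interleaved_def by auto

text \<open>A walk that changes sides must use an edge that crosses the chord.\<close>

lemma pedges_same_side:
  assumes "\<forall>e\<in>pedges zs. \<not> crosses {a, b} e" "a \<notin> set zs" "b \<notin> set zs" "x \<in> set zs" "y \<in> set zs"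
  shows "\<not> interleaved a b x y"
proof -
  let ?S = "\<lambda>x. min a b < x \<and> x < max a b"
  have "\<forall>x\<in>set zs. ?S x = ?S (hd zs)"
    using assms(1-3)
  proof (induction zs rule: pedges.induct)
    case (1 u v zs)
    then have "\<forall>x\<in>set (v # zs). ?S x = ?S v" by simp
    moreover have "\<not> interleaved a b u v" using 1(2) by simp
    then have "?S u = ?S v" using interleaved_side[of u a b v] 1(3,4) by auto
    ultimately show ?case by auto
  qed auto
  then have "?S x = ?S y" using assms(4,5) by blast
  then show ?thesis using interleaved_side[of x a b y] assms by blast
qed

lemma last_neq_hd:
  "distinct (as @ bs) \<Longrightarrow> as \<noteq> [] \<Longrightarrow> bs \<noteq> [] \<Longrightarrow> last as \<noteq> hd bs"
  by (metis disjoint_iff distinct_append hd_in_set last_in_set)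

lemma last_hd_in: "as \<noteq> [] \<Longrightarrow> x \<in> set as \<Longrightarrow> x = last as \<or> x \<in> set (butlast as)"
  "bs \<noteq> [] \<Longrightarrow> x \<in> set bs \<Longrightarrow> x = hd bs \<or> x \<in> set (tl bs)"
proof -
  assume "as \<noteq> []" "x \<in> set as"
  then show "x = last as \<or> x \<in> set (butlast as)"
    by (metis append_butlast_last_id in_set_conv_decomp rotate1.simps(2) set_ConsD set_rotate1)
next
  assume "bs \<noteq> []" "x \<in> set bs"
  then show "x = hd bs \<or> x \<in> set (tl bs)" by (cases bs) auto
qed

text \<open>The points before the diagonal lie on one side of it, and so do the points after it,
  since no edge crosses. Some points lie on either side, namely the two hull neighbours of
  \<open>hd bs\<close>. So the two parts occupy different sides, and neither is empty.\<close>

lemma diagonal_separates: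
  assumes noncrossing: "noncrossing n (as @ bs)" and ne: "as \<noteq> []" "bs \<noteq> []"
    and diag: "{last as, hd bs} \<notin> hull_edges n"
  shows "\<And>x y. x \<in> set (butlast as) \<Longrightarrow> y \<in> set (tl bs) \<Longrightarrow> interleaved (last as) (hd bs) x y"
    and "butlast as \<noteq> []" and "tl bs \<noteq> []"
proof -
  let ?a = "last as" and ?b = "hd bs"
  have as: "as = butlast as @ [?a]" and bs: "bs = [?b] @ tl bs" using ne by simp_all
  have d: "distinct (as @ bs)" "set (as @ bs) = {..<n}" using noncrossing by (simp_all add: noncrossing_def)
  have "distinct ((butlast as @ [?a]) @ ([?b] @ tl bs))"
    using d(1) by (simp only: as[symmetric] bs[symmetric])
  then have dis: "distinct (butlast as @ [?a] @ [?b] @ tl bs)" by simp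
  have notin: "?a \<notin> set (butlast as)" "?b \<notin> set (butlast as)" "?a \<notin> set (tl bs)" "?b \<notin> set (tl bs)"
    using dis by auto
  have edge: "{?a, ?b} \<in> pedges (as @ bs)" using ne by (simp add: pedges_append)
  have sub: "pedges (butlast as) \<subseteq> pedges (as @ bs)" "pedges (tl bs) \<subseteq> pedges (as @ bs)"
    using pedges_append_subset as bs by (metis subset_trans)+
  have A: "\<not> interleaved ?a ?b x y" if "x \<in> set (butlast as)" "y \<in> set (butlast as)" for x y
    using noncrossing sub(1) edge notin that by (intro pedges_same_side[of "butlast as"]) (auto simp: noncrossing_def)
  have B: "\<not> interleaved ?a ?b x y" if "x \<in> set (tl bs)" "y \<in> set (tl bs)" for x y
    using noncrossing sub(2) edge notin that by (intro pedges_same_side[of "tl bs"]) (auto simp: noncrossing_def)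
  have ab: "?a < n" "?b < n" "?a \<noteq> ?b"
    using d ne dis by auto
  obtain y z where yz: "y < n" "z < n" "interleaved ?a ?b y z"
    using diagonal_separates_neighbours[OF ab diag] by blast
  have mem: "w \<in> set (butlast as) \<or> w \<in> set (tl bs)" if "w < n" "w \<noteq> ?a" "w \<noteq> ?b" for w
  proof -
    have "w \<in> set as \<or> w \<in> set bs" using d(2) that(1) by auto
    then show ?thesis using last_hd_in ne that by metis
  qed
  have "y \<in> set (butlast as) \<or> y \<in> set (tl bs)" "z \<in> set (butlast as) \<or> z \<in> set (tl bs)"
    using mem yz interleaved_distinct by metis+
  \<comment> \<open>Separated points cannot belong to the same part; their roles are exchanged if
    necessary.\<close>
  then obtain y z where yz: "y \<in> set (butlast as)" "z \<in> set (tl bs)" "interleaved ?a ?b y z"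
    using A B yz interleaved_commute by metis
  then show "butlast as \<noteq> []" "tl bs \<noteq> []" by auto
  fix x w assume xw: "x \<in> set (butlast as)" "w \<in> set (tl bs)"
  have "interleaved ?a ?b x z"
    using interleaved_side_trans[of x ?a ?b y z] A[OF xw(1) yz(1)] yz xw notin by metis
  then show "interleaved ?a ?b x w"
    using interleaved_side_trans[of x ?a ?b z w] B[OF yz(2) xw(2)] yz xw notin by metis
qed

lemma diagonal_ends:
  assumes "noncrossing n (as @ bs)" "as \<noteq> []" "bs \<noteq> []" "{last as, hd bs} \<notin> hull_edges n"
  shows "hd as \<in> set (butlast as)" "last bs \<in> set (tl bs)" "hd as \<noteq> last as" "hd bs \<noteq> last bs"
proof -
  note ne = diagonal_separates(2,3)[OF assms]
  show h: "hd as \<in> set (butlast as)" using ne(1) by (cases as) (auto split: if_splits)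
  show l: "last bs \<in> set (tl bs)" using ne(2) by (cases bs) auto
  have "distinct as" "distinct bs" using assms(1) by (simp_all add: noncrossing_def)
  then have "distinct (butlast as @ [last as])" "distinct (hd bs # tl bs)"
    using assms(2,3) by (metis append_butlast_last_id, metis list.collapse)
  then show "hd as \<noteq> last as" "hd bs \<noteq> last bs" using h l by auto
qed

text \<open>These are the three ways to rejoin two halves, seen as operations on lists: reverse the
  front, reverse the back, or swap the halves.\<close>

lemma pedges_rev_append:
  assumes "distinct (as @ bs)" "as \<noteq> []" "bs \<noteq> []"
  shows "pedges (rev as @ bs) = insert {hd as, hd bs} (pedges (as @ bs) - {{last as, hd bs}})"
    "pedges (as @ rev bs) = insert {last as, last bs} (pedges (as @ bs) - {{last as, hd bs}})"
    "pedges (bs @ as) = insert {hd as, last bs} (pedges (as @ bs) - {{last as, hd bs}})"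
  unfolding pedges_remove[OF assms] using assms
  by (simp_all add: pedges_append last_rev hd_rev insert_commute Un_commute)

text \<open>One hull neighbour of \<open>hd bs\<close> lies on the side of the front part, hence in
  that part, and differs from the end of the diagonal. If it were an inner point of the front part,
  it would lie on two hull edges there and on a third one to \<open>hd bs\<close>. So it is the
  start of the path.\<close>

lemma first_diagonal_hull:
  assumes noncrossing: "noncrossing n (as @ bs)" and ne: "as \<noteq> []" "bs \<noteq> []"
    and diag: "{last as, hd bs} \<notin> hull_edges n" and hull: "pedges as \<subseteq> hull_edges n"
  shows "{hd as, hd bs} \<in> hull_edges n"
proof -
  let ?a = "last as" and ?b = "hd bs"
  have d: "distinct (as @ bs)" "set (as @ bs) = {..<n}" using noncrossing by (simp_all add: noncrossing_def)
  have ab: "?a < n" "?b < n" "?a \<noteq> ?b" using d ne last_neq_hd[OF d(1) ne] by auto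
  obtain y z where yz: "y < n" "z < n" "{y, ?b} \<in> hull_edges n" "{z, ?b} \<in> hull_edges n"
      "interleaved ?a ?b y z"
    using diagonal_separates_neighbours[OF ab diag] by blast
  have x: "hd as \<in> set (butlast as)" using diagonal_ends[OF noncrossing ne diag] by simp
  have dist: "y \<noteq> ?a" "y \<noteq> ?b" "z \<noteq> ?a" "z \<noteq> ?b" using interleaved_distinct[OF yz(5)] by auto
  have "?a \<in> set as" "?b \<in> set bs" "hd as \<in> set as" using ne by auto
  then have notin: "?b \<notin> set as" "?a \<notin> set bs" "?a \<noteq> hd as" "?b \<noteq> hd as"
    using d(1) diagonal_ends[OF noncrossing ne diag] by auto
  have side: "interleaved ?a ?b (hd as) w \<or> w \<in> set as" if "w < n" "w \<noteq> ?b" for w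
  proof -
    have "w \<in> set as \<or> w \<in> set bs" using d(2) that(1) by auto
    then show ?thesis
      using last_hd_in(2)[of bs w] ne that diagonal_separates(1)[OF noncrossing ne diag x] by blast
  qed
  have "\<not> interleaved ?a ?b (hd as) y \<or> \<not> interleaved ?a ?b (hd as) z"
    using interleaved_side_trans[of y ?a ?b "hd as" z] yz(5) dist notin interleaved_commute by metis
  then obtain w where w: "w \<in> set as" "{w, ?b} \<in> hull_edges n" "w \<noteq> ?a"
    using side yz dist by metis
  have "w = hd as"
  proof (rule ccontr)
    assume "w \<noteq> hd as"
    then obtain p q where pq: "{w, p} \<in> pedges as" "{w, q} \<in> pedges as" "p \<noteq> q"
      using interior_edges[OF w(1)] w(3) d by auto
    then have "p \<in> set as" "q \<in> set as" using pedges_subset_set by blast+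
    then have "p \<noteq> ?b" "q \<noteq> ?b" using notin by auto
    then show False using hull_third[of w p n q ?b] pq w(2) hull by blast
  qed
  with w show ?thesis by simp
qed

lemma hull_notin_across:
  assumes noncrossing: "noncrossing n (as @ bs)" and ne: "as \<noteq> []" "bs \<noteq> []"
    and diag: "{last as, hd bs} \<notin> hull_edges n"
  shows "{hd as, hd bs} \<notin> pedges (as @ bs)"
  using pedges_crossing_edge[of as bs "hd as" "hd bs"] noncrossing ne diagonal_ends[OF noncrossing ne diag]
  by (auto simp: noncrossing_def)

text \<open>The front part is reversed; the only new edge is a hull edge, which cannot create a
  crossing.\<close>

lemma first_diagonal_exchange:
  assumes noncrossing: "noncrossing n (as @ bs)" and ne: "as \<noteq> []" "bs \<noteq> []"
    and diag: "{last as, hd bs} \<notin> hull_edges n" and hull: "pedges as \<subseteq> hull_edges n"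
  shows "insert {hd as, hd bs} (pedges (as @ bs) - {{last as, hd bs}}) \<in> ncpaths n"
proof -
  have d: "distinct (as @ bs)" "set (as @ bs) = {..<n}" using noncrossing by (simp_all add: noncrossing_def)
  have v: "pedges (as @ bs) \<in> ncpaths n" using noncrossing ncpaths_nc by blast
  have "pedges (rev as @ bs) \<in> spanning_paths n"
    unfolding spanning_paths_def using d by (intro CollectI exI[of _ "rev as @ bs"]) auto
  then have "pedges (rev as @ bs) \<in> ncpaths n"
    by (rule ncpathsI[OF _ v])
       (use first_diagonal_hull[OF assms] in \<open>auto simp: pedges_rev_append(1)[OF d(1) ne]\<close>)
  then show ?thesis by (simp add: pedges_rev_append(1)[OF d(1) ne])
qed

lemma first_diagonal_ex:
  "\<not> pedges xs \<subseteq> H \<Longrightarrow> \<exists>as bs. xs = as @ bs \<and> as \<noteq> [] \<and> bs \<noteq> [] \<and> {last as, hd bs} \<notin> H \<and> pedges as \<subseteq> H"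
proof (induction xs rule: pedges.induct)
  case (1 x y zs)
  show ?case
  proof (cases "{x, y} \<in> H")
    case False
    then show ?thesis by (intro exI[of _ "[x]"] exI[of _ "y # zs"]) simp
  next
    case True
    with 1 obtain as bs where *: "y # zs = as @ bs" "as \<noteq> []" "bs \<noteq> []" "{last as, hd bs} \<notin> H"
        "pedges as \<subseteq> H"
      by auto
    moreover have "pedges (x # as) \<subseteq> H" using * True by (cases as) auto
    ultimately show ?thesis by (intro exI[of _ "x # as"] exI[of _ bs]) simp
  qed
qed auto

text \<open>A diagonal separates the two ends of a non-crossing path, so an edge that closes the gap left
  by another edge would cross it.\<close>

lemma front_exchange_first:
  assumes noncrossing: "noncrossing n (as @ bs)" and ne: "as \<noteq> []" "bs \<noteq> []"
    and h: "{hd as, hd bs} \<in> hull_edges n"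
  shows "pedges as \<subseteq> hull_edges n"
proof (rule ccontr)
  assume "\<not> ?thesis"
  then obtain cs ds where cd: "as = cs @ ds" "cs \<noteq> []" "ds \<noteq> []" "{last cs, hd ds} \<notin> hull_edges n"
    using first_diagonal_ex by blast
  have nc': "noncrossing n (cs @ (ds @ bs))" using noncrossing cd by simp
  have diag: "{last cs, hd (ds @ bs)} \<notin> hull_edges n" using cd by simp
  have "hd cs \<in> set (butlast cs)" using diagonal_ends[OF nc' cd(2) _ diag] ne by simp
  moreover have "hd bs \<in> set (tl (ds @ bs))" using cd(3) ne by simp
  ultimately have "interleaved (last cs) (hd ds) (hd cs) (hd bs)"
    using diagonal_separates(1)[OF nc' cd(2) _ diag] cd(3) by simp
  moreover have "last cs < n" "hd ds < n" using noncrossing cd by (auto simp: noncrossing_def)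
  ultimately show False
    using hull_not_interleaved[OF h, of "last cs" "hd ds"] cd interleaved_sym by auto
qed

text \<open>The two ends of the path lie on different sides of every diagonal. This excludes the
  third form in \<open>exchange_forms\<close> whenever a diagonal stays in the path or a hull edge
  is inserted.\<close>

lemma ends_not_hull:
  assumes noncrossing: "noncrossing n (as @ bs)" and ne: "as \<noteq> []" "bs \<noteq> []"
    and diag: "{last as, hd bs} \<notin> hull_edges n"
  shows "{hd as, last bs} \<notin> hull_edges n" "crosses {last as, hd bs} {hd as, last bs}"
proof -
  have i: "interleaved (last as) (hd bs) (hd as) (last bs)"
    using diagonal_separates(1)[OF assms] diagonal_ends[OF assms] by blast
  have "last as < n" "hd bs < n" using noncrossing ne by (auto simp: noncrossing_def)
  then show "{hd as, last bs} \<notin> hull_edges n"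
    using hull_not_interleaved[of "hd as" "last bs" n "last as" "hd bs"] i interleaved_sym by auto
  show "crosses {last as, hd bs} {hd as, last bs}" using i by simp
qed

text \<open>Of the three forms in \<open>exchange_forms\<close>, joining the two ends of the path
  does not give a hull edge. Each of the others gives one only if the part that is reversed has no
  diagonal.\<close>

lemma hull_exchange:
  assumes noncrossing: "noncrossing n (as @ bs)" and ne: "as \<noteq> []" "bs \<noteq> []"
    and diag: "{last as, hd bs} \<notin> hull_edges n"
    and h: "h \<in> hull_edges n" "h \<notin> pedges (as @ bs)"
    and ex: "insert h (pedges (as @ bs) - {{last as, hd bs}}) \<in> ncpaths n"
  shows "h = {hd as, hd bs} \<and> pedges as \<subseteq> hull_edges n \<or>
    h = {last as, last bs} \<and> pedges bs \<subseteq> hull_edges n"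
proof -
  have d: "distinct (as @ bs)" "set (as @ bs) = {..<n}" using noncrossing by (simp_all add: noncrossing_def)
  obtain ys where ys: "insert h (pedges (as @ bs) - {{last as, hd bs}}) = pedges ys" "distinct ys"
      "set ys = {..<n}"
    using ex by (auto simp: ncpaths_nc noncrossing_def)
  have "h = {hd as, hd bs} \<or> h = {last as, last bs} \<or> h = {hd as, last bs}"
  proof (rule exchange_forms[OF d(1) ne ys(2)])
    show "set ys = set (as @ bs)" using ys d by simp
    show "pedges ys = insert h (pedges as \<union> pedges bs)"
      using ys(1) unfolding pedges_remove[OF d(1) ne] by simp
    show "h \<noteq> {last as, hd bs}" using diag h(1) by auto
  qed
  moreover have "pedges as \<subseteq> hull_edges n" if "h = {hd as, hd bs}"
    using front_exchange_first[OF noncrossing ne] h(1) that by simp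
  moreover have "pedges bs \<subseteq> hull_edges n" if "h = {last as, last bs}"
    using front_exchange_first[OF nc_append_rev[OF noncrossing]] h(1) that ne
    by (simp add: hd_rev insert_commute)
  moreover have "h \<noteq> {hd as, last bs}"
    using ends_not_hull(1)[OF noncrossing ne diag] h(1) by auto
  ultimately show ?thesis by blast
qed

lemma diagonals_split:
  assumes noncrossing: "noncrossing n (as @ bs)" and ne: "as \<noteq> []" "bs \<noteq> []"
    and "pedges as \<subseteq> H" "pedges bs \<subseteq> H"
  shows "pedges (as @ bs) - H \<subseteq> {{last as, hd bs}}"
  using assms by (auto simp: pedges_append)

lemma split_unique:
  assumes "distinct (as @ bs)" "as @ bs = cs @ ds" "as \<noteq> []" "bs \<noteq> []" "cs \<noteq> []" "ds \<noteq> []"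
    "{last as, hd bs} = {last cs, hd ds}"
  shows "as = cs \<and> bs = ds"
proof -
  consider us where "us \<noteq> []" "as = cs @ us" "ds = us @ bs" | "as = cs" "bs = ds"
    | us where "us \<noteq> []" "cs = as @ us" "bs = us @ ds"
    using assms(2) by (auto simp: append_eq_append_conv2)
  then show ?thesis
  proof cases
    case 1
    then have "hd ds \<in> set as" "last cs \<in> set as" "hd bs \<in> set bs" using assms by auto
    then have "hd bs \<noteq> hd ds" "hd bs \<noteq> last cs" using assms(1) by auto
    then show ?thesis using assms(7) by (auto simp: doubleton_eq_iff)
  next
    case 3
    then have "hd ds \<in> set bs" "last cs \<in> set bs" "last as \<in> set as" using assms by auto
    then have "last as \<noteq> last cs" "last as \<noteq> hd ds" using assms(1) by auto
    then show ?thesis using assms(7) by (auto simp: doubleton_eq_iff)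
  qed auto
qed

text \<open>\<open>f1\<close> is the first and \<open>f2\<close> the last diagonal along the path;
  \<open>h1\<close> and \<open>h2\<close> are the hull edges by which the adjoining end parts are
  reattached. With a single diagonal \<open>f1 = f2\<close>, but both end parts can be reversed, so
  there are still two exchanges. With more diagonals the two end parts are disjoint, and both
  exchanges can be made one after the other.\<close>

lemma lower_neighbours:
  assumes v: "v \<in> ncpaths n" "\<not> v \<subseteq> hull_edges n"
  shows "\<exists>f1 f2 h1 h2. f1 \<in> v - hull_edges n \<and> f2 \<in> v - hull_edges n \<and>
    h1 \<in> hull_edges n - v \<and> h2 \<in> hull_edges n - v \<and> h1 \<noteq> h2 \<and>
    (\<forall>f\<in>v - hull_edges n. \<forall>h\<in>hull_edges n - v.
      insert h (v - {f}) \<in> ncpaths n \<longleftrightarrow> (f = f1 \<and> h = h1) \<or> (f = f2 \<and> h = h2)) \<and>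
    (2 \<le> card (v - hull_edges n) \<longrightarrow>
      f1 \<noteq> f2 \<and> insert h2 (insert h1 (v - {f1}) - {f2}) \<in> ncpaths n)"
proof -
  obtain xs where xs: "v = pedges xs" "noncrossing n xs" using v(1) ncpaths_nc by blast
  have d: "distinct xs" "set xs = {..<n}" using xs by (simp_all add: noncrossing_def)
  obtain as bs where ab: "xs = as @ bs" "as \<noteq> []" "bs \<noteq> []" "{last as, hd bs} \<notin> hull_edges n"
      "pedges as \<subseteq> hull_edges n"
    using first_diagonal_ex v(2) xs by blast
  \<comment> \<open>The last diagonal is the first one of the reversed path.\<close>
  obtain ds' cs' where dc: "rev xs = ds' @ cs'" "ds' \<noteq> []" "cs' \<noteq> []" "{last ds', hd cs'} \<notin> hull_edges n"
      "pedges ds' \<subseteq> hull_edges n"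
    using first_diagonal_ex[of "rev xs" "hull_edges n"] v(2) xs by auto
  define cs ds where csds: "cs = rev cs'" "ds = rev ds'"
  have "xs = rev (ds' @ cs')" using dc(1) by (metis rev_rev_ident)
  then have cd: "xs = cs @ ds" "cs \<noteq> []" "ds \<noteq> []" "{last cs, hd ds} \<notin> hull_edges n"
      "pedges ds \<subseteq> hull_edges n"
    using dc by (simp_all add: csds hd_rev last_rev insert_commute)
  define f1 h1 f2 h2 where fh: "f1 = {last as, hd bs}" "h1 = {hd as, hd bs}"
    "f2 = {last cs, hd ds}" "h2 = {last cs, last ds}"
  have nc1: "noncrossing n (as @ bs)" and nc2: "noncrossing n (cs @ ds)" using xs ab cd by simp_all
  have v1: "v = pedges (as @ bs)" and v2: "v = pedges (cs @ ds)" using xs ab cd by simp_all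
  have f1v: "f1 \<in> v" unfolding fh v1 using ab by (simp add: pedges_append)
  have f2v: "f2 \<in> v" unfolding fh v2 using cd by (simp add: pedges_append)
  have h1: "h1 \<in> hull_edges n" "h1 \<notin> v"
    using first_diagonal_hull[OF nc1 ab(2-5)] hull_notin_across[OF nc1 ab(2-4)] by (simp_all add: fh v1)
  have nc2': "noncrossing n (rev ds @ rev cs)" by (rule nc_append_rev[OF nc2])
  have cd': "rev ds \<noteq> []" "rev cs \<noteq> []" "{last (rev ds), hd (rev cs)} \<notin> hull_edges n"
      "pedges (rev ds) \<subseteq> hull_edges n"
    using cd by (simp_all add: hd_rev last_rev insert_commute)
  have v2': "pedges (rev ds @ rev cs) = v" using v2 pedges_rev[of "cs @ ds"] by simp
  have eq2: "{hd (rev ds), hd (rev cs)} = h2" "{last (rev ds), hd (rev cs)} = f2"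
    using cd by (simp_all add: fh hd_rev last_rev insert_commute)
  have h2: "h2 \<in> hull_edges n" "h2 \<notin> v"
    using first_diagonal_hull[OF nc2' cd'] hull_notin_across[OF nc2' cd'(1-3)]
    unfolding v2' eq2 by simp_all
  have u1: "insert h1 (v - {f1}) \<in> ncpaths n"
    using first_diagonal_exchange[OF nc1 ab(2-5)] by (simp add: fh v1)
  have u2: "insert h2 (v - {f2}) \<in> ncpaths n"
    using first_diagonal_exchange[OF nc2' cd'] unfolding v2' eq2 .
  have neq: "h1 \<noteq> h2"
  proof
    assume "h1 = h2"
    then have "hd as = last cs \<or> hd as = last ds" by (auto simp: fh doubleton_eq_iff)
    moreover have "hd xs = hd as" unfolding ab(1) using ab(2) by simp
    moreover have "hd xs = hd cs" unfolding cd(1) using cd(2) by simp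
    moreover have "hd cs \<noteq> last cs" using diagonal_ends[OF nc2 cd(2-4)] by simp
    moreover have "hd cs \<in> set cs" "last ds \<in> set ds" using cd by auto
    then have "hd cs \<noteq> last ds" using d(1) unfolding cd(1) by auto
    ultimately show False by simp
  qed
  have iff: "insert h (v - {f}) \<in> ncpaths n \<longleftrightarrow> (f = f1 \<and> h = h1) \<or> (f = f2 \<and> h = h2)"
    if f: "f \<in> v - hull_edges n" and h: "h \<in> hull_edges n - v" for f h
  proof
    assume ins: "insert h (v - {f}) \<in> ncpaths n"
    obtain ps qs where pq: "xs = ps @ qs" "ps \<noteq> []" "qs \<noteq> []" "f = {last ps, hd qs}"
      using pedges_split[of f xs] f xs by auto
    have nc3: "noncrossing n (ps @ qs)" using pq xs by simp
    have "h = {hd ps, hd qs} \<and> pedges ps \<subseteq> hull_edges n \<or>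
        h = {last ps, last qs} \<and> pedges qs \<subseteq> hull_edges n"
      by (rule hull_exchange[OF nc3 pq(2,3)]) (use f h ins pq xs in auto)
    then show "(f = f1 \<and> h = h1) \<or> (f = f2 \<and> h = h2)"
    proof (elim disjE conjE)
      assume hh: "h = {hd ps, hd qs}" and sub: "pedges ps \<subseteq> hull_edges n"
      have e: "as @ bs = ps @ qs" using ab pq by simp
      \<comment> \<open>Both cuts are at the first edge that is not a hull edge, so they
        agree.\<close>
      have "as = ps \<and> bs = qs"
        using e[unfolded append_eq_append_conv2]
      proof (elim exE disjE conjE)
        fix us assume "as = ps @ us" "us @ bs = qs"
        then have us: "as = ps @ us" "qs = us @ bs" by simp_all
        show ?thesis
        proof (cases "us = []")
          case False
          then have "f \<in> pedges as" using us pq by (simp add: pedges_append)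
          then show ?thesis using ab(5) f by blast
        qed (use us in simp)
      next
        fix us assume "as @ us = ps" "bs = us @ qs"
        then have us: "ps = as @ us" "bs = us @ qs" by simp_all
        show ?thesis
        proof (cases "us = []")
          case False
          then have "f1 \<in> pedges ps" using us ab(2) by (auto simp: pedges_append fh)
          then show ?thesis using sub ab(4) by (auto simp: fh)
        qed (use us in simp)
      qed
      then show ?thesis using hh pq by (simp add: fh)
    next
      assume hh: "h = {last ps, last qs}" and sub: "pedges qs \<subseteq> hull_edges n"
      have e: "cs @ ds = ps @ qs" using cd pq by simp
      have "cs = ps \<and> ds = qs"
        using e[unfolded append_eq_append_conv2]
      proof (elim exE disjE conjE)
        fix us assume "cs = ps @ us" "us @ ds = qs"
        then have us: "cs = ps @ us" "qs = us @ ds" by simp_all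
        show ?thesis
        proof (cases "us = []")
          case False
          then have "f2 \<in> pedges qs" using us cd by (auto simp: pedges_append fh)
          then show ?thesis using sub cd(4) by (auto simp: fh)
        qed (use us in simp)
      next
        fix us assume "cs @ us = ps" "ds = us @ qs"
        then have us: "ps = cs @ us" "ds = us @ qs" by simp_all
        show ?thesis
        proof (cases "us = []")
          case False
          then have "f \<in> pedges ds" using us pq by (auto simp: pedges_append)
          then show ?thesis using cd(5) f by blast
        qed (use us in simp)
      qed
      then show ?thesis using hh pq by (simp add: fh)
    qed
  qed (use u1 u2 in auto)
  have sq: "f1 \<noteq> f2 \<and> insert h2 (insert h1 (v - {f1}) - {f2}) \<in> ncpaths n"
    if two: "2 \<le> card (v - hull_edges n)"
  proof
    show ne12: "f1 \<noteq> f2"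
    proof
      assume eq: "f1 = f2"
      have "as = cs \<and> bs = ds"
        by (rule split_unique) (use d ab cd eq in \<open>auto simp: fh\<close>)
      then have "v - hull_edges n \<subseteq> {f1}"
        using diagonals_split[OF nc1 ab(2,3,5)] cd(5) v1 by (simp add: fh)
      then have "card (v - hull_edges n) \<le> card {f1}" by (intro card_mono) auto
      then show False using two by simp
    qed
    have e: "as @ bs = cs @ ds" using ab cd by simp
    \<comment> \<open>The cuts differ and the first diagonal comes before the last one;
      \<open>ms\<close> is the part between them.\<close>
    obtain ms where ms: "ms \<noteq> []" "cs = as @ ms" "bs = ms @ ds"
    proof -
      from e[unfolded append_eq_append_conv2] show thesis
      proof (elim exE disjE conjE)
        fix us assume "as = cs @ us" "us @ bs = ds"
        then have us: "as = cs @ us" "ds = us @ bs" by simp_all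
        show thesis
        proof (cases "us = []")
          case True
          then show ?thesis using us ne12 by (simp add: fh)
        next
          case False
          then have "f2 \<in> pedges as" using us cd by (auto simp: pedges_append fh)
          then show ?thesis using ab(5) cd(4) by (auto simp: fh)
        qed
      next
        fix us assume "as @ us = cs" "bs = us @ ds"
        then have us: "cs = as @ us" "bs = us @ ds" by simp_all
        show thesis
        proof (cases "us = []")
          case True
          then show ?thesis using us ne12 by (simp add: fh)
        next
          case False
          then show ?thesis using that us by blast
        qed
      qed
    qed
    \<comment> \<open>The part before the first diagonal and the part after the last one are
      reversed independently of each other.\<close>
    have dd: "distinct ((rev as @ ms) @ ds)" using d cd ms by auto
    have "insert h1 (v - {f1}) = pedges (rev as @ bs)"
      using pedges_rev_append(1)[of as bs] d ab by (simp add: fh v1)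
    then have "insert h2 (insert h1 (v - {f1}) - {f2}) =
        insert h2 (pedges ((rev as @ ms) @ ds) - {f2})"
      using ms by simp
    also have "\<dots> = pedges ((rev as @ ms) @ rev ds)"
      using pedges_rev_append(2)[OF dd] ms ab cd by (simp add: fh)
    finally have z: "insert h2 (insert h1 (v - {f1}) - {f2}) = pedges ((rev as @ ms) @ rev ds)" .
    have "pedges ((rev as @ ms) @ rev ds) \<in> spanning_paths n"
      unfolding spanning_paths_def using d cd ms
      by (intro CollectI exI[of _ "(rev as @ ms) @ rev ds"]) auto
    then show "insert h2 (insert h1 (v - {f1}) - {f2}) \<in> ncpaths n"
      unfolding z[symmetric] by (rule ncpathsI[OF _ v(1)]) (use h1 h2 in auto)
  qed
  have "f1 \<notin> hull_edges n" "f2 \<notin> hull_edges n" using ab(4) cd(4) by (simp_all add: fh)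
  then have "f1 \<in> v - hull_edges n" "f2 \<in> v - hull_edges n"
      "h1 \<in> hull_edges n - v" "h2 \<in> hull_edges n - v"
    using f1v f2v h1 h2 by simp_all
  with neq iff sq show ?thesis by blast
qed

section \<open>Layers, gaps and the paths in layers 0 and 1\<close>

definition layer :: "nat \<Rightarrow> nat set set \<Rightarrow> nat" where
  "layer n v = card (v - hull_edges n)"

definition gaps :: "nat \<Rightarrow> nat set set \<Rightarrow> nat set" where
  "gaps n v = {k. k < n \<and> hull_edge n k \<notin> v}"

definition hull_path :: "nat \<Rightarrow> nat \<Rightarrow> nat set set" where
  "hull_path n k = hull_edges n - {hull_edge n k}"

text \<open>The hull edges with these numbers have no common end.\<close>

definition nonadj :: "nat \<Rightarrow> nat \<Rightarrow> nat \<Rightarrow> bool" where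
  "nonadj n k l \<longleftrightarrow> k \<noteq> l \<and> next_pt n k \<noteq> l \<and> next_pt n l \<noteq> k"

definition shift :: "nat \<Rightarrow> bool \<Rightarrow> nat \<Rightarrow> nat" where
  "shift n t x = (if t then next_pt n x else x)"

text \<open>Without the hull edges \<open>k\<close> and \<open>l\<close> the cycle falls into two
  arcs, one from the successor of \<open>k\<close> to \<open>l\<close> and one from the successor of
  \<open>l\<close> to \<open>k\<close>. An edge that joins an end of one to an end of the other is
  one of the two removed edges, or joins the two last points, or the two first points;
  \<open>t\<close> selects between the last two cases.\<close>

definition one_diagonal :: "nat \<Rightarrow> bool \<Rightarrow> nat \<Rightarrow> nat \<Rightarrow> nat set set" where
  "one_diagonal n t k l = insert {shift n t k, shift n t l} (hull_edges n - {hull_edge n k, hull_edge n l})"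

lemma spanning_pathsI: "distinct xs \<Longrightarrow> set xs = {..<n} \<Longrightarrow> pedges xs \<in> spanning_paths n"
  unfolding spanning_paths_def by blast

lemma spanning_paths_card: "S \<in> spanning_paths n \<Longrightarrow> finite S \<and> card S = n - 1"
  unfolding spanning_paths_def using card_pedges distinct_card by fastforce

lemma ncpaths_card: "S \<in> ncpaths n \<Longrightarrow> finite S \<and> card S = n - 1"
  unfolding ncpaths_def using spanning_paths_card by blast

lemma ncpaths_subset: "ncpaths n \<subseteq> Pow (Pow {..<n})"
  unfolding ncpaths_def spanning_paths_def using pedges_subset_set by blast

lemma finite_ncpaths [simp]: "finite (ncpaths n)"
  using ncpaths_subset by (rule finite_subset) simp

lemma lay_less: "v \<in> ncpaths n \<Longrightarrow> 0 < n \<Longrightarrow> layer n v < n"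
  unfolding layer_def using ncpaths_card[of v n] card_mono[of v "v - hull_edges n"] by fastforce

lemma lay_0: "v \<in> ncpaths n \<Longrightarrow> layer n v = 0 \<longleftrightarrow> v \<subseteq> hull_edges n"
  unfolding layer_def using ncpaths_card[of v n] by (auto simp: card_eq_0_iff)

lemma successively_upt: "successively (\<lambda>x y. y = Suc x) [a..<b]"
proof (induction b)
  case (Suc b)
  then show ?case by (cases "a < b") (auto simp: successively_append_iff not_less le_less)
qed simp

lemma successively_nx_edges: "successively (\<lambda>x y. y = next_pt n x) xs \<Longrightarrow> set xs \<subseteq> {..<n} \<Longrightarrow> pedges xs \<subseteq> hull_edges n"
  by (induction xs rule: pedges.induct) (auto simp: hull_edges_iff)

lemma rotation_list:
  assumes "k < n"
  defines "xs \<equiv> [Suc k..<n] @ [0..<Suc k]"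
  shows "distinct xs" "set xs = {..<n}" "successively (\<lambda>x y. y = next_pt n x) xs" "hd xs = next_pt n k" "last xs = k"
proof -
  have 1: "successively (\<lambda>x y. y = next_pt n x) [a..<b]" if "b \<le> n" for a b
    using successively_upt
    by (rule successively_mono) (use that in \<open>auto simp: next_pt_def\<close>)
  have "next_pt n (last [Suc k..<n]) = 0" if "Suc k < n" using that by (simp add: next_pt_def)
  then show "successively (\<lambda>x y. y = next_pt n x) xs"
    using 1[of n "Suc k"] 1[of "Suc k" 0] assms(1) unfolding xs_def successively_append_iff
    by (cases "Suc k < n") (simp_all del: upt_Suc add: hd_upt)
qed (use assms in \<open>auto simp: next_pt_def hd_append hd_upt simp del: upt_Suc\<close>)

text \<open>The list runs once around the cycle and stops before the step from \<open>k\<close>. So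
  its edges are hull edges other than number \<open>k\<close>, and counting shows that none is
  missing.\<close>

lemma Hp_eq_pedges:
  assumes "k < n" "3 \<le> n"
  shows "hull_path n k = pedges ([Suc k..<n] @ [0..<Suc k])"
proof -
  define xs where "xs = [Suc k..<n] @ [0..<Suc k]"
  note r = rotation_list[OF assms(1), folded xs_def]
  have sub: "pedges xs \<subseteq> hull_edges n" using successively_nx_edges r by blast
  have "hull_edge n k \<notin> pedges xs"
  proof
    assume "hull_edge n k \<in> pedges xs"
    then obtain as bs where ab: "xs = as @ bs" "as \<noteq> []" "bs \<noteq> []" "hull_edge n k = {last as, hd bs}"
      using pedges_split by blast
    then have "hd bs = next_pt n (last as)" using r(3) by (auto simp: successively_append_iff)
    moreover have "last as \<in> set xs" using ab by auto
    ultimately have "last as = k"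
      using he_inj[of n k "last as"] ab(4) assms r(2) by (auto simp: hull_edge_def)
    moreover have "last bs = k" using r(5) ab by simp
    ultimately show False using r(1) ab by (metis disjoint_iff distinct_append last_in_set)
  qed
  then have "pedges xs \<subseteq> hull_path n k" using sub by (auto simp: hull_path_def)
  moreover have "card (hull_path n k) = card (pedges xs)"
    using card_hull_edges[of n] assms card_pedges[OF r(1)] distinct_card[OF r(1)] r(2)
    by (simp add: hull_path_def card_Diff_singleton)
  ultimately show ?thesis unfolding xs_def[symmetric]
    by (metis card_subset_eq finite_Diff finite_hull_edges hull_path_def)
qed

lemma Hp_split:
  assumes "k < n" "l < n" "k \<noteq> l" "3 \<le> n"
  obtains as bs where "as \<noteq> []" "bs \<noteq> []" "distinct (as @ bs)" "set (as @ bs) = {..<n}"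
    "hull_path n k = pedges (as @ bs)" "last as = l" "hd bs = next_pt n l" "hd as = next_pt n k" "last bs = k"
proof -
  define xs where "xs = [Suc k..<n] @ [0..<Suc k]"
  note r = rotation_list[OF assms(1), folded xs_def]
  have H: "hull_path n k = pedges xs" using Hp_eq_pedges assms by (simp add: xs_def)
  have "hull_edge n l \<in> pedges xs"
    using H assms he_inj[of n l k] by (auto simp: hull_path_def simp flip: H)
  then obtain as bs where ab: "xs = as @ bs" "as \<noteq> []" "bs \<noteq> []" "hull_edge n l = {last as, hd bs}"
    using pedges_split by blast
  then have next_pt: "hd bs = next_pt n (last as)" using r(3) by (auto simp: successively_append_iff)
  moreover have "last as \<in> set xs" using ab by auto
  ultimately have "last as = l"
    using he_inj[of n l "last as"] ab(4) assms r(2) by (auto simp: hull_edge_def)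
  then show thesis using that[of as bs] ab r H next_pt by simp
qed

lemma spanning_Hp: "k < n \<Longrightarrow> 3 \<le> n \<Longrightarrow> hull_path n k \<in> spanning_paths n"
  unfolding spanning_paths_def using Hp_eq_pedges rotation_list(1,2) by blast

lemma Hp_ncpaths: "k < n \<Longrightarrow> 3 \<le> n \<Longrightarrow> hull_path n k \<in> ncpaths n"
  by (rule ncpathsI1[OF spanning_Hp, of _ _ "hull_edge n k"]) (auto simp: hull_path_def)

lemma lay_0_ex:
  assumes "v \<in> ncpaths n" "layer n v = 0" "3 \<le> n"
  shows "\<exists>k<n. v = hull_path n k"
proof -
  have sub: "v \<subseteq> hull_edges n" using assms lay_0 by blast
  have "card (hull_edges n - v) = 1"
    using ncpaths_card[OF assms(1)] card_hull_edges[OF assms(3)] sub assms(3)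
    by (simp add: card_Diff_subset)
  then obtain h where h: "hull_edges n - v = {h}" by (auto simp: card_1_singleton_iff)
  then have "h \<in> hull_edges n" by blast
  then obtain k where "k < n" "h = hull_edge n k" by (auto simp: hull_edges_def)
  moreover have "v = hull_edges n - {h}" using h sub by blast
  ultimately show ?thesis by (auto simp: hull_path_def)
qed

lemma lay_Hp [simp]: "layer n (hull_path n k) = 0"
proof -
  have "hull_path n k - hull_edges n = {}" by (auto simp: hull_path_def)
  then show ?thesis by (simp only: layer_def card.empty)
qed

lemma gaps_Hp: "k < n \<Longrightarrow> 3 \<le> n \<Longrightarrow> gaps n (hull_path n k) = {k}"
  by (auto simp: gaps_def hull_path_def he_inj)

lemma Hp_inj: "k < n \<Longrightarrow> l < n \<Longrightarrow> 3 \<le> n \<Longrightarrow> hull_path n k = hull_path n l \<longleftrightarrow> k = l"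
  using gaps_Hp by (metis singleton_inject)

lemma nadj_sym: "nonadj n k l \<longleftrightarrow> nonadj n l k" by (auto simp: nonadj_def)

lemma Dg_sym: "one_diagonal n t k l = one_diagonal n t l k" by (simp add: one_diagonal_def insert_commute)

lemma Dg_not_hull:
  assumes "k < n" "l < n" "nonadj n k l"
  shows "{shift n t k, shift n t l} \<notin> hull_edges n"
  using assms unfolding nonadj_def shift_def hull_edges_iff next_pt_def by (auto split: if_splits)

lemma Dg_ncpaths:
  assumes "k < n" "l < n" "nonadj n k l" "3 \<le> n"
  shows "one_diagonal n t k l \<in> ncpaths n"
proof -
  have "k \<noteq> l" using assms by (simp add: nonadj_def)
  from Hp_split[OF assms(1,2) this assms(4)] obtain as bs where ab: "as \<noteq> []" "bs \<noteq> []"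
    "distinct (as @ bs)" "set (as @ bs) = {..<n}" "hull_path n k = pedges (as @ bs)" "last as = l"
    "hd bs = next_pt n l" "hd as = next_pt n k" "last bs = k" .
  have "one_diagonal n t k l = (if t then pedges (rev as @ bs) else pedges (as @ rev bs))"
    using pedges_rev_append[OF ab(3,1,2)] unfolding ab(5)[symmetric]
    by (auto simp: one_diagonal_def shift_def ab hull_edge_def hull_path_def insert_commute)
  moreover have "pedges (rev as @ bs) \<in> spanning_paths n" "pedges (as @ rev bs) \<in> spanning_paths n"
    by (rule spanning_pathsI; use ab(3,4) in auto)+
  ultimately have "one_diagonal n t k l \<in> spanning_paths n" by simp
  then show ?thesis by (rule ncpathsI1[of _ _ "{shift n t k, shift n t l}"]) (auto simp: one_diagonal_def)
qed

text \<open>Joining the two ends of a hull path restores the missing hull edge and so gives another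
  hull path. The two remaining forms of exchange are the two kinds of diagonal; for adjacent gaps
  they would be hull edges.\<close>

lemma exch_Hp:
  assumes "k < n" "5 \<le> n" "u \<in> ncpaths n" "exchange (hull_path n k) u"
  shows "(\<exists>j<n. j \<noteq> k \<and> u = hull_path n j) \<or> (\<exists>t l. l < n \<and> nonadj n k l \<and> u = one_diagonal n t k l)"
proof -
  obtain e f where ef: "e \<in> hull_path n k" "f \<notin> hull_path n k" "u = insert f (hull_path n k - {e})"
    using assms(4) unfolding exchange_def by blast
  obtain l where l: "l < n" "e = hull_edge n l" using ef(1) by (auto simp: hull_path_def hull_edges_def)
  have kl: "k \<noteq> l" using ef(1) l by (auto simp: hull_path_def)
  show ?thesis
  proof (cases "f \<in> hull_edges n")
    case True
    then have "f = hull_edge n k" using ef(2) by (auto simp: hull_path_def)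
    then have "u = hull_path n l"
      using ef(3) l kl assms he_inj[of n k l] by (auto simp: hull_path_def)
    then show ?thesis using l kl by blast
  next
    case False
    have n3: "3 \<le> n" using assms by simp
    from Hp_split[OF assms(1) l(1) kl n3] obtain as bs where ab: "as \<noteq> []" "bs \<noteq> []"
      "distinct (as @ bs)" "set (as @ bs) = {..<n}" "hull_path n k = pedges (as @ bs)" "last as = l"
      "hd bs = next_pt n l" "hd as = next_pt n k" "last bs = k" .
    obtain ys where ys: "u = pedges ys" "distinct ys" "set ys = {..<n}"
      using assms(3) by (auto simp: ncpaths_nc noncrossing_def)
    have e: "e = {last as, hd bs}" using l ab by (simp add: hull_edge_def)
    have "f = {hd as, hd bs} \<or> f = {last as, last bs} \<or> f = {hd as, last bs}"
    proof (rule exchange_forms[OF ab(3,1,2) ys(2)])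
      show "set ys = set (as @ bs)" using ys ab by simp
      show "pedges ys = insert f (pedges as \<union> pedges bs)"
        using ef(3) ys(1) pedges_remove[OF ab(3,1,2)] ab(5) e by simp
      show "f \<noteq> {last as, hd bs}" using ef e by auto
    qed
    then have "f = {next_pt n k, next_pt n l} \<or> f = {l, k} \<or> f = hull_edge n k" using ab by (simp add: hull_edge_def insert_commute)
    moreover have "f \<noteq> hull_edge n k" using False assms by auto
    ultimately obtain t where t: "f = {shift n t k, shift n t l}"
      by (metis shift_def insert_commute)
    have "u = one_diagonal n t k l" using ef(3) t l by (auto simp: one_diagonal_def hull_path_def)
    moreover have "nonadj n k l"
    proof (rule ccontr)
      assume "\<not> nonadj n k l"
      then have "l = next_pt n k \<or> k = next_pt n l" using kl by (auto simp: nonadj_def)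
      then show False using False t nx_lt assms(1) l(1)
        by (auto simp: shift_def hull_edges_iff split: if_splits)
    qed
    ultimately show ?thesis using l by blast
  qed
qed

lemma Dg_diff: "k < n \<Longrightarrow> l < n \<Longrightarrow> nonadj n k l \<Longrightarrow> one_diagonal n t k l - hull_edges n = {{shift n t k, shift n t l}}"
  using Dg_not_hull by (auto simp: one_diagonal_def)

lemma lay_Dg: "k < n \<Longrightarrow> l < n \<Longrightarrow> nonadj n k l \<Longrightarrow> layer n (one_diagonal n t k l) = 1"
  by (simp add: layer_def Dg_diff)

lemma gaps_Dg:
  assumes "k < n" "l < n" "nonadj n k l" "3 \<le> n"
  shows "gaps n (one_diagonal n t k l) = {k, l}"
proof -
  have "{shift n t k, shift n t l} \<noteq> hull_edge n j" if "j < n" for j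
    using Dg_not_hull[OF assms(1-3)] that by (metis he_in_hull)
  then show ?thesis using assms by (auto simp: gaps_def one_diagonal_def he_inj)
qed

lemma exch_sym: "exchange A B \<Longrightarrow> exchange B A"
  unfolding exchange_def
proof (elim exE conjE)
  fix e f assume "e \<in> A" "f \<notin> A" "B = insert f (A - {e})"
  then show "\<exists>e f. e \<in> B \<and> f \<notin> B \<and> A = insert f (B - {e})"
    by (intro exI[of _ f] exI[of _ e]) auto
qed

text \<open>An exchange changes the layer by at most one. The equation is additive to avoid
  truncated subtraction.\<close>

lemma lay_insert_remove:
  assumes "finite v" "e \<in> v" "f \<notin> v"
  shows "layer n (insert f (v - {e})) + of_bool (e \<notin> hull_edges n) = layer n v + of_bool (f \<notin> hull_edges n)"
proof -
  let ?L = "v - hull_edges n"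
  have eq: "insert f (v - {e}) - hull_edges n =
      (if f \<in> hull_edges n then ?L - {e} else insert f (?L - {e}))"
    using assms by auto
  have "card (?L - {e}) + of_bool (e \<notin> hull_edges n) = card ?L"
    using card_Suc_Diff1[of ?L e] assms by (cases "e \<in> hull_edges n") auto
  moreover have "card (insert f (?L - {e})) = Suc (card (?L - {e}))"
    using assms by (intro card_insert_disjoint) auto
  ultimately show ?thesis unfolding layer_def eq by (cases "f \<in> hull_edges n") auto
qed

lemma exch_lower:
  assumes "finite v" "exchange v u" "layer n u + 1 = layer n v"
  shows "\<exists>f h. f \<in> v - hull_edges n \<and> h \<in> hull_edges n - v \<and> u = insert h (v - {f})"
proof -
  obtain e f where ef: "e \<in> v" "f \<notin> v" "u = insert f (v - {e})"
    using assms(2) unfolding exchange_def by blast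
  with lay_insert_remove[OF assms(1) ef(1,2), of n] assms(3)
  have "e \<notin> hull_edges n" "f \<in> hull_edges n" by (auto simp: of_bool_def split: if_splits)
  then show ?thesis using ef by blast
qed

lemma lower_exch:
  assumes "finite v" "f \<in> v - hull_edges n" "h \<in> hull_edges n - v"
  shows "exchange v (insert h (v - {f})) \<and> layer n (insert h (v - {f})) + 1 = layer n v"
  using lay_insert_remove[of v f h n] assms unfolding exchange_def by auto

lemma lay_exch: "finite v \<Longrightarrow> exchange v u \<Longrightarrow> layer n u \<le> layer n v + 1"
  unfolding exchange_def using lay_insert_remove[of v _ _ n] by (fastforce simp: of_bool_def split: if_splits)

text \<open>The path has a parent, which is a hull path, and the neighbours of hull paths are
  classified by \<open>exch_Hp\<close>.\<close>

lemma lay_1_ex: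
  assumes v: "v \<in> ncpaths n" "layer n v = 1" and n: "5 \<le> n"
  shows "\<exists>t k l. k < n \<and> l < n \<and> nonadj n k l \<and> v = one_diagonal n t k l"
proof -
  have nh: "\<not> v \<subseteq> hull_edges n" using v lay_0 by fastforce
  have fin: "finite v" using ncpaths_card v by blast
  obtain f h where fh: "f \<in> v - hull_edges n" "h \<in> hull_edges n - v" "insert h (v - {f}) \<in> ncpaths n"
    using lower_neighbours[OF v(1) nh] by metis
  have l: "layer n (insert h (v - {f})) = 0" "exchange v (insert h (v - {f}))"
    using lower_exch[OF fin fh(1,2)] v by auto
  then obtain k where k: "k < n" "insert h (v - {f}) = hull_path n k" using lay_0_ex[OF fh(3) l(1)] n by auto
  then have "exchange (hull_path n k) v" using l exch_sym by metis
  then have "(\<exists>j<n. j \<noteq> k \<and> v = hull_path n j) \<or> (\<exists>t l. l < n \<and> nonadj n k l \<and> v = one_diagonal n t k l)"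
    by (rule exch_Hp[OF k(1) n v(1)])
  moreover have "v \<noteq> hull_path n j" for j using v(2) by auto
  ultimately show ?thesis using k(1) by blast
qed

lemma gaps_lower:
  assumes "h \<in> hull_edges n - v" "f \<in> v - hull_edges n"
  shows "\<exists>k. h = hull_edge n k \<and> k \<in> gaps n v \<and> (3 \<le> n \<longrightarrow> gaps n (insert h (v - {f})) = gaps n v - {k})"
proof -
  obtain k where k: "k < n" "h = hull_edge n k" using assms by (auto simp: hull_edges_def)
  moreover have "f \<noteq> hull_edge n j" if "j < n" for j using assms(2) that by auto
  ultimately show ?thesis using assms by (intro exI[of _ k]) (auto simp: gaps_def he_inj)
qed

section \<open>Degrees in the path graph\<close>

definition Hnbrs :: "nat \<Rightarrow> nat \<Rightarrow> nat set set set" where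
  "Hnbrs n k = {u \<in> ncpaths n. exchange (hull_path n k) u}"

lemma card_nadj:
  assumes "k < n" "4 \<le> n"
  shows "card {l. l < n \<and> nonadj n k l} = n - 3"
proof -
  define p where "p = (if k = 0 then n - 1 else k - 1)"
  have "{l. l < n \<and> nonadj n k l} = {..<n} - {k, next_pt n k, p}"
    using assms by (auto simp: nonadj_def p_def next_pt_def split: if_splits)
  moreover have "card {k, next_pt n k, p} = 3"
    using assms by (auto simp: p_def next_pt_def card_insert_if)
  moreover have "{k, next_pt n k, p} \<subseteq> {..<n}" using assms by (auto simp: p_def next_pt_def)
  ultimately show ?thesis by (simp add: card_Diff_subset)
qed

lemma exch_Hp_Hp: "k < n \<Longrightarrow> j < n \<Longrightarrow> j \<noteq> k \<Longrightarrow> 3 \<le> n \<Longrightarrow> exchange (hull_path n k) (hull_path n j)"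
  unfolding exchange_def hull_path_def
  by (intro exI[of _ "hull_edge n j"] exI[of _ "hull_edge n k"]) (auto simp: he_inj)

lemma exch_Hp_Dg:
  assumes "k < n" "l < n" "nonadj n k l" "3 \<le> n"
  shows "exchange (hull_path n k) (one_diagonal n t k l)"
proof -
  have "k \<noteq> l" using assms by (simp add: nonadj_def)
  then show ?thesis
    unfolding exchange_def hull_path_def one_diagonal_def using Dg_not_hull[OF assms(1-3), of t] assms
    by (intro exI[of _ "hull_edge n l"] exI[of _ "{shift n t k, shift n t l}"]) (auto simp: he_inj)
qed

text \<open>The exchange has to remove the diagonal, which is in no hull path. Hence the hull edge
  that the target lacks must already be missing, that is, \<open>j\<close> is one of the two
  gaps.\<close>

lemma exch_Dg_Hp_iff:
  assumes "k < n" "l < n" "nonadj n k l" "j < n" "3 \<le> n"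
  shows "exchange (one_diagonal n t k l) (hull_path n j) \<longleftrightarrow> j = k \<or> j = l"
proof
  assume "exchange (one_diagonal n t k l) (hull_path n j)"
  then obtain e f where ef: "e \<in> one_diagonal n t k l" "f \<notin> one_diagonal n t k l" "hull_path n j = insert f (one_diagonal n t k l - {e})"
    unfolding exchange_def by blast
  have "hull_edge n j \<notin> hull_path n j" by (simp add: hull_path_def)
  then have "hull_edge n j \<notin> one_diagonal n t k l \<or> e = hull_edge n j" using ef by auto
  moreover have "{shift n t k, shift n t l} \<notin> hull_path n j" "{shift n t k, shift n t l} \<in> one_diagonal n t k l"
    using Dg_not_hull[OF assms(1-3)] by (auto simp: hull_path_def one_diagonal_def)
  then have "e = {shift n t k, shift n t l}" using ef by auto
  then have "e \<noteq> hull_edge n j" using Dg_not_hull[OF assms(1-3), of t] assms(4) by auto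
  ultimately have "j \<in> gaps n (one_diagonal n t k l)" using assms(4) by (simp add: gaps_def)
  then show "j = k \<or> j = l" using gaps_Dg assms by auto
next
  assume "j = k \<or> j = l"
  then show "exchange (one_diagonal n t k l) (hull_path n j)"
    using exch_Hp_Dg[of k n l t] exch_Hp_Dg[of l n k t] assms nadj_sym Dg_sym exch_sym by metis
qed

lemma Dg_inj:
  assumes "k < n" "l < n" "nonadj n k l" "l' < n" "nonadj n k l'" "3 \<le> n" "one_diagonal n t k l = one_diagonal n t' k l'"
  shows "t = t' \<and> l = l'"
proof -
  have "{k, l} = {k, l'}" using gaps_Dg[of k n l t] gaps_Dg[of k n l' t'] assms by simp
  then have l: "l = l'" by (auto simp: doubleton_eq_iff)
  have "{shift n t k, shift n t l} = {shift n t' k, shift n t' l}"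
    using Dg_diff[of k n l t] Dg_diff[of k n l' t'] assms l by simp
  then have "t = t'"
    using assms l by (cases t; cases t') (auto simp: doubleton_eq_iff shift_def nonadj_def next_pt_def split: if_splits)
  then show ?thesis using l by simp
qed

text \<open>There are \<open>n - 1\<close> other hull paths, and two kinds of diagonal for each of
  the \<open>n - 3\<close> hull edges disjoint from number \<open>k\<close>.\<close>

lemma card_Hnbrs:
  assumes "k < n" "5 \<le> n"
  shows "card (Hnbrs n k) = 3 * n - 7"
proof -
  let ?A = "hull_path n ` ({..<n} - {k})"
  let ?B = "(\<lambda>(t, l). one_diagonal n t k l) ` (UNIV \<times> {l. l < n \<and> nonadj n k l})"
  have n3: "3 \<le> n" using assms by simp
  have eq: "Hnbrs n k = ?A \<union> ?B"
  proof
    show "Hnbrs n k \<subseteq> ?A \<union> ?B"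
    proof
      fix u assume "u \<in> Hnbrs n k"
      then have "(\<exists>j<n. j \<noteq> k \<and> u = hull_path n j) \<or> (\<exists>t l. l < n \<and> nonadj n k l \<and> u = one_diagonal n t k l)"
        using exch_Hp[OF assms] by (simp add: Hnbrs_def)
      then show "u \<in> ?A \<union> ?B"
      proof (elim disjE exE conjE)
        fix t l assume "l < n" "nonadj n k l" "u = one_diagonal n t k l"
        then have "u \<in> ?B" by (intro image_eqI[of _ _ "(t, l)"]) auto
        then show ?thesis ..
      qed auto
    qed
    show "?A \<union> ?B \<subseteq> Hnbrs n k"
      unfolding Hnbrs_def using assms n3
      by (auto intro!: Hp_ncpaths Dg_ncpaths exch_Hp_Hp exch_Hp_Dg)
  qed
  have "card ?A = n - 1"
    using assms by (subst card_image) (auto simp: inj_on_def Hp_inj)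
  moreover have "card ?B = 2 * (n - 3)"
  proof (subst card_image)
    show "inj_on (\<lambda>(t, l). one_diagonal n t k l) (UNIV \<times> {l. l < n \<and> nonadj n k l})"
    proof (rule inj_onI, clarify)
      fix t l t' l' assume "l < n" "nonadj n k l" "l' < n" "nonadj n k l'" "one_diagonal n t k l = one_diagonal n t' k l'"
      then show "t = t' \<and> l = l'" using Dg_inj[of k n l l' t t'] assms(1) n3 by blast
    qed
    show "card ((UNIV :: bool set) \<times> {l. l < n \<and> nonadj n k l}) = 2 * (n - 3)"
      using card_nadj[of k n] assms by (simp add: card_cartesian_product)
  qed
  moreover have "?A \<inter> ?B = {}"
  proof -
    have "layer n u = 0" if "u \<in> ?A" for u using that by auto
    moreover have "layer n u = 1" if "u \<in> ?B" for u using that lay_Dg[OF assms(1)] by auto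
    ultimately show ?thesis by (metis (no_types, lifting) disjoint_iff zero_neq_one)
  qed
  ultimately have "card (?A \<union> ?B) = (n - 1) + 2 * (n - 3)"
    by (subst card_Un_disjoint) auto
  then show ?thesis using eq assms by simp
qed

text \<open>By \<open>exchange_forms\<close> there are three ways to reconnect after a removal.
  Reversing a part with a single point changes nothing, which leaves \<open>n - 2\<close> reversals
  of a front part and \<open>n - 2\<close> of a back part. Joining the two ends of the path is
  possible at most once, since that edge crosses every diagonal.\<close>

lemma card_nbrs_upper:
  assumes v: "v \<in> ncpaths n" "layer n v \<noteq> 0"
  shows "card {u \<in> ncpaths n. exchange v u} \<le> 2 * n - 3"
proof -
  obtain xs where xs: "v = pedges xs" "noncrossing n xs" using v(1) ncpaths_nc by blast
  have d: "distinct xs" "set xs = {..<n}" using xs by (simp_all add: noncrossing_def)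
  then have len: "length xs = n" using distinct_card by fastforce
  have "\<not> v \<subseteq> hull_edges n" using v lay_0[OF v(1)] by simp
  then obtain f0 where f0: "f0 \<in> v" "f0 \<notin> hull_edges n" by blast
  obtain cs ds where cd: "xs = cs @ ds" "cs \<noteq> []" "ds \<noteq> []" "f0 = {last cs, hd ds}"
    using pedges_split f0 xs by blast
  have n2: "2 \<le> n" using cd len by (cases cs; cases ds) auto
  let ?A = "(\<lambda>i. pedges (rev (take i xs) @ drop i xs)) ` {2..<n}"
  let ?B = "(\<lambda>i. pedges (take i xs @ rev (drop i xs))) ` {1..<n-1}"
  let ?C = "{insert {hd xs, last xs} (v - {f0})}"
  have "{u \<in> ncpaths n. exchange v u} \<subseteq> ?A \<union> ?B \<union> ?C"
  proof
    fix u assume "u \<in> {u \<in> ncpaths n. exchange v u}"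
    then obtain e f where u: "u \<in> ncpaths n" "e \<in> v" "f \<notin> v" "u = insert f (v - {e})"
      unfolding exchange_def by blast
    obtain as bs where ab: "xs = as @ bs" "as \<noteq> []" "bs \<noteq> []" "e = {last as, hd bs}"
      using pedges_split u xs by blast
    have dab: "distinct (as @ bs)" using d ab by simp
    have lab: "length as + length bs = n" "0 < length as" "0 < length bs" using ab len by auto
    have fe: "f \<noteq> {last as, hd bs}" using u ab by auto
    obtain ys where ys: "u = pedges ys" "distinct ys" "set ys = {..<n}"
      using u(1) by (auto simp: ncpaths_nc noncrossing_def)
    have "f = {hd as, hd bs} \<or> f = {last as, last bs} \<or> f = {hd as, last bs}"
    proof (rule exchange_forms[OF dab ab(2,3) ys(2)])
      show "set ys = set (as @ bs)" using ys ab d by simp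
      show "pedges ys = insert f (pedges as \<union> pedges bs)"
        using u(4) ys(1) pedges_remove[OF dab ab(2,3)] ab xs by simp
    qed (rule fe)
    then consider "f = {hd as, hd bs}" | "f = {last as, last bs}" | "f = {hd as, last bs}" by blast
    then show "u \<in> ?A \<union> ?B \<union> ?C"
    proof cases
      case 1
      have "length as \<noteq> 1" using fe 1 by (auto simp: length_Suc_conv)
      then have i: "length as \<in> {2..<n}" using lab unfolding atLeastLessThan_iff by linarith
      have "u = pedges (rev as @ bs)" using u 1 pedges_rev_append(1)[OF dab ab(2,3)] ab xs by simp
      then have "u \<in> ?A" using i ab(1) by (intro image_eqI[of _ _ "length as"]) simp_all
      then show ?thesis by blast
    next
      case 2
      have "length bs \<noteq> 1" using fe 2 by (auto simp: length_Suc_conv)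
      then have i: "length as \<in> {1..<n-1}" using lab unfolding atLeastLessThan_iff by linarith
      have "u = pedges (as @ rev bs)" using u 2 pedges_rev_append(2)[OF dab ab(2,3)] ab xs by simp
      then have "u \<in> ?B" using i ab(1) by (intro image_eqI[of _ _ "length as"]) simp_all
      then show ?thesis by blast
    next
      case 3
      then have f: "f = {hd xs, last xs}" using ab by simp
      \<comment> \<open>The edge between the two ends of the path crosses the fixed diagonal
        \<open>f0\<close>, so \<open>f0\<close> must be the edge removed.\<close>
      have "e = f0"
      proof (rule ccontr)
        assume "e \<noteq> f0"
        then have "f0 \<in> u" "f \<in> u" using u f0 by auto
        moreover have "crosses f0 {hd cs, last ds}"
          using ends_not_hull(2)[of n cs ds] xs cd f0 by simp
        moreover have "f = {hd cs, last ds}" using f cd by simp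
        ultimately show False using u(1) by (auto simp: ncpaths_def)
      qed
      then show ?thesis using u f by blast
    qed
  qed
  then have "card {u \<in> ncpaths n. exchange v u} \<le> card (?A \<union> ?B \<union> ?C)" by (intro card_mono) auto
  also have "\<dots> \<le> card ?A + card ?B + card ?C"
    by (meson add_right_mono card_Un_le le_trans)
  also have "\<dots> \<le> (n - 2) + (n - 2) + 1"
    using card_image_le[of "{2..<n}" "\<lambda>i. pedges (rev (take i xs) @ drop i xs)"]
      card_image_le[of "{1..<n-1}" "\<lambda>i. pedges (take i xs @ rev (drop i xs))"] by simp
  finally show ?thesis using n2 by simp
qed

section \<open>Parents, and what layer 2 reveals about layer 1\<close>

lemma parents:
  assumes v: "v \<in> ncpaths n" "layer n v \<noteq> 0" and n: "3 \<le> n"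
  shows "\<exists>X Y. X \<noteq> Y \<and> {u \<in> ncpaths n. exchange v u \<and> layer n u + 1 = layer n v} = {X, Y} \<and>
    gaps n v = gaps n X \<union> gaps n Y"
proof -
  have nh: "\<not> v \<subseteq> hull_edges n" using v lay_0[OF v(1)] by simp
  have fin: "finite v" using ncpaths_card v by blast
  obtain f1 f2 h1 h2 where L: "f1 \<in> v - hull_edges n" "f2 \<in> v - hull_edges n"
    "h1 \<in> hull_edges n - v" "h2 \<in> hull_edges n - v" "h1 \<noteq> h2"
    "\<forall>f\<in>v - hull_edges n. \<forall>h\<in>hull_edges n - v.
      insert h (v - {f}) \<in> ncpaths n \<longleftrightarrow> (f = f1 \<and> h = h1) \<or> (f = f2 \<and> h = h2)"
    "2 \<le> card (v - hull_edges n) \<longrightarrow>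
      f1 \<noteq> f2 \<and> insert h2 (insert h1 (v - {f1}) - {f2}) \<in> ncpaths n"
    using lower_neighbours[OF v(1) nh] by blast
  let ?X = "insert h1 (v - {f1})" and ?Y = "insert h2 (v - {f2})"
  have "?X \<noteq> ?Y" using L by auto
  moreover have "{u \<in> ncpaths n. exchange v u \<and> layer n u + 1 = layer n v} = {?X, ?Y}"
  proof
    show "{u \<in> ncpaths n. exchange v u \<and> layer n u + 1 = layer n v} \<subseteq> {?X, ?Y}"
      using exch_lower[OF fin] L(6) by fastforce
    show "{?X, ?Y} \<subseteq> {u \<in> ncpaths n. exchange v u \<and> layer n u + 1 = layer n v}"
      using lower_exch[OF fin L(1,3)] lower_exch[OF fin L(2,4)] L by auto
  qed
  \<comment> \<open>Each exchange fills one gap, and the two fill different ones, so no gap of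
    \<open>v\<close> is lost in both parents.\<close>
  moreover have "gaps n v = gaps n ?X \<union> gaps n ?Y"
  proof -
    obtain k1 where k1: "h1 = hull_edge n k1" "gaps n ?X = gaps n v - {k1}"
      using gaps_lower[OF L(3,1)] n by auto
    obtain k2 where k2: "h2 = hull_edge n k2" "gaps n ?Y = gaps n v - {k2}"
      using gaps_lower[OF L(4,2)] n by auto
    have "k1 \<noteq> k2" using L(5) k1 k2 by auto
    then show ?thesis using k1 k2 by auto
  qed
  ultimately show ?thesis by (intro exI[of _ ?X] exI[of _ ?Y] conjI)
qed

text \<open>For three different numbers the sum is 2 or 1, depending on their orientation on the
  cycle. In the wrong orientation the chord from \<open>next_pt n a\<close> to
  \<open>next_pt n s\<close> separates \<open>b\<close> from \<open>s\<close>; the three cases are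
  the rotations of that orientation.\<close>

lemma layer2_orientation:
  assumes lt: "a < n" "b < n" "s < n" and ne: "a \<noteq> b" and na: "nonadj n a s" "nonadj n b s"
    and noncrossing: "\<not> interleaved (next_pt n a) (next_pt n s) b s"
  shows "of_bool (a < b) + of_bool (b < s) + of_bool (s < a) = (2 :: nat)"
proof -
  have "a \<noteq> s" "b \<noteq> s" "next_pt n a \<noteq> s" "next_pt n b \<noteq> s" "next_pt n s \<noteq> a" "next_pt n s \<noteq> b"
    using na by (auto simp: nonadj_def)
  note d = this
  have "interleaved (next_pt n a) (next_pt n s) b s" if "b < a" "a < s"
    using that lt d unfolding interleaved_def next_pt_def by (auto split: if_splits)
  moreover have "interleaved (next_pt n a) (next_pt n s) b s" if "a < s" "s < b"
    using that lt d unfolding interleaved_def next_pt_def by (auto split: if_splits)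
  moreover have "interleaved (next_pt n a) (next_pt n s) b s" if "s < b" "b < a"
    using that lt d unfolding interleaved_def next_pt_def by (auto split: if_splits)
  ultimately show ?thesis using noncrossing d ne by (cases "a < b"; cases "b < s"; cases "s < a") auto
qed

lemma spanning_degree3:
  assumes "v \<in> ncpaths n" "{x, a} \<in> v" "{x, b} \<in> v" "{x, c} \<in> v" "a \<noteq> b" "a \<noteq> c" "b \<noteq> c"
  shows False
proof -
  obtain xs where "v = pedges xs" "distinct xs" using assms(1) by (auto simp: ncpaths_nc noncrossing_def)
  then show False using pedges_degree3[of xs x a b c] assms by auto
qed

text \<open>The two parents are found in an arbitrary order, so the facts about the first and the
  last diagonal are restated symmetrically for any two parents.\<close>

lemma two_parents:
  assumes v: "v \<in> ncpaths n" "2 \<le> layer n v"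
    and X: "X \<in> ncpaths n" "exchange v X" "layer n X + 1 = layer n v"
    and Y: "Y \<in> ncpaths n" "exchange v Y" "layer n Y + 1 = layer n v" and XY: "X \<noteq> Y"
  shows "\<exists>f h f' h'. f \<in> v - hull_edges n \<and> h \<in> hull_edges n - v \<and> X = insert h (v - {f}) \<and>
    f' \<in> v - hull_edges n \<and> h' \<in> hull_edges n - v \<and> Y = insert h' (v - {f'}) \<and>
    f \<noteq> f' \<and> h \<noteq> h' \<and> insert h' (X - {f'}) \<in> ncpaths n \<and>
    (\<forall>g\<in>v - hull_edges n. \<forall>k\<in>hull_edges n - v.
      insert k (v - {g}) \<in> ncpaths n \<longrightarrow> (g = f \<and> k = h) \<or> (g = f' \<and> k = h'))"
proof -
  have nh: "\<not> v \<subseteq> hull_edges n" using v lay_0[OF v(1)] by simp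
  have fin: "finite v" using ncpaths_card v by blast
  obtain f1 f2 h1 h2 where L: "f1 \<in> v - hull_edges n" "f2 \<in> v - hull_edges n"
    "h1 \<in> hull_edges n - v" "h2 \<in> hull_edges n - v" "h1 \<noteq> h2"
    "\<forall>f\<in>v - hull_edges n. \<forall>h\<in>hull_edges n - v.
      insert h (v - {f}) \<in> ncpaths n \<longleftrightarrow> (f = f1 \<and> h = h1) \<or> (f = f2 \<and> h = h2)"
    "2 \<le> card (v - hull_edges n) \<longrightarrow>
      f1 \<noteq> f2 \<and> insert h2 (insert h1 (v - {f1}) - {f2}) \<in> ncpaths n"
    using lower_neighbours[OF v(1) nh] by blast
  have sq: "f1 \<noteq> f2 \<and> insert h2 (insert h1 (v - {f1}) - {f2}) \<in> ncpaths n"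
    using L(7) v(2) by (simp add: layer_def)
  obtain f h where X': "f \<in> v - hull_edges n" "h \<in> hull_edges n - v" "X = insert h (v - {f})"
    using exch_lower[OF fin X(2), of n] X v by auto
  obtain f' h' where Y': "f' \<in> v - hull_edges n" "h' \<in> hull_edges n - v" "Y = insert h' (v - {f'})"
    using exch_lower[OF fin Y(2), of n] Y v by auto
  have fh': "(f = f1 \<and> h = h1) \<or> (f = f2 \<and> h = h2)" "(f' = f1 \<and> h' = h1) \<or> (f' = f2 \<and> h' = h2)"
    using L(6) X' Y' X(1) Y(1) by auto
  \<comment> \<open>The two exchanges concern different edges and therefore commute, which settles
    the case of swapped parents.\<close>
  have eq: "insert h1 (insert h2 (v - {f2}) - {f1}) = insert h2 (insert h1 (v - {f1}) - {f2})"
    using L(1-5) by auto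
  have ff: "f = f1 \<and> h = h1 \<and> f' = f2 \<and> h' = h2 \<or> f = f2 \<and> h = h2 \<and> f' = f1 \<and> h' = h1"
    using fh' X'(3) Y'(3) XY by blast
  from ff have "f \<noteq> f' \<and> h \<noteq> h' \<and> insert h' (X - {f'}) \<in> ncpaths n"
  proof (elim disjE conjE)
    assume "f = f1" "h = h1" "f' = f2" "h' = h2"
    then show ?thesis using sq L(5) unfolding X'(3) by blast
  next
    assume *: "f = f2" "h = h2" "f' = f1" "h' = h1"
    then have "insert h' (X - {f'}) = insert h2 (insert h1 (v - {f1}) - {f2})"
      unfolding X'(3) by (simp only: eq)
    then show ?thesis using sq L(5) * by metis
  qed
  moreover have "(g = f \<and> k = h) \<or> (g = f' \<and> k = h')"
    if "g \<in> v - hull_edges n" "k \<in> hull_edges n - v" "insert k (v - {g}) \<in> ncpaths n" for g k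
  proof -
    have "(g = f1 \<and> k = h1) \<or> (g = f2 \<and> k = h2)"
      using bspec[OF bspec[OF L(6) that(1)] that(2)] that(3) by (rule iffD1)
    then show ?thesis using ff by (elim disjE conjE) simp_all
  qed
  ultimately show ?thesis
    by (intro exI[of _ f] exI[of _ h] exI[of _ f'] exI[of _ h'] conjI ballI impI) (use X' Y' in simp_all)
qed

text \<open>Undoing both exchanges gives a hull path, whose gap \<open>s\<close> is shared by the
  parents, while \<open>a\<close> and \<open>b\<close> belong to one parent each. Two diagonals of
  the same kind would meet in \<open>s\<close> or in its successor, which also lies on a hull edge
  of \<open>v\<close> and so would have three edges. Hence the kinds differ, and the absence of a
  crossing fixes the orientation of \<open>a\<close>, \<open>b\<close>, \<open>s\<close>.\<close>

lemma layer2_parents: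
  assumes v: "v \<in> ncpaths n" "layer n v = 2" and n: "5 \<le> n"
    and X: "X \<in> ncpaths n" "exchange v X" "layer n X = 1"
    and Y: "Y \<in> ncpaths n" "exchange v Y" "layer n Y = 1" and XY: "X \<noteq> Y"
  shows "\<exists>a b s t. a < n \<and> b < n \<and> s < n \<and> a \<noteq> b \<and> a \<noteq> s \<and> b \<noteq> s \<and> nonadj n a s \<and> nonadj n b s \<and>
    X = one_diagonal n t a s \<and> Y = one_diagonal n (\<not> t) b s \<and>
    of_bool (a < b) + of_bool (b < s) + of_bool (s < a) = (if t then 2 else 1 :: nat)"
proof -
  have n3: "3 \<le> n" using n by simp
  have fin: "finite v" using ncpaths_card v by blast
  have c: "2 \<le> layer n v" "layer n X + 1 = layer n v" "layer n Y + 1 = layer n v" using v X Y by simp_all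
  obtain f h f' h' where X': "f \<in> v - hull_edges n" "h \<in> hull_edges n - v" "X = insert h (v - {f})"
    and Y': "f' \<in> v - hull_edges n" "h' \<in> hull_edges n - v" "Y = insert h' (v - {f'})"
    and fh: "f \<noteq> f'" "h \<noteq> h'" and Z: "insert h' (X - {f'}) \<in> ncpaths n"
    using two_parents[OF v(1) c(1) X(1,2) c(2) Y(1,2) c(3) XY] by blast
  have D: "v - hull_edges n = {f, f'}"
  proof (rule sym, rule card_subset_eq)
    show "card {f, f'} = card (v - hull_edges n)" using fh v(2) by (simp add: layer_def)
  qed (use fin X' Y' in auto)
  have "insert h' (X - {f'}) \<subseteq> hull_edges n" using D X' Y' by auto
  then obtain s where s: "s < n" "insert h' (X - {f'}) = hull_path n s"
    using lay_0[OF Z] lay_0_ex[OF Z _ n3] by blast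
  obtain a where a: "h' = hull_edge n a" "a \<in> gaps n v" using gaps_lower Y' by blast
  obtain b where b: "h = hull_edge n b" "b \<in> gaps n v" using gaps_lower X' by blast
  have ab: "a < n" "b < n" "a \<noteq> b" using a b fh by (auto simp: gaps_def)
  have "hull_edge n s \<notin> insert h' (X - {f'})" using s by (simp add: hull_path_def)
  moreover have "f' \<noteq> hull_edge n s" using s Y' by auto
  ultimately have sX: "hull_edge n s \<notin> X" and "s \<noteq> a" using a by auto
  then have sv: "hull_edge n s \<notin> v" "s \<noteq> b" using X' b s by auto
  have "X - hull_edges n = (v - hull_edges n) - {f}" "Y - hull_edges n = (v - hull_edges n) - {f'}"
    using X'(2,3) Y'(2,3) by blast+
  then have XD: "X - hull_edges n = {f'}" and YD: "Y - hull_edges n = {f}"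
    unfolding D using fh(1) by (simp_all add: insert_Diff_if)
  have "h' \<notin> X" "h \<notin> Y" "hull_edge n s \<notin> Y"
    using X'(2,3) Y'(2,3) fh(2) sv(1) a(1) \<open>s \<noteq> a\<close> he_inj[OF n3 s(1) ab(1)] by auto
  then have gX: "{a, s} \<subseteq> gaps n X" and gY: "{b, s} \<subseteq> gaps n Y"
    using sX a(1) b(1) s(1) ab by (simp_all add: gaps_def)
  obtain t k l where X1: "k < n" "l < n" "nonadj n k l" "X = one_diagonal n t k l" using lay_1_ex[OF X(1,3) n] by blast
  have "{a, s} \<subseteq> {k, l}" using gX gaps_Dg[OF X1(1-3) n3] X1(4) by simp
  then have "a = k \<and> s = l \<or> a = l \<and> s = k" using \<open>s \<noteq> a\<close> by auto
  then have XX: "X = one_diagonal n t a s" "nonadj n a s" using X1 Dg_sym nadj_sym by auto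
  obtain t' k l where Y1: "k < n" "l < n" "nonadj n k l" "Y = one_diagonal n t' k l" using lay_1_ex[OF Y(1,3) n] by blast
  have "{b, s} \<subseteq> {k, l}" using gY gaps_Dg[OF Y1(1-3) n3] Y1(4) by simp
  then have "b = k \<and> s = l \<or> b = l \<and> s = k" using \<open>s \<noteq> b\<close> by auto
  then have YY: "Y = one_diagonal n t' b s" "nonadj n b s" using Y1 Dg_sym nadj_sym by auto
  have f': "f' = {shift n t a, shift n t s}" using XD Dg_diff[OF ab(1) s(1) XX(2)] XX(1) by simp
  have f: "f = {shift n t' b, shift n t' s}" using YD Dg_diff[OF ab(2) s(1) YY(2)] YY(1) by simp
  have hull_v: "hull_edge n j \<in> v" if "j < n" "j \<noteq> a" "j \<noteq> b" "j \<noteq> s" for j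
  proof -
    have "hull_edge n j \<in> hull_path n s" using that s n3 by (simp add: hull_path_def he_inj)
    moreover have "hull_edge n j \<noteq> h" "hull_edge n j \<noteq> h'"
      using a(1) b(1) that ab he_inj[OF n3 that(1)] by simp_all
    ultimately show ?thesis unfolding s(2)[symmetric] X'(3) by blast
  qed
  have fv: "f \<in> v" "f' \<in> v" using X' Y' by auto
  have tt: "t' = (\<not> t)"
  proof (rule ccontr)
    assume "t' \<noteq> (\<not> t)"
    then consider "t" "t'" | "\<not> t" "\<not> t'" by blast
    then show False
    proof cases
      case 1
      have j: "next_pt n s < n" "next_pt n s \<noteq> a" "next_pt n s \<noteq> b" "next_pt n s \<noteq> s"
        using XX(2) YY(2) s n nx_lt nx_neq by (auto simp: nonadj_def)
      have "{next_pt n s, next_pt n a} \<in> v" "{next_pt n s, next_pt n b} \<in> v" "{next_pt n s, next_pt n (next_pt n s)} \<in> v"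
        using fv f f' 1 hull_v[OF j] by (simp_all add: shift_def insert_commute hull_edge_def)
      moreover have "next_pt n a \<noteq> next_pt n b" "next_pt n a \<noteq> next_pt n (next_pt n s)" "next_pt n b \<noteq> next_pt n (next_pt n s)"
        using nx_inj ab j by auto
      ultimately show False using spanning_degree3[OF v(1)] by blast
    next
      case 2
      \<comment> \<open>\<open>p\<close> is the predecessor of \<open>s\<close>; the hull edge with
        number \<open>p\<close> is the third edge at \<open>s\<close>.\<close>
      define p where "p = (if s = 0 then n - 1 else s - 1)"
      have p: "p < n" "next_pt n p = s" "p \<noteq> s" using s n by (auto simp: p_def next_pt_def)
      have pab: "p \<noteq> a" "p \<noteq> b" using XX(2) YY(2) p by (auto simp: nonadj_def)
      have "{s, a} \<in> v" "{s, b} \<in> v" "{s, p} \<in> v"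
        using fv f f' 2 hull_v[of p] p pab by (simp_all add: shift_def insert_commute hull_edge_def)
      then show False using spanning_degree3[OF v(1)] ab pab by metis
    qed
  qed
  have ncr: "\<not> crosses f' f" using v(1) fv by (auto simp: ncpaths_def)
  have cyc: "of_bool (a < b) + of_bool (b < s) + of_bool (s < a) = (if t then 2 else 1 :: nat)"
  proof (cases t)
    case True
    then have "\<not> interleaved (next_pt n a) (next_pt n s) b s" using ncr f f' tt by (simp add: shift_def)
    then show ?thesis using layer2_orientation[OF ab(1,2) s(1) ab(3) XX(2) YY(2)] True by simp
  next
    case False
    then have "\<not> interleaved (next_pt n b) (next_pt n s) a s"
      using ncr f f' tt by (simp add: shift_def interleaved_sym)
    then have "of_bool (b < a) + of_bool (a < s) + of_bool (s < b) = (2 :: nat)"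
      using layer2_orientation[OF ab(2,1) s(1) _ YY(2) XX(2)] ab by simp
    then show ?thesis using False ab \<open>s \<noteq> a\<close> \<open>s \<noteq> b\<close>
      by (auto simp: of_bool_def not_less split: if_splits)
  qed
  show ?thesis
    by (intro exI[of _ a] exI[of _ b] exI[of _ s] exI[of _ t] conjI)
      (use ab s XX YY tt cyc \<open>s \<noteq> a\<close> \<open>s \<noteq> b\<close> in simp_all)
qed

text \<open>Replacing \<open>{y, z}\<close> by \<open>{x, z}\<close> makes \<open>y\<close> the new
  end of the path, attached to \<open>x\<close>. The new diagonal cuts off nothing but
  \<open>y\<close>, and the only edge left at \<open>y\<close> shares the end \<open>x\<close> with
  it.\<close>

lemma cut_ear:
  assumes noncrossing: "noncrossing n (x # y # z # r)" and hull: "{x, y} \<in> hull_edges n" "{y, z} \<in> hull_edges n"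
    and n: "4 \<le> n"
  shows "\<exists>v\<in>ncpaths n. exchange v (pedges (x # y # z # r)) \<and> layer n v = layer n (pedges (x # y # z # r)) + 1"
proof -
  let ?u = "pedges (x # y # z # r)" and ?v = "pedges (y # x # z # r)"
  have d: "distinct (x # y # z # r)" "set (x # y # z # r) = {..<n}" using noncrossing by (simp_all only: noncrossing_def)
  have u: "?u \<in> ncpaths n" using noncrossing ncpaths_nc by blast
  have us: "?u \<in> spanning_paths n" using u by (simp add: ncpaths_def)
  have v: "?v = insert {x, z} (?u - {{y, z}})"
    using pedges_rev_append(1)[of "[x, y]" "z # r"] d by simp
  have nh: "{x, z} \<notin> hull_edges n" using ear_not_hull[OF hull] d n by simp
  have xz_u: "{x, z} \<notin> ?u"
  proof
    assume a: "{x, z} \<in> ?u"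
    have "x = last [x] \<and> z = hd (y # z # r)"
      by (rule pedges_crossing_edge) (use a d in auto)
    then show False using d by simp
  qed
  have key: "\<not> crosses {x, z} g" if g: "g \<in> ?u - {{y, z}}" for g
  proof
    assume cr: "crosses {x, z} g"
    obtain c e where ce: "g = {c, e}" "c < n" "e < n"
      using spanning_paths_edge[OF us, of g] g by blast
    then have i: "interleaved x z c e" using cr by simp
    then have "y \<in> g" using ear_interleaved[OF hull _ i] ce d by auto
    moreover have "g \<noteq> {x, y}" using i ce interleaved_distinct[OF i] by (auto simp: doubleton_eq_iff)
    moreover have "y \<notin> f" if "f \<in> pedges (z # r)" for f
      using pedges_subset_set[OF that] d by auto
    ultimately show False using g by auto
  qed
  have self: "\<not> crosses {x, z} {x, z}" using interleaved_distinct[of x z x z] by auto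
  have "\<not> crosses e f" if ef: "e \<in> ?v" "f \<in> ?v" for e f
  proof -
    consider "e = {x, z}" "f = {x, z}" | "e = {x, z}" "f \<in> ?u - {{y, z}}"
      | "f = {x, z}" "e \<in> ?u - {{y, z}}" | "e \<in> ?u" "f \<in> ?u"
      using ef unfolding v by blast
    then show ?thesis
    proof cases
      case 4
      then show ?thesis using u unfolding ncpaths_def mem_Collect_eq by blast
    qed (use self key crosses_sym in blast)+
  qed
  moreover have "?v \<in> spanning_paths n" by (rule spanning_pathsI) (use d in auto)
  ultimately have vn: "?v \<in> ncpaths n" by (simp only: ncpaths_def mem_Collect_eq) blast
  have fin: "finite ?u" by simp
  have "exchange ?u ?v" unfolding exchange_def v using xz_u by (intro exI[of _ "{y, z}"] exI[of _ "{x, z}"]) auto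
  moreover have "layer n ?v = layer n ?u + 1"
    unfolding v using lay_insert_remove[OF fin, of "{y, z}" "{x, z}" n] xz_u hull nh by simp
  ultimately show ?thesis using vn exch_sym by blast
qed

text \<open>The only diagonal joins two runs of hull edges. As \<open>5 \<le> n\<close>, one of them
  has at least three points, and an ear can be cut off at its outer end. Since the kind of a layer 1
  diagonal is read off in layer 2, each such path needs this neighbour.\<close>

lemma layer2_ex:
  assumes D: "D \<in> ncpaths n" "layer n D = 1" and n: "5 \<le> n"
  shows "\<exists>v\<in>ncpaths n. exchange v D \<and> layer n v = 2"
proof -
  obtain xs where xs: "D = pedges xs" "noncrossing n xs" using D(1) ncpaths_nc by blast
  have d: "distinct xs" "set xs = {..<n}" using xs by (simp_all add: noncrossing_def)
  have len: "length xs = n" using distinct_card[OF d(1)] d(2) by simp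
  have "\<not> D \<subseteq> hull_edges n" using D lay_0[OF D(1)] by simp
  then obtain as bs where ab: "xs = as @ bs" "as \<noteq> []" "bs \<noteq> []" "{last as, hd bs} \<notin> hull_edges n"
    using first_diagonal_ex xs by blast
  have sub: "pedges as \<union> pedges bs = D - {{last as, hd bs}}"
    using pedges_remove[of as bs] d ab xs by simp
  have "{last as, hd bs} \<in> D" using ab xs by (simp add: pedges_append)
  moreover obtain f where "D - hull_edges n = {f}"
    using D(2) by (auto simp: layer_def card_1_singleton_iff)
  moreover from calculation have "{last as, hd bs} \<in> {f}" using ab(4) by (metis DiffI)
  ultimately have D1: "D - hull_edges n = {{last as, hd bs}}" by simp
  then have hull: "pedges as \<subseteq> hull_edges n" "pedges bs \<subseteq> hull_edges n"
    using sub by blast+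
  have "length as \<ge> 3 \<or> length bs \<ge> 3" using len ab n by auto
  then show ?thesis
  proof
    assume "length as \<ge> 3"
    then obtain x y z r where "as = x # y # z # r" by (auto simp: numeral_3_eq_3 Suc_le_length_iff)
    then show ?thesis
      using cut_ear[of n x y z "r @ bs"] xs ab hull n D by (simp add: numeral_2_eq_2)
  next
    assume "length bs \<ge> 3"
    then have "length (rev bs) \<ge> 3" by simp
    then obtain x y z r where r: "rev bs = x # y # z # r"
      by (auto simp: numeral_3_eq_3 Suc_le_length_iff simp del: length_rev)
    have nr: "noncrossing n (rev bs @ rev as)" using nc_append_rev xs ab by simp
    have "pedges (rev bs @ rev as) = D" using xs ab pedges_rev[of "as @ bs"] by simp
    moreover have "pedges (rev bs) \<subseteq> hull_edges n" using hull by simp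
    ultimately show ?thesis
      using cut_ear[of n x y z "r @ rev as"] nr n D unfolding r by (simp add: numeral_2_eq_2)
  qed
qed

section \<open>Recovering a path from its two parents\<close>

text \<open>A path is stored as one edge per hull edge: the hull edge itself if the path contains it, and
  otherwise a diagonal. If deleting a diagonal and inserting the missing hull edge gives a
  path again, then the slot of that hull edge has to hold that diagonal.\<close>

definition slots_ok :: "nat \<Rightarrow> nat set set \<Rightarrow> (nat \<Rightarrow> nat set) \<Rightarrow> bool" where
  "slots_ok n v sl \<longleftrightarrow> (\<forall>g<n. g \<notin> gaps n v \<longrightarrow> sl g = hull_edge n g) \<and> sl ` gaps n v = v - hull_edges n \<and>
    (\<forall>g\<in>gaps n v. \<forall>f\<in>v - hull_edges n. insert (hull_edge n g) (v - {f}) \<in> ncpaths n \<longrightarrow> sl g = f)"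

lemma slots_image:
  assumes "slots_ok n v sl"
  shows "sl ` {..<n} = v"
proof -
  have "{..<n} = gaps n v \<union> ({..<n} - gaps n v)" by (auto simp: gaps_def)
  then have "sl ` {..<n} = sl ` gaps n v \<union> sl ` ({..<n} - gaps n v)" by (metis image_Un)
  also have "sl ` ({..<n} - gaps n v) = hull_edge n ` ({..<n} - gaps n v)"
    using assms by (intro image_cong) (auto simp: slots_ok_def)
  also have "\<dots> = v \<inter> hull_edges n" by (auto simp: gaps_def hull_edges_def)
  also have "sl ` gaps n v = v - hull_edges n" using assms by (simp add: slots_ok_def)
  finally show ?thesis by blast
qed

text \<open>A path has one more gap than diagonals, so some diagonal occupies two slots; here both
  gaps hold the only diagonal.\<close>

lemma slots_Dg:
  assumes "k < n" "l < n" "nonadj n k l" "3 \<le> n"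
    and "sl k = {shift n t k, shift n t l}" "sl l = {shift n t k, shift n t l}"
    and "\<And>g. g < n \<Longrightarrow> g \<noteq> k \<Longrightarrow> g \<noteq> l \<Longrightarrow> sl g = hull_edge n g"
  shows "slots_ok n (one_diagonal n t k l) sl"
  unfolding slots_ok_def gaps_Dg[OF assms(1-4)] Dg_diff[OF assms(1-3)] using assms by auto

text \<open>The gap \<open>p\<close> that is filled in \<open>X\<close> is still a gap of
  \<open>Y\<close>, and since the two exchanges commute, \<open>Y\<close> too can trade the diagonal
  \<open>f\<close> for hull edge \<open>p\<close>. So the last clause of \<open>slots_ok\<close> for
  \<open>Y\<close> forces its slot \<open>p\<close> to hold \<open>f\<close>, as required for
  \<open>v\<close>. In the same way the slot in \<open>X\<close> of the gap \<open>q\<close> filled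
  in \<open>Y\<close> holds \<open>f'\<close>. All diagonals except \<open>f\<close> occur in the
  slots of the gaps of \<open>X\<close>.\<close>

lemma slots_merge:
  assumes v: "v \<in> ncpaths n" "2 \<le> layer n v" and n: "3 \<le> n"
    and X: "X \<in> ncpaths n" "exchange v X" "layer n X + 1 = layer n v"
    and Y: "Y \<in> ncpaths n" "exchange v Y" "layer n Y + 1 = layer n v" and XY: "X \<noteq> Y"
    and sX: "slots_ok n X slX" and sY: "slots_ok n Y slY"
    and sl: "\<And>g. g < n \<Longrightarrow> sl g = (if g \<in> gaps n X then slX g else slY g)"
  shows "slots_ok n v sl"
proof -
  obtain f h f' h' where X': "f \<in> v - hull_edges n" "h \<in> hull_edges n - v" "X = insert h (v - {f})"
    and Y': "f' \<in> v - hull_edges n" "h' \<in> hull_edges n - v" "Y = insert h' (v - {f'})"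
    and fh: "f \<noteq> f'" "h \<noteq> h'" and Z: "insert h' (X - {f'}) \<in> ncpaths n"
    and only: "\<forall>g\<in>v - hull_edges n. \<forall>k\<in>hull_edges n - v.
      insert k (v - {g}) \<in> ncpaths n \<longrightarrow> (g = f \<and> k = h) \<or> (g = f' \<and> k = h')"
    using two_parents[OF v X Y XY] by blast
  have Z': "insert h (Y - {f}) \<in> ncpaths n"
  proof -
    have "insert h (Y - {f}) = insert h' (X - {f'})" using X' Y' fh by auto
    then show ?thesis using Z by simp
  qed
  obtain p where p: "h = hull_edge n p" "p \<in> gaps n v" "gaps n X = gaps n v - {p}"
    using gaps_lower[OF X'(2,1)] X'(3) n by auto
  obtain q where q: "h' = hull_edge n q" "q \<in> gaps n v" "gaps n Y = gaps n v - {q}"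
    using gaps_lower[OF Y'(2,1)] Y'(3) n by auto
  have pq: "p \<noteq> q" "p < n" "q < n" using p q fh by (auto simp: gaps_def)
  have XD: "X - hull_edges n = (v - hull_edges n) - {f}" and YD: "Y - hull_edges n = (v - hull_edges n) - {f'}"
    using X'(2,3) Y'(2,3) by blast+
  have slp: "sl p = f"
  proof -
    have "sl p = slY p" using sl pq p by simp
    moreover have "p \<in> gaps n Y" "f \<in> Y - hull_edges n" using p q pq YD X' fh by auto
    ultimately show ?thesis using sY Z' p(1) by (auto simp: slots_ok_def)
  qed
  have slq: "sl q = f'"
  proof -
    have qX: "q \<in> gaps n X" using p q pq by auto
    then have "sl q = slX q" using sl pq by simp
    moreover have "f' \<in> X - hull_edges n" using XD Y' fh by auto
    ultimately show ?thesis using sX Z q(1) qX by (auto simp: slots_ok_def)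
  qed
  have slX: "sl g = slX g" if "g \<in> gaps n X" for g
    using that sl by (auto simp: gaps_def)
  have "gaps n v = insert p (gaps n X)" using p by auto
  then have "sl ` gaps n v = insert (sl p) (sl ` gaps n X)" by simp
  also have "sl ` gaps n X = slX ` gaps n X" using slX by (intro image_cong) auto
  also have "\<dots> = (v - hull_edges n) - {f}" using sX XD by (simp add: slots_ok_def)
  finally have im: "sl ` gaps n v = v - hull_edges n" using slp X'(1) by auto
  show ?thesis
    unfolding slots_ok_def
  proof (intro conjI allI impI ballI)
    fix g assume g: "g < n" "g \<notin> gaps n v"
    then have "g \<notin> gaps n X" "g \<notin> gaps n Y" using p q by auto
    then show "sl g = hull_edge n g" using sl[OF g(1)] sY g(1) by (simp add: slots_ok_def)
  next
    fix g d assume g: "g \<in> gaps n v" and d: "d \<in> v - hull_edges n" and i: "insert (hull_edge n g) (v - {d}) \<in> ncpaths n"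
    have gn: "g < n" "hull_edge n g \<in> hull_edges n - v" using g by (auto simp: gaps_def)
    then have "(d = f \<and> hull_edge n g = h) \<or> (d = f' \<and> hull_edge n g = h')" using only d i by blast
    then have "(d = f \<and> g = p) \<or> (d = f' \<and> g = q)" using p q pq gn he_inj[OF n] by auto
    then show "sl g = d" using slp slq by auto
  qed (rule im)
qed

section \<open>There are exponentially many paths\<close>

text \<open>The points still to come always form an interval; a bit tells whether its least or its
  greatest element is next.\<close>

fun zigzag :: "nat \<Rightarrow> bool list \<Rightarrow> nat list" where
  "zigzag l [] = [l]"
| "zigzag l (b # bs) = (if b then l # zigzag (Suc l) bs else (l + length bs + 1) # zigzag l bs)"

lemma length_zigzag [simp]: "length (zigzag l bs) = length bs + 1"
  by (induction l bs rule: zigzag.induct) auto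

lemma set_zigzag: "set (zigzag l bs) = {l..l + length bs}"
  by (induction l bs rule: zigzag.induct) auto

lemma distinct_zigzag: "distinct (zigzag l bs)"
  by (induction l bs rule: zigzag.induct) (auto simp: set_zigzag)

lemma hd_zigzag: "hd (zigzag l bs) = l \<or> hd (zigzag l bs) = l + length bs"
  by (cases bs) auto

lemma pedges_Cons: "ys \<noteq> [] \<Longrightarrow> pedges (x # ys) = insert {x, hd ys} (pedges ys)"
  by (cases ys) auto

lemma crosses_self: "\<not> crosses {x, y} {x, y}"
  by (auto simp: interleaved_def)

text \<open>The current point borders on the interval of the later points and is joined to one end
  of that interval. So this edge has all later points on one side, apart from its own end.\<close>

lemma noncrossing_zigzag:
  "e \<in> pedges (zigzag l bs) \<Longrightarrow> f \<in> pedges (zigzag l bs) \<Longrightarrow> \<not> crosses e f"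
proof (induction l bs arbitrary: e f rule: zigzag.induct)
  case (2 l b bs)
  define l' x where lx: "l' = (if b then Suc l else l)" "x = (if b then l else l + length bs + 1)"
  let ?ys = "zigzag l' bs"
  have z: "zigzag l (b # bs) = x # ?ys" by (simp add: lx)
  have ne: "?ys \<noteq> []" by (cases bs) auto
  have IH: "\<not> crosses e f" if "e \<in> pedges ?ys" "f \<in> pedges ?ys" for e f
    using 2(1,2) that by (cases b) (auto simp: lx)
  have P: "pedges (zigzag l (b # bs)) = insert {x, hd ?ys} (pedges ?ys)"
    unfolding z by (rule pedges_Cons[OF ne])
  have key: "\<not> crosses {x, hd ?ys} g" if g: "g \<in> pedges ?ys" for g
  proof -
    obtain c d where cd: "g = {c, d}" "c \<in> {l'..l' + length bs}" "d \<in> {l'..l' + length bs}"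
      using pedges_doubleton[OF g distinct_zigzag] unfolding set_zigzag by blast
    have "x = l' - 1 \<and> l' > 0 \<or> x = l' + length bs + 1" by (simp add: lx)
    then have "\<not> interleaved x (hd ?ys) c d"
      using cd(2,3) hd_zigzag[of l' bs] unfolding interleaved_def by auto
    then show ?thesis using cd by simp
  qed
  show ?case
    using 2(3,4) unfolding P
  proof (elim insertE)
    assume "e \<in> pedges ?ys" "f = {x, hd ?ys}"
    then show ?thesis using key crosses_sym by blast
  qed (use IH key crosses_self in auto)
qed simp

lemma zigzag_inj: "length bs = length cs \<Longrightarrow> zigzag l bs = zigzag l cs \<Longrightarrow> bs = cs"
proof (induction l bs arbitrary: cs rule: zigzag.induct)
  case (2 l b bs)
  then obtain c cs' where cs: "cs = c # cs'" "length bs = length cs'" by (cases cs) auto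
  then have "b = c" using 2(4) by (auto split: if_splits)
  with cs 2 show ?case by (auto split: if_splits)
qed simp

text \<open>A path can be read off from its edges once it is known at which end to start.\<close>

lemma pedges_inj:
  assumes "distinct xs" "distinct ys" "hd xs = hd ys" "length xs = length ys" "pedges xs = pedges ys"
  shows "xs = ys"
  using assms
proof (induction xs arbitrary: ys rule: pedges.induct)
  case (1 x y zs)
  then obtain y' zs' where ys: "ys = x # y' # zs'"
    by (cases ys; cases "tl ys") auto
  have next_pt: "x \<notin> e" if "e \<in> pedges (y # zs)" for e
    using pedges_subset_set[OF that] 1(2) by auto
  have nx': "x \<notin> e" if "e \<in> pedges (y' # zs')" for e
    using pedges_subset_set[OF that] 1(3) ys by auto
  have eq: "insert {x, y} (pedges (y # zs)) = insert {x, y'} (pedges (y' # zs'))"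
    using 1(6) ys by simp
  then have "{x, y} \<in> insert {x, y'} (pedges (y' # zs'))" by blast
  then have yy: "y = y'" using nx' by (auto simp: doubleton_eq_iff)
  have "pedges (y # zs) = pedges (y' # zs')"
    using eq next_pt nx' unfolding yy by (metis insertI1 insert_ident)
  then have "y # zs = y' # zs'"
    by (intro 1(1)) (use 1 ys yy in auto)
  then show ?case using ys by simp
next
  case "2_1"
  then show ?case by simp
next
  case ("2_2" v)
  then show ?case by (cases ys) auto
qed

text \<open>The leading \<open>True\<close> makes every sequence start at 0, so that no path is
  counted a second time in reverse. The other \<open>n - 2\<close> bits are free.\<close>

lemma card_ncpaths_lower:
  assumes "2 \<le> n"
  shows "2 ^ (n - 2) \<le> card (ncpaths n)"
proof -
  let ?B = "{bs :: bool list. length bs = n - 2}"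
  let ?g = "\<lambda>bs. pedges (zigzag 0 (True # bs))"
  have "card ?B = 2 ^ (n - 2)"
    using card_lists_length_eq[of "UNIV :: bool set" "n - 2"] by simp
  moreover have "inj_on ?g ?B"
  proof (rule inj_onI)
    fix bs cs assume l: "bs \<in> ?B" "cs \<in> ?B" and eq: "?g bs = ?g cs"
    have "zigzag 0 (True # bs) = zigzag 0 (True # cs)"
      by (rule pedges_inj) (use l eq in \<open>auto simp: distinct_zigzag set_zigzag\<close>)
    then show "bs = cs" using zigzag_inj[of "True # bs" "True # cs" 0] l by simp
  qed
  moreover have "?g ` ?B \<subseteq> ncpaths n"
  proof (rule image_subsetI)
    fix bs assume "bs \<in> ?B"
    then have s: "set (zigzag 0 (True # bs)) = {..<n}"
      unfolding set_zigzag using assms by auto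
    then show "?g bs \<in> ncpaths n"
      unfolding ncpaths_nc noncrossing_def
      using noncrossing_zigzag distinct_zigzag by blast
  qed
  ultimately show ?thesis using card_inj_on_le[of ?g ?B "ncpaths n"] by simp
qed

section \<open>Symmetries of the cyclic order\<close>

text \<open>The ternary cyclic order. Rotations preserve it and reflections reverse it, so
  symmetries are checked on it rather than on the inequalities of
  \<open>interleaved\<close>.\<close>

definition cyc :: "nat \<Rightarrow> nat \<Rightarrow> nat \<Rightarrow> bool" where
  "cyc x y z \<longleftrightarrow> x < y \<and> y < z \<or> y < z \<and> z < x \<or> z < x \<and> x < y"

lemma interleaved_cyc:
  "interleaved a b c d \<longleftrightarrow> a \<noteq> b \<and> c \<noteq> a \<and> c \<noteq> b \<and> d \<noteq> a \<and> d \<noteq> b \<and> cyc a c b \<noteq> cyc a d b"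
proof (cases a b rule: linorder_cases)
  case less
  then show ?thesis unfolding interleaved_def cyc_def by auto
next
  case greater
  then show ?thesis unfolding interleaved_def cyc_def by auto
qed (auto simp: interleaved_def)

text \<open>These are the symmetries of the polygon. The last clause makes layers invariant.\<close>

definition hull_aut :: "nat \<Rightarrow> (nat \<Rightarrow> nat) \<Rightarrow> bool" where
  "hull_aut n \<tau> \<longleftrightarrow> bij_betw \<tau> {..<n} {..<n} \<and>
     (\<forall>a<n. \<forall>b<n. \<forall>c<n. \<forall>d<n. interleaved (\<tau> a) (\<tau> b) (\<tau> c) (\<tau> d) \<longleftrightarrow> interleaved a b c d) \<and>
     (\<forall>k<n. \<tau> ` hull_edge n k \<in> hull_edges n)"

lemma he_subset: "k < n \<Longrightarrow> hull_edge n k \<subseteq> {..<n}"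
  using nx_lt by (auto simp: hull_edge_def)

lemma hull_edges_subset: "e \<in> hull_edges n \<Longrightarrow> e \<subseteq> {..<n}"
  using he_subset by (auto simp: hull_edges_def)

lemma hull_aut_image_hull:
  assumes "hull_aut n \<tau>"
  shows "(`) \<tau> ` hull_edges n = hull_edges n"
proof (rule endo_inj_surj)
  show "(`) \<tau> ` hull_edges n \<subseteq> hull_edges n" using assms by (auto simp: hull_aut_def hull_edges_def)
  have "inj_on ((`) \<tau>) (Pow {..<n})"
    using assms by (intro inj_on_image_Pow) (simp add: hull_aut_def bij_betw_def)
  then show "inj_on ((`) \<tau>) (hull_edges n)"
    by (rule inj_on_subset) (use hull_edges_subset in blast)
qed simp

lemma hull_aut_inv:
  assumes \<tau>: "hull_aut n \<tau>"
  shows "hull_aut n (inv_into {..<n} \<tau>)"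
proof -
  let ?\<sigma> = "inv_into {..<n} \<tau>"
  have bij: "bij_betw \<tau> {..<n} {..<n}" using \<tau> by (simp add: hull_aut_def)
  have lt: "?\<sigma> a < n" if "a < n" for a
    using bij_betw_inv_into[OF bij] that by (auto simp: bij_betw_def)
  have r: "\<tau> (?\<sigma> a) = a" if "a < n" for a
    using bij_betw_inv_into_right[OF bij] that by simp
  have l: "?\<sigma> (\<tau> a) = a" if "a < n" for a
    using bij_betw_inv_into_left[OF bij] that by simp
  have "interleaved (?\<sigma> a) (?\<sigma> b) (?\<sigma> c) (?\<sigma> d) \<longleftrightarrow> interleaved a b c d"
    if "a < n" "b < n" "c < n" "d < n" for a b c d
    using \<tau>[unfolded hull_aut_def, THEN conjunct2, THEN conjunct1, rule_format,
      OF lt[OF that(1)] lt[OF that(2)] lt[OF that(3)] lt[OF that(4)]] r that by simp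
  moreover have "?\<sigma> ` hull_edge n k \<in> hull_edges n" if "k < n" for k
  proof -
    have "hull_edge n k \<in> (`) \<tau> ` hull_edges n" using hull_aut_image_hull[OF \<tau>] that by simp
    then obtain e where e: "e \<in> hull_edges n" "hull_edge n k = \<tau> ` e" by blast
    have "?\<sigma> ` hull_edge n k = (\<lambda>x. ?\<sigma> (\<tau> x)) ` e" unfolding e(2) by (simp add: image_image)
    also have "\<dots> = e" using hull_edges_subset[OF e(1)] l by force
    finally show ?thesis using e by simp
  qed
  ultimately show ?thesis using bij_betw_inv_into[OF bij] by (simp add: hull_aut_def)
qed

section \<open>Rotations and reflections of the cycle\<close>

definition rot :: "nat \<Rightarrow> nat \<Rightarrow> nat \<Rightarrow> nat" where
  "rot n c j = (if c + j < n then c + j else c + j - n)"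

definition reflect :: "nat \<Rightarrow> nat \<Rightarrow> nat \<Rightarrow> nat" where
  "reflect n c j = (if j \<le> c then c - j else c + n - j)"

lemma rot_nx: "c < n \<Longrightarrow> j < n \<Longrightarrow> rot n c (next_pt n j) = next_pt n (rot n c j)"
  by (auto simp: rot_def next_pt_def)

lemma reflect_nx: "c < n \<Longrightarrow> j < n \<Longrightarrow> next_pt n (reflect n c (next_pt n j)) = reflect n c j"
  by (auto simp: reflect_def next_pt_def)

lemma hull_aut_comp:
  assumes \<sigma>: "hull_aut n \<sigma>" and \<tau>: "hull_aut n \<tau>"
  shows "hull_aut n (\<lambda>x. \<sigma> (\<tau> x))"
proof -
  have lt: "\<tau> x < n" if "x < n" for x using \<tau> that by (auto simp: hull_aut_def bij_betw_def)
  have "bij_betw (\<lambda>x. \<sigma> (\<tau> x)) {..<n} {..<n}"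
    using bij_betw_trans[of \<tau> "{..<n}" "{..<n}" \<sigma> "{..<n}"] \<sigma> \<tau> by (simp add: hull_aut_def comp_def)
  moreover have "(\<lambda>x. \<sigma> (\<tau> x)) ` hull_edge n k \<in> hull_edges n" if "k < n" for k
  proof -
    have "\<tau> ` hull_edge n k \<in> hull_edges n" using \<tau> that by (simp add: hull_aut_def)
    then have "\<sigma> ` \<tau> ` hull_edge n k \<in> hull_edges n" using hull_aut_image_hull[OF \<sigma>] by blast
    then show ?thesis by (simp add: image_image)
  qed
  ultimately show ?thesis using \<sigma> \<tau> lt by (simp add: hull_aut_def)
qed

lemma hull_aut_cong:
  assumes \<sigma>: "hull_aut n \<sigma>" and eq: "\<And>x. x < n \<Longrightarrow> \<tau> x = \<sigma> x"
  shows "hull_aut n \<tau>"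
proof -
  have "\<tau> ` hull_edge n k = \<sigma> ` hull_edge n k" if "k < n" for k
    using he_subset[OF that] eq by (intro image_cong) auto
  moreover have "bij_betw \<tau> {..<n} {..<n} = bij_betw \<sigma> {..<n} {..<n}"
    using eq by (intro bij_betw_cong) simp
  ultimately show ?thesis using \<sigma> eq by (simp add: hull_aut_def)
qed

text \<open>By \<open>interleaved_cyc\<close> crossing is an inequality of two orientations, so it
  survives both when all orientations are kept and when all are reversed; \<open>r\<close> tells
  which is the case.\<close>

lemma hull_aut_cycI:
  assumes inj: "inj_on f {..<n}" and lt: "\<And>x. x < n \<Longrightarrow> f x < n"
    and cy: "\<And>x y z. x < n \<Longrightarrow> y < n \<Longrightarrow> z < n \<Longrightarrow> x \<noteq> y \<Longrightarrow> y \<noteq> z \<Longrightarrow> x \<noteq> z \<Longrightarrow>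
      cyc (f x) (f y) (f z) = (if r then \<not> cyc x y z else cyc x y z)"
    and hull: "\<And>k. k < n \<Longrightarrow> f ` hull_edge n k \<in> hull_edges n"
  shows "hull_aut n f"
proof -
  have "bij_betw f {..<n} {..<n}"
    by (rule bij_betw_imageI[OF inj], rule endo_inj_surj) (use inj lt in auto)
  moreover have ne: "f a = f b \<longleftrightarrow> a = b" if "a < n" "b < n" for a b
    using inj that by (auto simp: inj_on_def)
  have "interleaved (f a) (f b) (f p) (f q) \<longleftrightarrow> interleaved a b p q"
    if "a < n" "b < n" "p < n" "q < n" for a b p q
    unfolding interleaved_cyc using that cy[of a p b] cy[of a q b] ne by (cases r) auto
  ultimately show ?thesis using hull by (simp add: hull_aut_def)
qed

lemma hull_aut_nx:
  assumes "3 \<le> n"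
  shows "hull_aut n (next_pt n)"
proof (rule hull_aut_cycI[where r = False])
  show "inj_on (next_pt n) {..<n}" by (auto simp: inj_on_def nx_inj)
  show "next_pt n ` hull_edge n k \<in> hull_edges n" if "k < n" for k
    using that by (simp add: hull_edge_def hull_edges_iff nx_lt)
  fix x y z assume "x < n" "y < n" "z < n" "x \<noteq> y" "y \<noteq> z" "x \<noteq> z"
  then show "cyc (next_pt n x) (next_pt n y) (next_pt n z) = (if False then \<not> cyc x y z else cyc x y z)"
    unfolding cyc_def next_pt_def by (cases "Suc x = n"; cases "Suc y = n"; cases "Suc z = n") auto
qed (rule nx_lt)

lemma hull_aut_flip: "hull_aut n (\<lambda>x. n - 1 - x)"
proof (rule hull_aut_cycI[where r = True])
  show "inj_on (\<lambda>x. n - 1 - x) {..<n}" by (auto simp: inj_on_def)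
  show "(\<lambda>x. n - 1 - x) ` hull_edge n k \<in> hull_edges n" if "k < n" for k
    using that by (auto simp: hull_edge_def hull_edges_iff next_pt_def)
  fix x y z assume lt: "x < n" "y < n" "z < n" and ne: "x \<noteq> y" "y \<noteq> z" "x \<noteq> z"
  have rev: "n - 1 - a < n - 1 - b \<longleftrightarrow> b < a" if "a < n" "b < n" for a b
    using that by auto
  have "cyc (n - 1 - x) (n - 1 - y) (n - 1 - z) \<longleftrightarrow> cyc z y x"
    unfolding cyc_def rev[OF lt(1,2)] rev[OF lt(2,3)] rev[OF lt(3,1)] by blast
  also have "\<dots> \<longleftrightarrow> \<not> cyc x y z"
    using ne unfolding cyc_def by (cases "x < y"; cases "y < z"; cases "z < x") auto
  finally show "cyc (n - 1 - x) (n - 1 - y) (n - 1 - z) = (if True then \<not> cyc x y z else cyc x y z)"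
    by simp
qed auto

text \<open>The bound admits the full turn \<open>c = n\<close>, which occurs in the construction of
  reflections.\<close>

lemma hull_aut_rot:
  assumes n: "3 \<le> n"
  shows "c \<le> n \<Longrightarrow> hull_aut n (rot n c)"
proof (induction c)
  case 0
  \<comment> \<open>The identity is obtained as a symmetry followed by its inverse.\<close>
  have "hull_aut n (\<lambda>x. (inv_into {..<n} (next_pt n)) (next_pt n x))"
    by (rule hull_aut_comp[OF hull_aut_inv hull_aut_nx]) (use hull_aut_nx n in auto)
  then show ?case
    by (rule hull_aut_cong) (use hull_aut_nx[OF n] in \<open>auto simp: rot_def hull_aut_def bij_betw_def\<close>)
next
  case (Suc c)
  have "hull_aut n (\<lambda>x. next_pt n (rot n c x))"
    by (rule hull_aut_comp[OF hull_aut_nx[OF n]]) (use Suc in simp)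
  then show ?case by (rule hull_aut_cong) (use Suc in \<open>auto simp: rot_def next_pt_def\<close>)
qed

lemma hull_aut_reflect:
  assumes n: "3 \<le> n" and c: "c < n"
  shows "hull_aut n (reflect n c)"
proof -
  \<comment> \<open>Modulo \<open>n\<close>, the reflection takes \<open>x\<close> to
    \<open>c - x\<close>, which is \<open>Suc c + (n - 1 - x)\<close>.\<close>
  have "hull_aut n (\<lambda>x. rot n (Suc c) (n - 1 - x))"
    by (rule hull_aut_comp[OF hull_aut_rot[OF n] hull_aut_flip]) (use c in simp)
  then show ?thesis by (rule hull_aut_cong) (use c in \<open>auto simp: rot_def reflect_def\<close>)
qed

text \<open>Turning around would revisit the point visited two steps earlier.\<close>

lemma walk_direction:
  assumes inj: "inj_on \<kappa> {..<m}" and step: "\<And>j. Suc j < m \<Longrightarrow> R (\<kappa> j) (\<kappa> (Suc j)) \<or> R (\<kappa> (Suc j)) (\<kappa> j)"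
    and R: "\<And>x y z. R x z \<Longrightarrow> R y z \<Longrightarrow> x < n \<Longrightarrow> y < n \<Longrightarrow> x = y" and lt: "\<And>j. j < m \<Longrightarrow> \<kappa> j < n"
    and first: "Suc 0 < m \<Longrightarrow> R (\<kappa> 0) (\<kappa> 1)"
  shows "Suc j < m \<Longrightarrow> R (\<kappa> j) (\<kappa> (Suc j))"
proof (induction j)
  case (Suc j)
  have "\<kappa> j \<noteq> \<kappa> (Suc (Suc j))" using inj_onD[OF inj, of j "Suc (Suc j)"] Suc(2) by auto
  then have "\<not> R (\<kappa> (Suc (Suc j))) (\<kappa> (Suc j))" using R Suc lt by (meson Suc_lessD)
  then show ?case using step[of "Suc j"] Suc(2) by blast
qed (use first in simp)

text \<open>The first step fixes the direction of an injective walk. In the backward case the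
  equation is about \<open>next_pt n (\<kappa> j)\<close>: a reflection maps a hull edge to one
  whose number is the predecessor of the image of the old number, because its two ends change
  roles.\<close>

lemma walk_form:
  assumes inj: "inj_on \<kappa> {..<m}" and lt: "\<And>j. j < m \<Longrightarrow> \<kappa> j < n"
    and step: "\<And>j. Suc j < m \<Longrightarrow> \<kappa> (Suc j) = next_pt n (\<kappa> j) \<or> \<kappa> j = next_pt n (\<kappa> (Suc j))"
    and m: "0 < m" "m \<le> n"
  shows "(\<forall>j<m. \<kappa> j = rot n (\<kappa> 0) j) \<or> (\<forall>j<m. next_pt n (\<kappa> j) = reflect n (next_pt n (\<kappa> 0)) j)"
proof (cases "Suc 0 < m \<longrightarrow> \<kappa> 1 = next_pt n (\<kappa> 0)")
  case True
  have c: "\<kappa> 0 < n" using lt m by simp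
  have dir: "\<kappa> (Suc j) = next_pt n (\<kappa> j)" if "Suc j < m" for j
    by (rule walk_direction[where R = "\<lambda>x y. y = next_pt n x" and n = n and m = m])
       (use inj step lt True that nx_inj in auto)
  have "\<kappa> j = rot n (\<kappa> 0) j" if "j < m" for j
    using that
  proof (induction j)
    case (Suc j)
    then show ?case using dir[of j] rot_nx[OF c, of j] m by (simp add: next_pt_def split: if_splits)
  qed (use c in \<open>simp add: rot_def\<close>)
  then show ?thesis by blast
next
  case False
  then have first: "\<kappa> 0 = next_pt n (\<kappa> 1)" using step[of 0] by auto
  have c: "next_pt n (\<kappa> 0) < n" using lt m nx_lt by simp
  have dir: "\<kappa> j = next_pt n (\<kappa> (Suc j))" if "Suc j < m" for j
    by (rule walk_direction[where R = "\<lambda>x y. x = next_pt n y" and n = n and m = m])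
       (use inj step lt first that in auto)
  have "next_pt n (\<kappa> j) = reflect n (next_pt n (\<kappa> 0)) j" if "j < m" for j
    using that
  proof (induction j)
    case (Suc j)
    have "next_pt n (reflect n (next_pt n (\<kappa> 0)) (Suc j)) = reflect n (next_pt n (\<kappa> 0)) j"
      using reflect_nx[OF c, of j] Suc m by (simp add: next_pt_def split: if_splits)
    also have "\<dots> = next_pt n (\<kappa> j)" using Suc by simp
    also have "\<dots> = next_pt n (next_pt n (\<kappa> (Suc j)))" using dir[of j] Suc by simp
    finally have "reflect n (next_pt n (\<kappa> 0)) (Suc j) = next_pt n (\<kappa> (Suc j))"
      using nx_inj[of "reflect n (next_pt n (\<kappa> 0)) (Suc j)" n "next_pt n (\<kappa> (Suc j))"] Suc(2) c lt[OF Suc(2)] nx_lt m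
      by (auto simp: reflect_def split: if_splits)
    then show ?case by simp
  qed (simp add: reflect_def)
  then show ?thesis by blast
qed

text \<open>The positions visited form an arc that grows in one direction, and it is not yet the
  whole cycle, so the next position in this direction is free. Hence a greedy walk cannot get
  stuck.\<close>

lemma walk_extend:
  assumes inj: "inj_on \<kappa> {..<Suc m}" and lt: "\<And>j. j < Suc m \<Longrightarrow> \<kappa> j < n"
    and step: "\<And>j. Suc j < Suc m \<Longrightarrow> \<kappa> (Suc j) = next_pt n (\<kappa> j) \<or> \<kappa> j = next_pt n (\<kappa> (Suc j))"
    and m: "Suc m < n"
  shows "\<exists>y<n. y \<notin> \<kappa> ` {..<Suc m} \<and> (y = next_pt n (\<kappa> m) \<or> \<kappa> m = next_pt n y)"
proof -
  have "(\<forall>j<Suc m. \<kappa> j = rot n (\<kappa> 0) j) \<or> (\<forall>j<Suc m. next_pt n (\<kappa> j) = reflect n (next_pt n (\<kappa> 0)) j)"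
    by (rule walk_form) (use assms in auto)
  then show ?thesis
  proof
    assume r: "\<forall>j<Suc m. \<kappa> j = rot n (\<kappa> 0) j"
    have c: "\<kappa> 0 < n" using lt by simp
    have "next_pt n (\<kappa> m) = rot n (\<kappa> 0) (Suc m)"
    proof -
      have "next_pt n m = Suc m" using m by (simp add: next_pt_def)
      then show ?thesis using rot_nx[OF c, of m] r[rule_format, of m] m by simp
    qed
    moreover have "rot n (\<kappa> 0) (Suc m) \<noteq> rot n (\<kappa> 0) i" if "i < Suc m" for i
      using that m c by (auto simp: rot_def)
    ultimately have "next_pt n (\<kappa> m) \<noteq> \<kappa> i" if "i < Suc m" for i
      using r[rule_format, OF that] that by metis
    then have "next_pt n (\<kappa> m) \<notin> \<kappa> ` {..<Suc m}" by blast
    then show ?thesis using nx_lt lt by blast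
  next
    assume r: "\<forall>j<Suc m. next_pt n (\<kappa> j) = reflect n (next_pt n (\<kappa> 0)) j"
    let ?c = "next_pt n (\<kappa> 0)"
    have c: "?c < n" using lt nx_lt by simp
    define y where "y = (if \<kappa> m = 0 then n - 1 else \<kappa> m - 1)"
    have y: "y < n" "next_pt n y = \<kappa> m" using lt[of m] m by (auto simp: y_def next_pt_def)
    have "next_pt n (reflect n ?c (Suc m)) = next_pt n (\<kappa> m)"
    proof -
      have "next_pt n m = Suc m" using m by (simp add: next_pt_def)
      then show ?thesis using reflect_nx[OF c, of m] r[rule_format, of m] m by simp
    qed
    moreover have "reflect n ?c (Suc m) < n" using c m by (auto simp: reflect_def)
    ultimately have rm: "reflect n ?c (Suc m) = \<kappa> m" using nx_inj lt by blast
    have "reflect n ?c (Suc m) \<noteq> reflect n ?c i" if "i < Suc m" for i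
      using that m c by (auto simp: reflect_def)
    then have "y \<noteq> \<kappa> i" if "i < Suc m" for i
      using r[rule_format, OF that] that y(2) rm by metis
    then have "y \<notin> \<kappa> ` {..<Suc m}" by blast
    then show ?thesis using y by auto
  qed
qed

text \<open>The order in which a complete walk visits the hull edges differs from their numbering by
  a rotation or a reflection; \<open>\<tau>\<close> is its inverse.\<close>

lemma hull_walk:
  assumes inj: "inj_on \<kappa> {..<n}" and lt: "\<And>j. j < n \<Longrightarrow> \<kappa> j < n"
    and step: "\<And>j. Suc j < n \<Longrightarrow> \<kappa> (Suc j) = next_pt n (\<kappa> j) \<or> \<kappa> j = next_pt n (\<kappa> (Suc j))"
    and n: "3 \<le> n"
  shows "\<exists>\<tau>. hull_aut n \<tau> \<and> (\<forall>j<n. \<tau> ` hull_edge n (\<kappa> j) = hull_edge n j)"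
proof -
  have c: "\<kappa> 0 < n" using lt n by simp
  have "(\<forall>j<n. \<kappa> j = rot n (\<kappa> 0) j) \<or> (\<forall>j<n. next_pt n (\<kappa> j) = reflect n (next_pt n (\<kappa> 0)) j)"
    by (rule walk_form) (use assms in auto)
  then have "\<exists>\<rho>. hull_aut n \<rho> \<and> (\<forall>j<n. \<rho> ` hull_edge n j = hull_edge n (\<kappa> j))"
  proof
    assume \<kappa>: "\<forall>j<n. \<kappa> j = rot n (\<kappa> 0) j"
    have "rot n (\<kappa> 0) ` hull_edge n j = hull_edge n (\<kappa> j)" if "j < n" for j
      using rot_nx[OF c that] \<kappa>[rule_format, OF that] by (simp add: hull_edge_def)
    then show ?thesis using hull_aut_rot[OF n] c by (meson less_imp_le)
  next
    assume \<kappa>: "\<forall>j<n. next_pt n (\<kappa> j) = reflect n (next_pt n (\<kappa> 0)) j"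
    let ?c = "next_pt n (\<kappa> 0)"
    have c': "?c < n" using c nx_lt by simp
    have "reflect n ?c ` hull_edge n j = hull_edge n (\<kappa> j)" if j: "j < n" for j
    proof -
      have "reflect n ?c (next_pt n j) < n" using c' nx_lt[OF j] by (auto simp: reflect_def)
      then have "reflect n ?c (next_pt n j) = \<kappa> j"
        using reflect_nx[OF c' j] \<kappa>[rule_format, OF j] nx_inj lt[OF j] by metis
      then show ?thesis using \<kappa>[rule_format, OF j] by (auto simp: hull_edge_def)
    qed
    then show ?thesis using hull_aut_reflect[OF n c'] by blast
  qed
  then obtain \<rho> where \<rho>: "hull_aut n \<rho>" "\<And>j. j < n \<Longrightarrow> \<rho> ` hull_edge n j = hull_edge n (\<kappa> j)" by blast
  have "inv_into {..<n} \<rho> ` hull_edge n (\<kappa> j) = hull_edge n j" if "j < n" for j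
  proof -
    have "inv_into {..<n} \<rho> ` hull_edge n (\<kappa> j) = inv_into {..<n} \<rho> ` \<rho> ` hull_edge n j" using \<rho>(2)[OF that] by simp
    also have "\<dots> = hull_edge n j"
      by (rule inv_into_image_cancel) (use \<rho>(1) he_subset[OF that] in \<open>auto simp: hull_aut_def bij_betw_def\<close>)
    finally show ?thesis .
  qed
  then show ?thesis using hull_aut_inv[OF \<rho>(1)] by blast
qed

section \<open>Action of the symmetries on paths\<close>

lemma hull_aut_crosses:
  assumes "hull_aut n \<tau>" "S \<in> spanning_paths n" "e \<in> S" "f \<in> S"
  shows "crosses (\<tau> ` e) (\<tau> ` f) \<longleftrightarrow> crosses e f"
proof -
  obtain a b where e: "e = {a, b}" "a < n" "b < n" using spanning_paths_edge assms(2,3) by metis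
  obtain c d where f: "f = {c, d}" "c < n" "d < n" using spanning_paths_edge assms(2,4) by metis
  show ?thesis using assms(1) e f by (simp add: hull_aut_def)
qed

lemma hull_aut_ncpaths:
  assumes \<tau>: "hull_aut n \<tau>" and v: "v \<in> ncpaths n"
  shows "(`) \<tau> ` v \<in> ncpaths n"
proof -
  obtain xs where xs: "v = pedges xs" "distinct xs" "set xs = {..<n}"
    using v by (auto simp: ncpaths_nc noncrossing_def)
  have b: "inj_on \<tau> {..<n}" "\<tau> ` {..<n} = {..<n}" using \<tau> by (auto simp: hull_aut_def bij_betw_def)
  have "pedges (map \<tau> xs) \<in> spanning_paths n"
    by (rule spanning_pathsI) (use xs b in \<open>auto simp: distinct_map\<close>)
  then show ?thesis
    using v hull_aut_crosses[OF \<tau>] xs by (auto simp: ncpaths_def pedges_map)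
qed

lemma inj_on_edge_image:
  assumes "hull_aut n \<tau>"
  shows "inj_on ((`) \<tau>) (Pow {..<n})" "inj_on ((`) ((`) \<tau>)) (Pow (Pow {..<n}))"
proof -
  show "inj_on ((`) \<tau>) (Pow {..<n})"
    using assms by (intro inj_on_image_Pow) (simp add: hull_aut_def bij_betw_def)
  then show "inj_on ((`) ((`) \<tau>)) (Pow (Pow {..<n}))" by (rule inj_on_image_Pow)
qed

lemma hull_aut_bij_ncpaths:
  assumes "hull_aut n \<tau>"
  shows "bij_betw (\<lambda>v. (`) \<tau> ` v) (ncpaths n) (ncpaths n)"
proof -
  have "inj_on (\<lambda>v. (`) \<tau> ` v) (ncpaths n)"
    using inj_on_edge_image(2)[OF assms] ncpaths_subset by (rule inj_on_subset)
  moreover have "(\<lambda>v. (`) \<tau> ` v) ` ncpaths n \<subseteq> ncpaths n" using hull_aut_ncpaths[OF assms] by blast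
  ultimately show ?thesis by (intro bij_betw_imageI) (simp_all add: endo_inj_surj)
qed

lemma hull_aut_lay:
  assumes \<tau>: "hull_aut n \<tau>" and v: "v \<in> ncpaths n"
  shows "layer n ((`) \<tau> ` v) = layer n v"
proof -
  have i: "inj_on ((`) \<tau>) (v \<union> hull_edges n)"
    by (rule inj_on_subset[OF inj_on_edge_image(1)[OF \<tau>]])
       (use v ncpaths_subset hull_edges_subset in blast)
  have "(`) \<tau> ` v - hull_edges n = (`) \<tau> ` v - (`) \<tau> ` hull_edges n"
    using hull_aut_image_hull[OF \<tau>] by simp
  also have "\<dots> = (`) \<tau> ` (v - hull_edges n)"
    by (rule sym, rule inj_on_image_set_diff[OF i]) auto
  finally show ?thesis
    unfolding layer_def using card_image[OF inj_on_subset[OF i, of "v - hull_edges n"]] by auto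
qed

lemma exch_image:
  assumes "inj_on g S" "u \<subseteq> S" "v \<subseteq> S" "exchange u v"
  shows "exchange (g ` u) (g ` v)"
proof -
  obtain e f where ef: "e \<in> u" "f \<notin> u" "v = insert f (u - {e})" using assms(4) by (auto simp: exchange_def)
  have f: "f \<in> S" using ef assms(3) by auto
  have "g f \<notin> g ` u" using ef f assms(1,2) by (auto dest: inj_onD)
  moreover have "g ` (u - {e}) = g ` u - {g e}"
    using inj_on_image_set_diff[OF assms(1), of u "{e}"] ef assms(2) by auto
  ultimately show ?thesis unfolding exchange_def
    using ef by (intro exI[of _ "g e"] exI[of _ "g f"]) auto
qed

lemma exch_image_iff:
  assumes g: "inj_on g S" and uv: "u \<subseteq> S" "v \<subseteq> S"
  shows "exchange (g ` u) (g ` v) \<longleftrightarrow> exchange u v"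
proof
  assume e: "exchange (g ` u) (g ` v)"
  let ?h = "inv_into S g"
  have "inj_on ?h (g ` S)" by (rule inj_on_inv_into) simp
  then have "exchange (?h ` g ` u) (?h ` g ` v)" by (rule exch_image) (use uv e in auto)
  then show "exchange u v" using inv_into_image_cancel[OF g] uv by simp
qed (rule exch_image[OF g uv])

section \<open>Reasoning about programs of the word RAM\<close>

text \<open>A total-correctness judgement for one initial state. The time is only bounded from
  above, so that bounds can be rounded up.\<close>

definition runs :: "nat \<Rightarrow> com \<Rightarrow> state \<Rightarrow> nat \<Rightarrow> (state \<Rightarrow> bool) \<Rightarrow> bool" where
  "runs w c s t Q \<longleftrightarrow> (\<exists>t' s'. run w c s t' s' \<and> t' \<le> t \<and> Q s')"

lemma runs_mono: "runs w c s t Q \<Longrightarrow> t \<le> u \<Longrightarrow> (\<And>s'. Q s' \<Longrightarrow> R s') \<Longrightarrow> runs w c s u R"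
  unfolding runs_def by (meson le_trans)

lemma runs_Seq:
  assumes "runs w c s t R" "\<And>s'. R s' \<Longrightarrow> runs w d s' u Q"
  shows "runs w (Seq c d) s (t + u) Q"
proof -
  obtain t1 s1 where 1: "run w c s t1 s1" "t1 \<le> t" "R s1" using assms(1) by (auto simp: runs_def)
  obtain t2 s2 where 2: "run w d s1 t2 s2" "t2 \<le> u" "Q s2" using assms(2)[OF 1(3)] by (auto simp: runs_def)
  show ?thesis
    unfolding runs_def
    by (intro exI[of _ "t1 + t2"] exI[of _ s2]) (use 1 2 in \<open>auto intro: run.Seq\<close>)
qed

lemma runs_If:
  assumes "eval w b s \<noteq> 0 \<Longrightarrow> runs w c s t Q" "eval w b s = 0 \<Longrightarrow> runs w d s t Q"
  shows "runs w (If b c d) s (1 + cost b + t) Q"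
proof (cases "eval w b s = 0")
  case True
  then obtain t1 s1 where 1: "run w d s t1 s1" "t1 \<le> t" "Q s1" using assms(2) by (auto simp: runs_def)
  show ?thesis unfolding runs_def
    by (intro exI[of _ "1 + cost b + t1"] exI[of _ s1] conjI run.IfFalse) (use 1 True in auto)
next
  case False
  then obtain t1 s1 where 1: "run w c s t1 s1" "t1 \<le> t" "Q s1" using assms(1) by (auto simp: runs_def)
  show ?thesis unfolding runs_def
    by (intro exI[of _ "1 + cost b + t1"] exI[of _ s1] conjI run.IfTrue) (use 1 False in auto)
qed

section \<open>Straight-line programs and frame conditions\<close>

fun loopfree :: "com \<Rightarrow> bool" where
  "loopfree (Seq c d) \<longleftrightarrow> loopfree c \<and> loopfree d"
| "loopfree (If b c d) \<longleftrightarrow> loopfree c \<and> loopfree d"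
| "loopfree (While b c) \<longleftrightarrow> False"
| "loopfree _ \<longleftrightarrow> True"

text \<open>This lets the simplifier execute straight-line code. The clause for \<open>While\<close>
  is a dummy, excluded by \<open>loopfree\<close>.\<close>

fun exec :: "nat \<Rightarrow> com \<Rightarrow> state \<Rightarrow> state" where
  "exec w Skip s = s"
| "exec w (Assign x e) s = s\<lparr>vars := (vars s)(x := eval w e s)\<rparr>"
| "exec w (Store a d e) s =
     s\<lparr>arrays := (arrays s)(a := (arrays s a)(eval w d s := eval w e s))\<rparr>"
| "exec w (Seq c d) s = exec w d (exec w c s)"
| "exec w (If b c d) s = (if eval w b s \<noteq> 0 then exec w c s else exec w d s)"
| "exec w (While b c) s = s"

fun time_bound :: "com \<Rightarrow> nat" where
  "time_bound Skip = 1"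
| "time_bound (Assign x e) = 1 + cost e"
| "time_bound (Store a d e) = 1 + cost d + cost e"
| "time_bound (Seq c d) = time_bound c + time_bound d"
| "time_bound (If b c d) = 1 + cost b + max (time_bound c) (time_bound d)"
| "time_bound (While b c) = 0"

lemma runs_exec: "loopfree c \<Longrightarrow> runs w c s (time_bound c) (\<lambda>s'. s' = exec w c s)"
proof (induction c arbitrary: s)
  case (Seq c d)
  have "runs w c s (time_bound c) (\<lambda>s'. s' = exec w c s)" using Seq by simp
  then have "runs w (Seq c d) s (time_bound c + time_bound d) (\<lambda>s'. s' = exec w d (exec w c s))"
    by (rule runs_Seq) (use Seq in simp)
  then show ?case by simp
next
  case (If b c d)
  have "runs w (If b c d) s (1 + cost b + max (time_bound c) (time_bound d))
      (\<lambda>s'. s' = exec w (If b c d) s)"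
  proof (rule runs_If)
    assume "eval w b s \<noteq> 0"
    moreover have "runs w c s (time_bound c) (\<lambda>s'. s' = exec w c s)" using If by simp
    ultimately show "runs w c s (max (time_bound c) (time_bound d)) (\<lambda>s'. s' = exec w (If b c d) s)"
      by (auto elim: runs_mono)
  next
    assume "eval w b s = 0"
    moreover have "runs w d s (time_bound d) (\<lambda>s'. s' = exec w d s)" using If by simp
    ultimately show "runs w d s (max (time_bound c) (time_bound d)) (\<lambda>s'. s' = exec w (If b c d) s)"
      by (auto elim: runs_mono)
  qed
  then show ?case by simp
next
  case Skip
  show ?case unfolding runs_def by (auto intro: run.Skip)
next
  case (Assign x e)
  show ?case unfolding runs_def using run.Assign[of w x e s] by fastforce
next
  case (Store a d e)
  show ?case unfolding runs_def using run.Store[of w a d e s] by fastforce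
qed simp

lemma runs_loopfree:
  "loopfree c \<Longrightarrow> time_bound c \<le> t \<Longrightarrow> Q (exec w c s) \<Longrightarrow> runs w c s t Q"
  by (rule runs_mono[OF runs_exec]) auto

text \<open>A syntactic bound on what a program may change. It yields frame conditions, so that
  invariants need only mention what does change.\<close>

fun mod_vars :: "com \<Rightarrow> name set" where
  "mod_vars (Assign x e) = {x}"
| "mod_vars (Seq c d) = mod_vars c \<union> mod_vars d"
| "mod_vars (If b c d) = mod_vars c \<union> mod_vars d"
| "mod_vars (While b c) = mod_vars c"
| "mod_vars _ = {}"

fun mod_arrays :: "com \<Rightarrow> name set" where
  "mod_arrays (Store a d e) = {a}"
| "mod_arrays (Seq c d) = mod_arrays c \<union> mod_arrays d"
| "mod_arrays (If b c d) = mod_arrays c \<union> mod_arrays d"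
| "mod_arrays (While b c) = mod_arrays c"
| "mod_arrays _ = {}"

definition agree :: "name set \<Rightarrow> name set \<Rightarrow> state \<Rightarrow> state \<Rightarrow> bool" where
  "agree V B s s' \<longleftrightarrow> (\<forall>x. x \<notin> V \<longrightarrow> vars s' x = vars s x) \<and> (\<forall>a. a \<notin> B \<longrightarrow> arrays s' a = arrays s a)"

lemma agree_refl [simp]: "agree V B s s" by (simp add: agree_def)

lemma run_agree: "run w c s t s' \<Longrightarrow> agree (mod_vars c) (mod_arrays c) s s'"
  by (induction rule: run.induct) (auto simp: agree_def)

lemma runs_agree:
  "runs w c s t Q \<Longrightarrow> runs w c s t (\<lambda>s'. Q s' \<and> agree (mod_vars c) (mod_arrays c) s s')"
  unfolding runs_def using run_agree by blast

section \<open>Counting loops\<close>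

definition For :: "name \<Rightarrow> expr \<Rightarrow> expr \<Rightarrow> com \<Rightarrow> com" where
  "For x lo hi body = Seq (Assign x lo)
     (While (Op Less (Var x) hi) (Seq body (Assign x (Op Add (Var x) (Const 1)))))"

lemma mod_For [simp]:
  "mod_vars (For x lo hi body) = insert x (mod_vars body)"
  "mod_arrays (For x lo hi body) = mod_arrays body"
  by (auto simp: For_def)

lemma runs_While_step:
  assumes b: "eval w b s \<noteq> 0" and c: "runs w c s t R"
    and rest: "\<And>s'. R s' \<Longrightarrow> runs w (While b c) s' u Q"
  shows "runs w (While b c) s (1 + cost b + t + u) Q"
proof -
  obtain t1 s1 where 1: "run w c s t1 s1" "t1 \<le> t" "R s1" using c by (auto simp: runs_def)
  obtain t2 s2 where 2: "run w (While b c) s1 t2 s2" "t2 \<le> u" "Q s2"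
    using rest[OF 1(3)] by (auto simp: runs_def)
  show ?thesis unfolding runs_def
    by (intro exI[of _ "1 + cost b + t1 + t2"] exI[of _ s2] conjI run.WhileTrue[OF b 1(1) 2(1)])
       (use 1 2 in auto)
qed

text \<open>The bound \<open>hi\<close> is evaluated before each pass, so the body must not change
  its value; \<open>h < 2 ^ w\<close> keeps the counter from wrapping around. One pass costs
  \<open>B i\<close> for the body, \<open>cost hi + 3\<close> for the test and 4 for the increment.
  The initial assignment and the last test together cost
  \<open>cost lo + cost hi + 4\<close>.\<close>

lemma runs_For:
  fixes I :: "nat \<Rightarrow> state \<Rightarrow> bool"
  assumes lo: "eval w lo s0 = l" and lh: "l \<le> h" "h < 2 ^ w"
    and x: "x \<notin> mod_vars body"
    and hi: "\<And>s. agree (insert x (mod_vars body)) (mod_arrays body) s0 s \<Longrightarrow> eval w hi s = h"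
    and init: "I l (s0\<lparr>vars := (vars s0)(x := l)\<rparr>)"
    and step: "\<And>i s. l \<le> i \<Longrightarrow> i < h \<Longrightarrow> vars s x = i \<Longrightarrow>
        agree (insert x (mod_vars body)) (mod_arrays body) s0 s \<Longrightarrow> I i s \<Longrightarrow>
        runs w body s (B i) (\<lambda>s'. I (Suc i) (s'\<lparr>vars := (vars s')(x := Suc i)\<rparr>))"
    and post: "\<And>s. vars s x = h \<Longrightarrow> agree (insert x (mod_vars body)) (mod_arrays body) s0 s \<Longrightarrow>
        I h s \<Longrightarrow> Q s"
    and T: "(\<Sum>i=l..<h. B i + cost hi + 7) + (cost lo + cost hi + 4) \<le> T"
  shows "runs w (For x lo hi body) s0 T Q"
proof -
  let ?A = "agree (insert x (mod_vars body)) (mod_arrays body) s0"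
  let ?b = "Op Less (Var x) hi"
  let ?c = "Seq body (Assign x (Op Add (Var x) (Const 1)))"
  \<comment> \<open>Induction on the number \<open>k\<close> of passes that are left.\<close>
  have loop: "runs w (While ?b ?c) s ((\<Sum>i=h-k..<h. B i + cost hi + 7) + (cost hi + 3)) Q"
    if "k \<le> h - l" "vars s x = h - k" "?A s" "I (h - k) s" for k s
    using that
  proof (induction k arbitrary: s)
    case 0
    have "eval w ?b s = 0" using hi[OF 0(3)] 0(2) by simp
    then have "run w (While ?b ?c) s (1 + cost ?b) s" by (rule run.WhileFalse)
    moreover have "Q s" using post 0 by simp
    ultimately show ?case unfolding runs_def by (intro exI[of _ "1 + cost ?b"] exI[of _ s]) simp
  next
    case (Suc k)
    define i where "i = h - Suc k"
    have i: "l \<le> i" "i < h" "Suc i = h - k" using Suc(2) lh by (auto simp: i_def)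
    have tr: "eval w ?b s \<noteq> 0" using hi[OF Suc(4)] Suc(3) i by (simp add: i_def)
    \<comment> \<open>With word length 0 the constant 1 of the increment would be reduced to
      0.\<close>
    have "(2::nat) ^ w > 1" using i lh by linarith
    then have one: "0 < w" by (cases w) auto
    have "runs w body s (B i) (\<lambda>s'. I (Suc i) (s'\<lparr>vars := (vars s')(x := Suc i)\<rparr>) \<and>
        agree (mod_vars body) (mod_arrays body) s s')"
      by (rule runs_agree, rule step) (use Suc i in \<open>auto simp: i_def\<close>)
    then have "runs w ?c s (B i + 4) (\<lambda>s'. I (Suc i) s' \<and> vars s' x = Suc i \<and> ?A s')"
    proof (rule runs_Seq)
      fix s' assume s': "I (Suc i) (s'\<lparr>vars := (vars s')(x := Suc i)\<rparr>) \<and>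
        agree (mod_vars body) (mod_arrays body) s s'"
      have xi: "vars s' x = i" using s' x Suc(3) by (simp add: agree_def i_def)
      have "(i + 1) mod 2 ^ w = Suc i" using i lh by simp
      moreover have "?A (s'\<lparr>vars := (vars s')(x := Suc i)\<rparr>)"
        using s' Suc(4) by (auto simp: agree_def)
      ultimately show "runs w (Assign x (Op Add (Var x) (Const 1))) s' 4
          (\<lambda>s'. I (Suc i) s' \<and> vars s' x = Suc i \<and> ?A s')"
        using s' xi one by (intro runs_loopfree) simp_all
    qed
    then have "runs w (While ?b ?c) s (1 + cost ?b + (B i + 4) +
        ((\<Sum>i=h-k..<h. B i + cost hi + 7) + (cost hi + 3))) Q"
      by (rule runs_While_step[OF tr]) (use Suc i in auto)
    moreover have "(\<Sum>i=h - Suc k..<h. B i + cost hi + 7) =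
        B i + cost hi + 7 + (\<Sum>i=h-k..<h. B i + cost hi + 7)"
      using i by (simp add: sum.atLeast_Suc_lessThan flip: i_def)
    ultimately show ?case by (simp add: algebra_simps)
  qed
  have "runs w (Assign x lo) s0 (1 + cost lo) (\<lambda>s. s = s0\<lparr>vars := (vars s0)(x := l)\<rparr>)"
    by (rule runs_loopfree) (use lo in simp_all)
  then have "runs w (For x lo hi body) s0 ((1 + cost lo) +
      ((\<Sum>i=h-(h-l)..<h. B i + cost hi + 7) + (cost hi + 3))) Q"
    unfolding For_def
    by (rule runs_Seq) (rule loop, use init lh in \<open>auto simp: agree_def\<close>)
  then show ?thesis by (rule runs_mono) (use T lh in auto)
qed

section \<open>The algorithm\<close>

definition degree_expr :: expr where
  "degree_expr = Op Sub (Elem ''off'' (Op Add (Var ''v'') (Const 1))) (Elem ''off'' (Var ''v''))"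

definition max_degree :: com where
  "max_degree = For ''v'' (Const 0) (Var ''N'')
     (If (Op Less (Var ''m'') degree_expr) (Assign ''m'' degree_expr) Skip)"

definition mark_hull :: com where
  "mark_hull = For ''v'' (Const 0) (Var ''N'')
     (If (Op Equal degree_expr (Var ''m''))
       (Seq (Store ''dist'' (Var ''v'') (Const 1)) (Assign ''n'' (Op Add (Var ''n'') (Const 1)))) Skip)"

text \<open>\<open>W\<close> tells which path a vertex number stands for. The program sees only
  \<open>A\<close>, so one and the same run can be analysed under every suitable \<open>W\<close>,
  which is exploited after the labelling. The fourth power of \<open>N\<close> leaves room for
  indices of order \<open>N * N\<close>.\<close>

locale numbered_paths =
  fixes n N w :: nat and W :: "nat \<Rightarrow> nat set set" and A :: "nat list list"
  assumes n: "5 \<le> n" and bij: "bij_betw W {..<N} (ncpaths n)" and length_A: "length A = N"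
    and nbrs: "\<And>v. v < N \<Longrightarrow> distinct (A ! v) \<and> set (A ! v) = {u. u < N \<and> exchange (W v) (W u)}"
    and word: "N ^ 4 \<le> 2 ^ w"
begin

definition L :: "nat \<Rightarrow> nat" where "L v = layer n (W v)"

lemma W_in [simp]: "v < N \<Longrightarrow> W v \<in> ncpaths n" using bij by (auto simp: bij_betw_def)

lemma W_eq: "u < N \<Longrightarrow> v < N \<Longrightarrow> W u = W v \<longleftrightarrow> u = v" using bij by (auto simp: bij_betw_def inj_on_def)

lemma W_ex: "S \<in> ncpaths n \<Longrightarrow> \<exists>v<N. W v = S"
  using bij unfolding bij_betw_def by (metis imageE lessThan_iff)

lemma N_card: "N = card (ncpaths n)" using bij_betw_same_card[OF bij] by simp

lemma N_lower: "2 ^ (n - 2) \<le> N" using card_ncpaths_lower[of n] n N_card by simp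

lemma n_le_N: "n \<le> N" and N_ge: "8 \<le> N"
proof -
  have "n \<le> 2 ^ (n - 2) \<and> 8 \<le> (2::nat) ^ (n - 2)" using n
  proof (induction n rule: dec_induct)
    case (step m)
    then have "Suc m - 2 = Suc (m - 2)" by linarith
    then have "(2::nat) ^ (Suc m - 2) = 2 * 2 ^ (m - 2)" by (simp only: power_Suc)
    then show ?case using step by simp
  qed simp
  then show "n \<le> N" "8 \<le> N" using N_lower by linarith+
qed

text \<open>The largest indices are those into \<open>adj\<close> and into the table
  \<open>T\<close>, which has \<open>N + 1\<close> rows of length \<open>N\<close>. As
  \<open>8 \<le> N\<close>, the fourth power of \<open>N\<close> exceeds the stated value.\<close>

lemma word_bounds: "4 * (N * N) + 4 < 2 ^ w" "0 < w" "2 < (2::nat) ^ w" "3 < (2::nat) ^ w"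
proof -
  have "4 * (N * N) + 4 < N * N * (N * N)"
  proof -
    have "8 * 8 \<le> N * N" using N_ge by (intro mult_mono) auto
    then have "64 * (N * N) \<le> N * N * (N * N)" by (intro mult_mono) auto
    then show ?thesis using \<open>8 * 8 \<le> N * N\<close> by linarith
  qed
  also have "\<dots> \<le> 2 ^ w" using word by (simp add: power4_eq_xxxx mult.assoc)
  finally show *: "4 * (N * N) + 4 < 2 ^ w" .
  then show "2 < (2::nat) ^ w" "3 < (2::nat) ^ w" by linarith+
  then show "0 < w" by (cases w) auto
qed

lemma fits: "x \<le> 4 * (N * N) \<Longrightarrow> x < 2 ^ w" using word_bounds(1) by linarith

lemma fits_N: "x \<le> 4 * N \<Longrightarrow> x < 2 ^ w"
proof (rule fits)
  assume "x \<le> 4 * N"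
  also have "N \<le> N * N" by simp
  finally show "x \<le> 4 * (N * N)" by simp
qed

lemma mod_word [simp]: "2 mod 2 ^ w = (2::nat)" "3 mod 2 ^ w = (3::nat)"
  using word_bounds by simp_all

lemma L_less: "v < N \<Longrightarrow> L v < n" unfolding L_def using lay_less n by simp

lemma nbr_L: "v < N \<Longrightarrow> u \<in> set (A ! v) \<Longrightarrow> u < N \<and> L u \<le> L v + 1 \<and> L v \<le> L u + 1"
proof -
  assume v: "v < N" "u \<in> set (A ! v)"
  then have u: "u < N" "exchange (W v) (W u)" using nbrs[OF v(1)] by auto
  have "finite (W v)" "finite (W u)" using v u ncpaths_card W_in by blast+
  then show "u < N \<and> L u \<le> L v + 1 \<and> L v \<le> L u + 1"
    using u lay_exch[of "W v" "W u" n] lay_exch[of "W u" "W v" n] exch_sym unfolding L_def by blast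
qed

lemma degree_card: "v < N \<Longrightarrow> length (A ! v) = card {u \<in> ncpaths n. exchange (W v) u}"
proof -
  assume v: "v < N"
  have "W ` {u. u < N \<and> exchange (W v) (W u)} = {u \<in> ncpaths n. exchange (W v) u}"
    using W_ex by (auto simp: image_iff)
  moreover have "inj_on W {u. u < N \<and> exchange (W v) (W u)}" by (auto simp: inj_on_def W_eq)
  ultimately have "card {u. u < N \<and> exchange (W v) (W u)} = card {u \<in> ncpaths n. exchange (W v) u}"
    using card_image by fastforce
  then show ?thesis using nbrs[OF v] distinct_card[of "A ! v"] by simp
qed

lemma degree_hull: "v < N \<Longrightarrow> L v = 0 \<Longrightarrow> length (A ! v) = 3 * n - 7"
proof -
  assume v: "v < N" "L v = 0"
  then obtain k where "k < n" "W v = hull_path n k" using lay_0_ex[of "W v" n] n by (auto simp: L_def)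
  then show ?thesis using card_Hnbrs[of k n] degree_card[OF v(1)] n by (simp add: Hnbrs_def)
qed

lemma degree_other: "v < N \<Longrightarrow> L v \<noteq> 0 \<Longrightarrow> length (A ! v) \<le> 2 * n - 3"
  using card_nbrs_upper[of "W v" n] degree_card by (simp add: L_def)

lemma degree_le: "v < N \<Longrightarrow> length (A ! v) \<le> 3 * n"
  using degree_hull degree_other by (cases "L v = 0") fastforce+

lemma degree_hull_iff: "v < N \<Longrightarrow> length (A ! v) = 3 * n - 7 \<longleftrightarrow> L v = 0"
  using degree_hull degree_other[of v] n by fastforce

definition off :: "nat \<Rightarrow> nat" where "off v = length (concat (take v A))"

lemma off_Suc: "v < N \<Longrightarrow> off (Suc v) = off v + length (A ! v)"
  unfolding off_def using length_A by (simp add: take_Suc_conv_app_nth)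

lemma off_le: "v \<le> N \<Longrightarrow> off v \<le> v * N"
proof (induction v)
  case (Suc v)
  have "length (A ! v) = card (set (A ! v))" using nbrs[of v] Suc distinct_card[of "A ! v"] by simp
  also have "\<dots> \<le> card {..<N}" using nbrs[of v] Suc by (intro card_mono) auto
  finally show ?case using Suc off_Suc[of v] by simp
qed (simp add: off_def)

lemma off_fits: "v \<le> N \<Longrightarrow> off v < 2 ^ w"
proof (rule fits)
  assume "v \<le> N"
  then have "off v \<le> v * N" "v * N \<le> N * N" using off_le by simp_all
  then show "off v \<le> 4 * (N * N)" by linarith
qed

definition ready :: "state \<Rightarrow> bool" where
  "ready s \<longleftrightarrow> vars s ''N'' = N \<and> (\<forall>v\<le>N. arrays s ''off'' v = off v) \<and>
     (\<forall>v<N. \<forall>i<length (A ! v). arrays s ''adj'' (off v + i) = A ! v ! i)"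

lemma concat_nth:
  "v < length xs \<Longrightarrow> i < length (xs ! v) \<Longrightarrow> concat xs ! (length (concat (take v xs)) + i) = xs ! v ! i"
proof (induction xs arbitrary: v)
  case (Cons x xs)
  then show ?case by (cases v) (auto simp: nth_append)
qed simp

lemma ready_input: "ready (input_state A)"
proof -
  have "off v + i < length (concat A)" if "v < N" "i < length (A ! v)" for v i
  proof -
    have "A = take v A @ A ! v # drop (Suc v) A" using that length_A by (simp add: id_take_nth_drop)
    then have "concat A = concat (take v A @ A ! v # drop (Suc v) A)" by (rule arg_cong)
    then have "length (concat A) = off v + length (A ! v) + length (concat (drop (Suc v) A))"
      unfolding off_def by simp
    then show ?thesis using that by simp
  qed
  then show ?thesis
    using concat_nth[of _ A] length_A unfolding ready_def input_state_def off_def by simp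
qed

lemma ready_agree: "ready s \<Longrightarrow> agree V B s s' \<Longrightarrow> ''N'' \<notin> V \<Longrightarrow> ''off'' \<notin> B \<Longrightarrow> ''adj'' \<notin> B \<Longrightarrow> ready s'"
  unfolding ready_def agree_def by simp

lemma ready_N: "ready s \<Longrightarrow> vars s ''N'' = N"
  by (simp add: ready_def)

lemma eval_degree:
  assumes "ready s" "vars s ''v'' = v" "v < N"
  shows "eval w degree_expr s = length (A ! v)"
proof -
  have "Suc v < 2 ^ w" "length (A ! v) < 2 ^ w"
    using assms(3) degree_le[of v] n_le_N by (auto intro!: fits_N)
  then show ?thesis
    using assms off_Suc[of v] word_bounds(2) by (simp add: degree_expr_def ready_def)
qed

lemma hull_vertex_ex: "k < n \<Longrightarrow> \<exists>v<N. W v = hull_path n k \<and> L v = 0"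
  using W_ex[OF Hp_ncpaths[of k n]] n by (auto simp: L_def)

lemma runs_max_degree:
  assumes "ready s" "vars s ''m'' = 0"
  shows "runs w max_degree s (60 * N + 20) (\<lambda>s'. vars s' ''m'' = 3 * n - 7)"
  unfolding max_degree_def
\<comment> \<open>Here and in the following loops the constants are generous roundings of the actual
  cost.\<close>
proof (rule runs_For[where l = 0 and h = N and B = "\<lambda>_. 40" and
      I = "\<lambda>i s. (\<forall>v<i. length (A ! v) \<le> vars s ''m'') \<and> (vars s ''m'' = 0 \<or> (\<exists>v<i. vars s ''m'' = length (A ! v)))"])
  show "N < 2 ^ w" by (rule fits_N) simp
next
  fix i s' assume i: "i < N" "vars s' ''v'' = i"
    and ag: "agree (insert ''v'' (mod_vars (If (Op Less (Var ''m'') degree_expr) (Assign ''m'' degree_expr) Skip)))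
      (mod_arrays (If (Op Less (Var ''m'') degree_expr) (Assign ''m'' degree_expr) Skip)) s s'"
    and I: "(\<forall>v<i. length (A ! v) \<le> vars s' ''m'') \<and> (vars s' ''m'' = 0 \<or> (\<exists>v<i. vars s' ''m'' = length (A ! v)))"
  have "ready s'" by (rule ready_agree[OF assms(1) ag]) auto
  note e = eval_degree[OF this i(2,1)]
  show "runs w (If (Op Less (Var ''m'') degree_expr) (Assign ''m'' degree_expr) Skip) s' 40
     (\<lambda>s'. (\<forall>v<Suc i. length (A ! v) \<le> vars (s'\<lparr>vars := (vars s')(''v'' := Suc i)\<rparr>) ''m'') \<and>
       (vars (s'\<lparr>vars := (vars s')(''v'' := Suc i)\<rparr>) ''m'' = 0 \<or>
        (\<exists>v<Suc i. vars (s'\<lparr>vars := (vars s')(''v'' := Suc i)\<rparr>) ''m'' = length (A ! v))))"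
    by (rule runs_loopfree) (use e I in \<open>auto simp: degree_expr_def less_Suc_eq\<close>)
next
  fix s' assume I: "(\<forall>v<N. length (A ! v) \<le> vars s' ''m'') \<and> (vars s' ''m'' = 0 \<or> (\<exists>v<N. vars s' ''m'' = length (A ! v)))"
  obtain u where u: "u < N" "L u = 0" using hull_vertex_ex[of 0] n by auto
  then have "3 * n - 7 \<le> vars s' ''m''" using degree_hull[OF u] I by force
  moreover have "length (A ! v) \<le> 3 * n - 7" if "v < N" for v
    using degree_hull[OF that] degree_other[OF that] n by (cases "L v = 0") auto
  then have "vars s' ''m'' \<le> 3 * n - 7" using I by auto
  ultimately show "vars s' ''m'' = 3 * n - 7" by (rule antisym[rotated])
qed (use assms ready_N in \<open>auto simp: agree_def\<close>)


text \<open>The program is not told \<open>n\<close>; it obtains it by counting the vertices of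
  maximal degree.\<close>

lemma card_hull_vertices: "card {v. v < N \<and> L v = 0} = n"
proof -
  have "W ` {v. v < N \<and> L v = 0} = hull_path n ` {..<n}"
  proof
    show "W ` {v. v < N \<and> L v = 0} \<subseteq> hull_path n ` {..<n}"
    proof (rule image_subsetI)
      fix v assume "v \<in> {v. v < N \<and> L v = 0}"
      then obtain k where "k < n" "W v = hull_path n k" using lay_0_ex[of "W v" n] n by (auto simp: L_def)
      then show "W v \<in> hull_path n ` {..<n}" by simp
    qed
    show "hull_path n ` {..<n} \<subseteq> W ` {v. v < N \<and> L v = 0}"
    proof (rule image_subsetI)
      fix k assume "k \<in> {..<n}"
      then obtain v where "v < N" "W v = hull_path n k" "L v = 0" using hull_vertex_ex by auto
      then show "hull_path n k \<in> W ` {v. v < N \<and> L v = 0}" by (intro image_eqI[of _ _ v]) auto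
    qed
  qed
  moreover have "inj_on W {v. v < N \<and> L v = 0}" by (auto simp: inj_on_def W_eq)
  then have "card (W ` {v. v < N \<and> L v = 0}) = card {v. v < N \<and> L v = 0}" by (rule card_image)
  moreover have "card (hull_path n ` {..<n}) = n" using n by (subst card_image) (auto simp: inj_on_def Hp_inj)
  ultimately show ?thesis by simp
qed

lemma runs_mark_hull:
  assumes "ready s" "vars s ''m'' = 3 * n - 7" "vars s ''n'' = 0" "\<And>v. arrays s ''dist'' v = 0"
  shows "runs w mark_hull s (60 * N + 20)
    (\<lambda>s'. vars s' ''n'' = n \<and> (\<forall>v<N. arrays s' ''dist'' v = of_bool (L v = 0)))"
proof -
  define cnt where "cnt i = card {v. v < i \<and> L v = 0}" for i
  have cnt_Suc: "cnt (Suc i) = (if L i = 0 then Suc (cnt i) else cnt i)" for i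
  proof -
    have "{v. v < Suc i \<and> L v = 0} = (if L i = 0 then insert i {v. v < i \<and> L v = 0} else {v. v < i \<and> L v = 0})"
      by (auto simp: less_Suc_eq)
    then show ?thesis by (simp add: cnt_def)
  qed
  have cnt_le: "cnt i \<le> i" for i
    using card_mono[of "{..<i}" "{v. v < i \<and> L v = 0}"] by (auto simp: cnt_def)
  show ?thesis
    unfolding mark_hull_def
  proof (rule runs_For[where l = 0 and h = N and B = "\<lambda>_. 40" and
        I = "\<lambda>i s. vars s ''n'' = cnt i \<and> (\<forall>v. arrays s ''dist'' v = of_bool (v < i \<and> L v = 0))"],
      goal_cases)
    case (7 i s')
    have "ready s'" by (rule ready_agree[OF assms(1) 7(4)]) auto
    note e = eval_degree[OF this 7(3,2)]
    have m: "vars s' ''m'' = 3 * n - 7" using 7(4) assms(2) by (simp add: agree_def)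
    have iff: "length (A ! i) = 3 * n - 7 \<longleftrightarrow> L i = 0" by (rule degree_hull_iff[OF 7(2)])
    have "Suc (cnt i) < 2 ^ w" using 7(2) cnt_le[of i] by (intro fits_N) simp
    then show ?case
      by (intro runs_loopfree) (use e m iff 7 word_bounds in \<open>auto simp: degree_expr_def less_Suc_eq cnt_Suc\<close>)
  next
    case (8 s')
    then show ?case using card_hull_vertices by (simp add: cnt_def)
  qed (use assms ready_N fits_N[of N] in \<open>auto simp: agree_def cnt_def\<close>)
qed

end

section \<open>Search for layers and parents\<close>

definition scan_body :: com where
  "scan_body = Seq (Assign ''u'' (Elem ''adj'' (Var ''k'')))
     (If (Op Equal (Elem ''dist'' (Var ''u'')) (Const 0))
       (Store ''dist'' (Var ''u'') (Op Add (Var ''d'') (Const 1)))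
       (If (Op Equal (Op Add (Elem ''dist'' (Var ''u'')) (Const 1)) (Var ''d''))
         (Seq (Assign ''X'' (Var ''Y'')) (Assign ''Y'' (Var ''u''))) Skip))"

text \<open>A neighbour with \<open>dist\<close> 0 has not been reached before, so it lies in the
  next layer. At the end \<open>X\<close> and \<open>Y\<close> hold the last two neighbours found in
  the previous layer; above layer 0 there are exactly two.\<close>

definition scan :: com where
  "scan = For ''k'' (Elem ''off'' (Var ''v'')) (Elem ''off'' (Op Add (Var ''v'') (Const 1))) scan_body"

definition layer_body :: com where
  "layer_body = Seq (Seq (Assign ''X'' (Const 0)) (Assign ''Y'' (Const 0))) (Seq scan (Seq (Store ''PX'' (Var ''v'') (Var ''X'')) (Store ''PY'' (Var ''v'') (Var ''Y''))))"

text \<open>Every round looks at all \<open>N\<close> vertices. With at most \<open>n\<close> rounds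
  this stays within the time allowed, so no queue is kept.\<close>

definition visit_layer :: "com \<Rightarrow> com" where
  "visit_layer body = For ''v'' (Const 0) (Var ''N'')
     (If (Op Equal (Elem ''dist'' (Var ''v'')) (Var ''d'')) body Skip)"

text \<open>\<open>d\<close> is a layer plus one, as in \<open>dist\<close>. Layers are below
  \<open>n\<close>, so the last round is \<open>d = n\<close>.\<close>

definition visit_layers :: "nat \<Rightarrow> com \<Rightarrow> com" where
  "visit_layers d0 body = For ''d'' (Const d0) (Op Add (Var ''n'') (Const 1)) (visit_layer body)"

lemma mod_scan_body [simp]: "mod_vars scan_body = {''u'', ''X'', ''Y''}" "mod_arrays scan_body = {''dist''}"
  by (auto simp: scan_body_def)

lemma mod_layer_body [simp]: "mod_vars layer_body = {''k'', ''u'', ''X'', ''Y''}"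
    "mod_arrays layer_body = {''dist'', ''PX'', ''PY''}"
  by (auto simp: layer_body_def scan_def)

lemma mod_visit_layer [simp]: "mod_vars (visit_layer body) = insert ''v'' (mod_vars body)"
    "mod_arrays (visit_layer body) = mod_arrays body"
  by (auto simp: visit_layer_def)

context numbered_paths
begin

definition is_parents :: "nat \<Rightarrow> nat \<Rightarrow> nat \<Rightarrow> bool" where
  "is_parents v X Y \<longleftrightarrow> X < N \<and> Y < N \<and> X \<noteq> Y \<and> exchange (W v) (W X) \<and> exchange (W v) (W Y) \<and>
     L X + 1 = L v \<and> L Y + 1 = L v"

lemma parents_list:
  assumes v: "v < N" "L v \<noteq> 0"
  shows "\<exists>X Y. filter (\<lambda>u. L u + 1 = L v) (A ! v) = [X, Y] \<and> is_parents v X Y"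
proof -
  let ?F = "filter (\<lambda>u. L u + 1 = L v) (A ! v)"
  have nb: "distinct (A ! v)" "set (A ! v) = {u. u < N \<and> exchange (W v) (W u)}" using nbrs[OF v(1)] by auto
  have "\<exists>X Y. X \<noteq> Y \<and> {u \<in> ncpaths n. exchange (W v) u \<and> layer n u + 1 = layer n (W v)} = {X, Y} \<and>
      gaps n (W v) = gaps n X \<union> gaps n Y"
    by (rule parents) (use v n in \<open>auto simp: L_def\<close>)
  then obtain X Y where XY: "X \<noteq> Y" "{u \<in> ncpaths n. exchange (W v) u \<and> layer n u + 1 = layer n (W v)} = {X, Y}"
    by blast
  have "W ` set ?F = {u \<in> ncpaths n. exchange (W v) u \<and> layer n u + 1 = layer n (W v)}"
    using W_ex by (auto simp: nb L_def image_iff)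
  then have "card (W ` set ?F) = 2" using XY by simp
  moreover have "inj_on W (set ?F)" by (auto simp: inj_on_def W_eq nb)
  ultimately have "card (set ?F) = 2" by (simp only: card_image)
  then have "length ?F = 2" using nb(1) by (simp only: distinct_card distinct_filter)
  then obtain x y where xy: "?F = [x, y]" by (auto simp: numeral_2_eq_2 length_Suc_conv)
  have "distinct ?F" using nb(1) by simp
  then have "x \<noteq> y" unfolding xy by simp
  moreover have "x \<in> set ?F" "y \<in> set ?F" unfolding xy by simp_all
  then have "x \<in> set (A ! v) \<and> L x + 1 = L v" "y \<in> set (A ! v) \<and> L y + 1 = L v" by simp_all
  ultimately have "is_parents v x y" unfolding is_parents_def nb(2) by simp
  then show ?thesis using xy by blast
qed

text \<open>The state of the search in the round that treats layer \<open>d - 1\<close>: the layers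
  below \<open>d\<close> are completely marked, and those vertices of layer \<open>d\<close> that
  have been reached, described by \<open>Z\<close>.\<close>

definition dist_ok :: "nat \<Rightarrow> (nat \<Rightarrow> bool) \<Rightarrow> state \<Rightarrow> bool" where
  "dist_ok d Z s \<longleftrightarrow> (\<forall>u<N. arrays s ''dist'' u =
     (if L u < d then Suc (L u) else if L u = d \<and> Z u then Suc d else 0))"

lemma dist_ok_cong:
  assumes "dist_ok d Z s" "arrays s' ''dist'' = arrays s ''dist''"
    and "\<And>u. u < N \<Longrightarrow> L u = d \<Longrightarrow> Z u \<longleftrightarrow> Z' u"
  shows "dist_ok d Z' s'"
  using assms unfolding dist_ok_def by auto

lemma dist_ok_set:
  assumes "dist_ok d Z s" "L u = d" "arrays s' ''dist'' = (arrays s ''dist'')(u := Suc d)"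
    and "\<And>x. x < N \<Longrightarrow> L x = d \<Longrightarrow> Z' x \<longleftrightarrow> Z x \<or> x = u"
  shows "dist_ok d Z' s'"
  using assms unfolding dist_ok_def by auto

text \<open>The two zeros in front are the initial values of \<open>X\<close> and
  \<open>Y\<close>.\<close>

definition last_two :: "nat list \<Rightarrow> state \<Rightarrow> bool" where
  "last_two F s \<longleftrightarrow> vars s ''Y'' = last (0 # 0 # F) \<and> vars s ''X'' = last (butlast (0 # 0 # F))"

lemma runs_scan:
  assumes s: "ready s" "vars s ''v'' = v" "v < N" "vars s ''d'' = L v + 1" "dist_ok (L v + 1) Z s"
    and XY: "last_two [] s"
  shows "runs w scan s (300 * n + 20)
    (\<lambda>s'. dist_ok (L v + 1) (\<lambda>u. Z u \<or> u \<in> set (A ! v)) s' \<and>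
      last_two (filter (\<lambda>u. L u + 1 = L v) (A ! v)) s')"
  unfolding scan_def
proof (rule runs_For[where l = "off v" and h = "off (Suc v)" and B = "\<lambda>_. 50" and
      I = "\<lambda>k s. dist_ok (L v + 1) (\<lambda>u. Z u \<or> u \<in> set (take (k - off v) (A ! v))) s \<and>
        last_two (filter (\<lambda>u. L u + 1 = L v) (take (k - off v) (A ! v))) s"], goal_cases)
  case 1
  then show ?case using s by (simp add: ready_def)
next
  case 2
  then show ?case using off_Suc s by simp
next
  case 3
  then show ?case using off_fits s by simp
next
  case (5 s')
  have "ready s'" by (rule ready_agree[OF s(1) 5]) auto
  then show ?case using 5 s fits_N[of "Suc v"] word_bounds by (simp add: agree_def ready_def)
next
  case 6
  then show ?case using s XY by (simp add: dist_ok_def last_two_def)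
next
  case (7 k s')
  have r: "ready s'" by (rule ready_agree[OF s(1) 7(4)]) auto
  define i where "i = k - off v"
  have i: "k = off v + i" "i < length (A ! v)" using 7(1,2) off_Suc[OF s(3)] by (auto simp: i_def)
  define u where "u = A ! v ! i"
  have adj: "arrays s' ''adj'' k = u" using r i s(3) by (simp add: ready_def u_def)
  have "u \<in> set (A ! v)" using i by (simp add: u_def)
  then have u: "u < N" "L u \<le> L v + 1" using nbr_L[OF s(3)] by auto
  have d: "vars s' ''d'' = L v + 1" using 7(4) s by (simp add: agree_def)
  have take: "take (Suc k - off v) (A ! v) = take i (A ! v) @ [u]"
    using i by (simp add: u_def take_Suc_conv_app_nth Suc_diff_le)
  have Lf: "L v + 2 < 2 ^ w" "L u + 2 < 2 ^ w"
    using L_less[OF s(3)] L_less[OF u(1)] n_le_N N_ge by (auto intro!: fits_N)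
  have I: "dist_ok (Suc (L v)) (\<lambda>u. Z u \<or> u \<in> set (take i (A ! v))) s'"
    "last_two (filter (\<lambda>u. L u + 1 = L v) (take i (A ! v))) s'"
    using 7(5) by (simp_all add: i_def)
  have du: "arrays s' ''dist'' u =
      (if L u < L v + 1 then L u + 1 else if L u = L v + 1 \<and> (Z u \<or> u \<in> set (take i (A ! v))) then L v + 2 else 0)"
    using I(1) u by (simp add: dist_ok_def)
  have ex: "exec w scan_body s' =
      (if arrays s' ''dist'' u = 0
       then s'\<lparr>vars := (vars s')(''u'' := u),
           arrays := (arrays s')(''dist'' := (arrays s' ''dist'')(u := L v + 2))\<rparr>
       else if L u + 1 = L v
       then s'\<lparr>vars := (vars s')(''u'' := u, ''X'' := vars s' ''Y'', ''Y'' := u)\<rparr>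
       else s'\<lparr>vars := (vars s')(''u'' := u)\<rparr>)"
    using du d adj 7(3) Lf word_bounds(2) by (simp add: scan_body_def)
  show ?case
  proof (rule runs_loopfree)
    show "loopfree scan_body" "time_bound scan_body \<le> 50" by (simp_all add: scan_body_def)
    consider "arrays s' ''dist'' u = 0" "L u = L v + 1"
      | "arrays s' ''dist'' u \<noteq> 0" "L u + 1 = L v"
      | "arrays s' ''dist'' u \<noteq> 0" "L u + 1 \<noteq> L v" "L u = L v + 1 \<longrightarrow> Z u \<or> u \<in> set (take i (A ! v))"
      using du u(2) by (auto split: if_splits)
    then show "dist_ok (L v + 1) (\<lambda>u. Z u \<or> u \<in> set (take (Suc k - off v) (A ! v)))
        (exec w scan_body s'\<lparr>vars := (vars (exec w scan_body s'))(''k'' := Suc k)\<rparr>) \<and>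
      last_two (filter (\<lambda>u. L u + 1 = L v) (take (Suc k - off v) (A ! v)))
        (exec w scan_body s'\<lparr>vars := (vars (exec w scan_body s'))(''k'' := Suc k)\<rparr>)"
    proof cases
      case 1
      then show ?thesis
        unfolding take ex using I(2) by (auto intro!: dist_ok_set[OF I(1)] simp: last_two_def)
    next
      case 2
      then show ?thesis
        unfolding take ex using I(2)
        by (auto intro!: dist_ok_cong[OF I(1)] simp: last_two_def butlast_append)
    next
      case 3
      then show ?thesis
        unfolding take ex using I(2) by (auto intro!: dist_ok_cong[OF I(1)] simp: last_two_def)
    qed
  qed
next
  case (8 s')
  then show ?case using off_Suc[OF s(3)] by simp
next
  case 9
  \<comment> \<open>There are at most \<open>3 * n\<close> neighbours, and each costs at most 61
    units.\<close>
  then show ?case using off_Suc[OF s(3)] degree_le[OF s(3)] by simp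
qed simp

text \<open>Each vertex is treated in one round at most, so the cost of the bodies is paid once per
  vertex and not once per round.\<close>

lemma layered_sum:
  "(\<Sum>d=a..<b. \<Sum>v=0..<N. if L v + 1 = d then C else 0) \<le> N * (C :: nat)"
proof -
  have "(\<Sum>d=a..<b. \<Sum>v=0..<N. if L v + 1 = d then C else 0) =
      (\<Sum>v=0..<N. \<Sum>d=a..<b. if L v + 1 = d then C else 0)"
    by (rule sum.swap)
  also have "\<dots> \<le> (\<Sum>v=0..<N. C)"
    by (intro sum_mono) (simp add: sum.delta')
  finally show ?thesis by simp
qed

text \<open>\<open>J d v\<close> holds in round \<open>d\<close> before vertex \<open>v\<close> is
  looked at. It may depend on the arrays only, so that changes of the loop counters do not disturb
  it.\<close>

lemma runs_visit_layers:
  fixes J :: "nat \<Rightarrow> nat \<Rightarrow> state \<Rightarrow> bool"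
  assumes s: "ready s" "vars s ''n'' = n" and d0: "d0 \<le> n" and J0: "J d0 0 s"
    and mod: "''v'' \<notin> mod_vars body" "''d'' \<notin> mod_vars body" "''n'' \<notin> mod_vars body" "''N'' \<notin> mod_vars body"
      "''off'' \<notin> mod_arrays body" "''adj'' \<notin> mod_arrays body"
    and insens: "\<And>d v s s'. J d v s \<Longrightarrow> arrays s' = arrays s \<Longrightarrow> J d v s'"
    and dist: "\<And>d v s. d0 \<le> d \<Longrightarrow> d \<le> n \<Longrightarrow> v < N \<Longrightarrow> J d v s \<Longrightarrow> arrays s ''dist'' v = d \<longleftrightarrow> L v + 1 = d"
    and skip: "\<And>d v s. d0 \<le> d \<Longrightarrow> v < N \<Longrightarrow> J d v s \<Longrightarrow> L v + 1 \<noteq> d \<Longrightarrow> J d (Suc v) s"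
    and body: "\<And>v s. d0 \<le> L v + 1 \<Longrightarrow> v < N \<Longrightarrow> J (L v + 1) v s \<Longrightarrow> ready s \<Longrightarrow> vars s ''v'' = v \<Longrightarrow>
      vars s ''d'' = L v + 1 \<Longrightarrow> vars s ''n'' = n \<Longrightarrow> runs w body s C (J (L v + 1) (Suc v))"
    and nxt: "\<And>d s. d0 \<le> d \<Longrightarrow> d \<le> n \<Longrightarrow> J d N s \<Longrightarrow> J (Suc d) 0 s"
  shows "runs w (visit_layers d0 body) s (N * C + n * (60 * N + 60) + 60) (J (Suc n) 0)"
proof -
  let ?if = "If (Op Equal (Elem ''dist'' (Var ''v'')) (Var ''d'')) body Skip"
  have fits: "Suc n < 2 ^ w" "N < 2 ^ w" using n_le_N N_ge by (auto intro!: fits_N)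
  have round: "runs w (visit_layer body) s ((\<Sum>v=0..<N. if L v + 1 = d then C else 0) + 40 * N + 20) (J d N)"
    if d: "d0 \<le> d" "d \<le> n" "ready s" "vars s ''n'' = n" "vars s ''d'' = d" "J d 0 s" for d s
    unfolding visit_layer_def
  proof (rule runs_For[where l = 0 and h = N and B = "\<lambda>v. (if L v + 1 = d then C else 0) + 8" and I = "J d"], goal_cases)
    case (5 s')
    then show ?case using mod d ready_N by (simp add: agree_def)
  next
    case 6
    then show ?case using d insens by simp
  next
    case (7 v s')
    have st: "ready s'" "vars s' ''n'' = n" "vars s' ''d'' = d"
      using ready_agree[OF d(3) 7(4)] 7(4) mod d by (auto simp: agree_def)
    have iff: "arrays s' ''dist'' v = d \<longleftrightarrow> L v + 1 = d" using dist d 7 by blast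
    show ?case
    proof (cases "L v + 1 = d")
      case True
      have "runs w body s' C (J (L v + 1) (Suc v))"
        by (rule body) (use True 7 st d in simp_all)
      then have "runs w body s' C (\<lambda>s'. J d (Suc v) (s'\<lparr>vars := (vars s')(''v'' := Suc v)\<rparr>))"
        by (rule runs_mono) (use True insens in auto)
      then have "runs w ?if s' (1 + cost (Op Equal (Elem ''dist'' (Var ''v'')) (Var ''d'')) + C)
          (\<lambda>s'. J d (Suc v) (s'\<lparr>vars := (vars s')(''v'' := Suc v)\<rparr>))"
        by (rule runs_If) (use True iff 7(3) st in simp_all)
      then show ?thesis by (rule runs_mono) (use True in simp_all)
    next
      case False
      have "J d (Suc v) (s'\<lparr>vars := (vars s')(''v'' := Suc v)\<rparr>)"
        using skip[OF d(1) 7(2,5) False] insens by simp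
      then have "runs w Skip s' 1 (\<lambda>s'. J d (Suc v) (s'\<lparr>vars := (vars s')(''v'' := Suc v)\<rparr>))"
        by (intro runs_loopfree) simp_all
      then have "runs w ?if s' (1 + cost (Op Equal (Elem ''dist'' (Var ''v'')) (Var ''d'')) + 1)
          (\<lambda>s'. J d (Suc v) (s'\<lparr>vars := (vars s')(''v'' := Suc v)\<rparr>))"
        by (rule runs_If[rotated]) (use False iff 7(3) st in simp_all)
      then show ?thesis by (rule runs_mono) simp_all
    qed
  next
    case 9
    have "(\<Sum>v=0..<N. (if L v + 1 = d then C else 0) + 8 + cost (Var ''N'') + 7) =
        (\<Sum>v=0..<N. if L v + 1 = d then C else 0) + 16 * N"
      by (simp add: sum.distrib)
    then show ?case by simp
  qed (use mod fits in simp_all)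
  show ?thesis
    unfolding visit_layers_def
  proof (rule runs_For[where l = d0 and h = "Suc n" and I = "\<lambda>d. J d 0" and
        B = "\<lambda>d. (\<Sum>v=0..<N. if L v + 1 = d then C else 0) + 40 * N + 20"], goal_cases)
    case 1
    then show ?case using d0 fits by simp
  next
    case (5 s')
    then show ?case using mod s fits word_bounds by (simp add: agree_def)
  next
    case 6
    then show ?case using J0 insens by simp
  next
    case (7 d s')
    have "runs w (visit_layer body) s' ((\<Sum>v=0..<N. if L v + 1 = d then C else 0) + 40 * N + 20) (J d N)"
      by (rule round) (use 7 s mod ready_agree[OF s(1) 7(4)] in \<open>auto simp: agree_def\<close>)
    then show ?case
      by (rule runs_mono) (use 7 nxt insens in auto)
  next
    case 9
    have "(\<Sum>d=d0..<Suc n. (\<Sum>v=0..<N. if L v + 1 = d then C else 0) + 40 * N + 20 +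
          cost (Op Add (Var ''n'') (Const 1)) + 7) =
        (\<Sum>d=d0..<Suc n. \<Sum>v=0..<N. if L v + 1 = d then C else 0) + (Suc n - d0) * (40 * N + 30)"
      by (simp add: sum.distrib algebra_simps)
    moreover have "(Suc n - d0) * (40 * N + 30) \<le> Suc n * (40 * N + 30)" by (intro mult_right_mono) auto
    moreover have "Suc n * (40 * N + 30) + 50 \<le> n * (60 * N + 60) + 60"
    proof -
      have "5 * (20 * N + 30) \<le> n * (20 * N + 30)" using n by (intro mult_right_mono) auto
      then show ?thesis by (simp add: algebra_simps)
    qed
    ultimately show ?case using layered_sum[where a = d0 and b = "Suc n" and C = C] by simp
  qed (use mod d0 fits in simp_all)
qed

lemma runs_layer_body:
  assumes s: "ready s" "vars s ''v'' = v" "v < N" "vars s ''d'' = L v + 1" "dist_ok (L v + 1) Z s"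
  shows "runs w layer_body s (300 * n + 40)
    (\<lambda>s'. dist_ok (L v + 1) (\<lambda>u. Z u \<or> u \<in> set (A ! v)) s' \<and>
      (L v \<noteq> 0 \<longrightarrow> is_parents v (arrays s' ''PX'' v) (arrays s' ''PY'' v)) \<and>
      (\<forall>u. u \<noteq> v \<longrightarrow> arrays s' ''PX'' u = arrays s ''PX'' u \<and> arrays s' ''PY'' u = arrays s ''PY'' u))"
proof -
  let ?s = "s\<lparr>vars := (vars s)(''X'' := 0, ''Y'' := 0)\<rparr>"
  have i: "runs w (Seq (Assign ''X'' (Const 0)) (Assign ''Y'' (Const 0))) s 4 (\<lambda>s'. s' = ?s)"
    by (rule runs_loopfree) simp_all
  have "runs w scan ?s (300 * n + 20)
    (\<lambda>s'. dist_ok (L v + 1) (\<lambda>u. Z u \<or> u \<in> set (A ! v)) s' \<and>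
      last_two (filter (\<lambda>u. L u + 1 = L v) (A ! v)) s')"
    by (rule runs_scan) (use s in \<open>auto simp: ready_def dist_ok_def last_two_def\<close>)
  from runs_agree[OF this]
  have "runs w (Seq scan (Seq (Store ''PX'' (Var ''v'') (Var ''X'')) (Store ''PY'' (Var ''v'') (Var ''Y'')))) ?s
    (300 * n + 20 + 6) (\<lambda>s'. dist_ok (L v + 1) (\<lambda>u. Z u \<or> u \<in> set (A ! v)) s' \<and>
      (L v \<noteq> 0 \<longrightarrow> is_parents v (arrays s' ''PX'' v) (arrays s' ''PY'' v)) \<and>
      (\<forall>u. u \<noteq> v \<longrightarrow> arrays s' ''PX'' u = arrays s ''PX'' u \<and> arrays s' ''PY'' u = arrays s ''PY'' u))"
  proof (rule runs_Seq)
    fix s' assume s': "(dist_ok (L v + 1) (\<lambda>u. Z u \<or> u \<in> set (A ! v)) s' \<and>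
      last_two (filter (\<lambda>u. L u + 1 = L v) (A ! v)) s') \<and> agree (mod_vars scan) (mod_arrays scan) ?s s'"
    then have v': "vars s' ''v'' = v" "arrays s' ''PX'' = arrays s ''PX''" "arrays s' ''PY'' = arrays s ''PY''"
      using s by (auto simp: agree_def scan_def)
    have p: "is_parents v (vars s' ''X'') (vars s' ''Y'')" if "L v \<noteq> 0"
      using parents_list[OF s(3) that] s' by (auto simp: last_two_def)
    have d: "dist_ok (L v + 1) (\<lambda>u. Z u \<or> u \<in> set (A ! v)) s'" using s' by simp
    show "runs w (Seq (Store ''PX'' (Var ''v'') (Var ''X'')) (Store ''PY'' (Var ''v'') (Var ''Y''))) s' 6
      (\<lambda>s'. dist_ok (L v + 1) (\<lambda>u. Z u \<or> u \<in> set (A ! v)) s' \<and>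
      (L v \<noteq> 0 \<longrightarrow> is_parents v (arrays s' ''PX'' v) (arrays s' ''PY'' v)) \<and>
      (\<forall>u. u \<noteq> v \<longrightarrow> arrays s' ''PX'' u = arrays s ''PX'' u \<and> arrays s' ''PY'' u = arrays s ''PY'' u))"
      by (rule runs_loopfree) (use v' p dist_ok_cong[OF d] in simp_all)
  qed
  then show ?thesis
    unfolding layer_body_def
    by (intro runs_mono[OF runs_Seq[OF i]]) auto
qed

end

section \<open>Cyclic order of the hull edges\<close>

definition pair_body :: com where
  "pair_body = If (Op Equal (Elem ''dist'' (Var ''v'')) (Const 2))
     (Seq (Store ''T'' (Op Add (Op Mul (Elem ''PX'' (Var ''v'')) (Var ''N'')) (Elem ''PY'' (Var ''v''))) (Const 1))
          (Store ''T'' (Op Add (Op Mul (Elem ''PY'' (Var ''v'')) (Var ''N'')) (Elem ''PX'' (Var ''v''))) (Const 1)))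
     Skip"

text \<open>In layer 1, where \<open>dist\<close> is 2, the parents are hull paths, and their pair
  is entered in both orders. The table has about \<open>N * N\<close> cells, but memory starts out
  as zero, so only the entries made cost time.\<close>

definition mark_pairs :: com where
  "mark_pairs = For ''v'' (Const 0) (Var ''N'') pair_body"

text \<open>A hull vertex without label that is not marked together with \<open>cur\<close>
  continues the walk. The last one found is taken: at the start both directions are equally
  good.\<close>

definition find_body :: com where
  "find_body = If (Op Equal (Elem ''dist'' (Var ''x'')) (Const 1))
     (If (Op Equal (Elem ''lab'' (Var ''x'')) (Const 0))
       (If (Op Equal (Elem ''T'' (Op Add (Op Mul (Var ''cur'') (Var ''N'')) (Var ''x''))) (Const 0))
         (Assign ''nx'' (Var ''x'')) Skip) Skip) Skip"

definition label_body :: com where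
  "label_body = Seq (For ''x'' (Const 0) (Var ''N'') find_body)
     (Seq (Assign ''cur'' (Var ''nx''))
     (Seq (Store ''lab'' (Var ''cur'') (Const 1))
          (Store ''gp'' (Op Add (Op Mul (Var ''cur'') (Var ''n'')) (Var ''j'')) (Const 1))))"

text \<open>Row \<open>N\<close> of \<open>T\<close> is empty, so the start value \<open>N\<close> of \<open>cur\<close> lets the walk begin anywhere.\<close>

definition label_hull :: com where
  "label_hull = Seq (Assign ''cur'' (Var ''N'')) (For ''j'' (Const 0) (Var ''n'') label_body)"

lemma mod_pair_body [simp]: "mod_vars pair_body = {}" "mod_arrays pair_body = {''T''}"
  by (auto simp: pair_body_def)

lemma mod_find_body [simp]: "mod_vars find_body = {''nx''}" "mod_arrays find_body = {}"
  by (auto simp: find_body_def)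

lemma mod_label_body [simp]: "mod_vars label_body = {''x'', ''nx'', ''cur''}"
    "mod_arrays label_body = {''lab'', ''gp''}"
  by (auto simp: label_body_def)

lemma index_inj: "b < m \<Longrightarrow> b' < m \<Longrightarrow> a * m + b = a' * m + b' \<longleftrightarrow> a = a' \<and> b = (b' :: nat)"
  by (metis div_mult_self3 div_less mod_less mod_mult_self3 add.commute add.right_neutral
      less_nat_zero_code)

context numbered_paths
begin

lemma fits_sum: "a \<le> N * N \<Longrightarrow> b \<le> N \<Longrightarrow> a + b < 2 ^ w"
proof (rule fits)
  assume "a \<le> N * N" "b \<le> N"
  moreover have "N \<le> N * N" by simp
  ultimately show "a + b \<le> 4 * (N * N)" by linarith
qed

text \<open>The array \<open>dist\<close> stores layers plus one, since \<open>0\<close> marks the vertices not yet reached.\<close>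

definition layered :: "state \<Rightarrow> bool" where
  "layered s \<longleftrightarrow> (\<forall>v<N. arrays s ''dist'' v = L v + 1) \<and>
     (\<forall>v<N. L v \<noteq> 0 \<longrightarrow> is_parents v (arrays s ''PX'' v) (arrays s ''PY'' v))"

lemma dist_ok_eq: "dist_ok d Z s \<Longrightarrow> v < N \<Longrightarrow> 1 \<le> d \<Longrightarrow> arrays s ''dist'' v = d \<longleftrightarrow> L v + 1 = d"
  unfolding dist_ok_def by (auto split: if_splits)

text \<open>This is why the search, which only follows edges from marked vertices, reaches every
  layer.\<close>

lemma parent_ex:
  assumes "v < N" "L v \<noteq> 0"
  shows "\<exists>u<N. L u + 1 = L v \<and> v \<in> set (A ! u)"
proof -
  obtain X Y where "is_parents v X Y" using parents_list[OF assms] by blast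
  then show ?thesis using nbrs[of X] assms exch_sym by (auto simp: is_parents_def intro!: exI[of _ X])
qed

lemma runs_layers:
  assumes s: "ready s" "vars s ''n'' = n" "\<forall>v<N. arrays s ''dist'' v = of_bool (L v = 0)"
  shows "runs w (visit_layers 1 layer_body) s (N * (300 * n + 40) + n * (60 * N + 60) + 60) layered"
proof -
  \<comment> \<open>Reached so far in this round are the neighbours of the vertices of layer
    \<open>d - 1\<close> with numbers below \<open>v\<close>.\<close>
  let ?Z = "\<lambda>d v u. \<exists>v'<v. L v' + 1 = d \<and> u \<in> set (A ! v')"
  let ?J = "\<lambda>d v s. dist_ok d (?Z d v) s \<and>
    (\<forall>u<N. L u \<noteq> 0 \<and> (L u + 1 < d \<or> L u + 1 = d \<and> u < v) \<longrightarrow>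
      is_parents u (arrays s ''PX'' u) (arrays s ''PY'' u))"
  have "runs w (visit_layers 1 layer_body) s (N * (300 * n + 40) + n * (60 * N + 60) + 60) (?J (Suc n) 0)"
  proof (rule runs_visit_layers[where J = ?J, OF s(1,2)], goal_cases)
    case 2
    then show ?case using s by (auto simp: dist_ok_def)
  next
    case (9 d v s s')
    then show ?case by (simp add: dist_ok_def)
  next
    case (10 d v s')
    then have "dist_ok d (?Z d v) s'" by blast
    then show ?case using dist_ok_eq 10(1,3) by blast
  next
    case (11 d v s')
    have "?Z d v u = ?Z d (Suc v) u" for u using 11(4) less_Suc_eq by auto
    then show ?case using 11 by (auto simp: less_Suc_eq)
  next
    case (12 v s')
    have "dist_ok (L v + 1) (?Z (L v + 1) v) s'" using 12(3) by blast
    from runs_layer_body[OF 12(4,5,2,6) this] show ?case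
    proof (rule runs_mono)
      fix s'' assume s'': "dist_ok (L v + 1) (\<lambda>u. ?Z (L v + 1) v u \<or> u \<in> set (A ! v)) s'' \<and>
        (L v \<noteq> 0 \<longrightarrow> is_parents v (arrays s'' ''PX'' v) (arrays s'' ''PY'' v)) \<and>
        (\<forall>u. u \<noteq> v \<longrightarrow> arrays s'' ''PX'' u = arrays s' ''PX'' u \<and> arrays s'' ''PY'' u = arrays s' ''PY'' u)"
      have "?Z (L v + 1) v u \<or> u \<in> set (A ! v) \<longleftrightarrow> ?Z (L v + 1) (Suc v) u" for u
        by (auto simp: less_Suc_eq)
      then have "dist_ok (L v + 1) (?Z (L v + 1) (Suc v)) s''" using s'' by simp
      moreover have "is_parents u (arrays s'' ''PX'' u) (arrays s'' ''PY'' u)"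
        if "u < N" "L u \<noteq> 0" "L u + 1 < L v + 1 \<or> L u + 1 = L v + 1 \<and> u < Suc v" for u
        using that s'' 12(3) by (cases "u = v") auto
      ultimately show "?J (L v + 1) (Suc v) s''" by blast
    qed simp
  next
    case (13 d s')
    have "dist_ok (Suc d) (?Z (Suc d) 0) s'"
      unfolding dist_ok_def
    proof (intro allI impI)
      fix u assume u: "u < N"
      \<comment> \<open>Every vertex of layer \<open>d\<close> has a parent, so it has been reached
        when the round is over.\<close>
      have "?Z d N u" if "L u = d"
        using parent_ex[OF u] that 13(1) by (metis One_nat_def not_one_le_zero)
      then show "arrays s' ''dist'' u =
          (if L u < Suc d then Suc (L u) else if L u = Suc d \<and> ?Z (Suc d) 0 u then Suc (Suc d) else 0)"
        using 13(3) u by (auto simp: dist_ok_def less_Suc_eq)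
    qed
    then show ?case using 13(3) by auto
  qed (use n in simp_all)
  then show ?thesis
  proof (rule runs_mono)
    fix s' assume J: "?J (Suc n) 0 s'"
    show "layered s'"
      unfolding layered_def
    proof (intro conjI allI impI)
      fix v assume v: "v < N"
      have l: "L v + 1 < Suc n" using L_less[OF v] by simp
      then show "arrays s' ''dist'' v = L v + 1" using J v by (simp add: dist_ok_def)
      show "is_parents v (arrays s' ''PX'' v) (arrays s' ''PY'' v)" if "L v \<noteq> 0"
        using J v l that by blast
    qed
  qed simp
qed

lemma is_parents_nbrs:
  "is_parents v X Y \<Longrightarrow> v < N \<Longrightarrow> {u. u < N \<and> exchange (W v) (W u) \<and> L u + 1 = L v} = {X, Y}"
proof -
  assume p: "is_parents v X Y" and v: "v < N"
  then have "L v \<noteq> 0" by (auto simp: is_parents_def)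
  then obtain x y where xy: "filter (\<lambda>u. L u + 1 = L v) (A ! v) = [x, y]" "is_parents v x y"
    using parents_list v by blast
  have "{u. u < N \<and> exchange (W v) (W u) \<and> L u + 1 = L v} = set (filter (\<lambda>u. L u + 1 = L v) (A ! v))"
    using nbrs[OF v] by auto
  also have "\<dots> = {x, y}" unfolding xy(1) by simp
  finally have *: "{u. u < N \<and> exchange (W v) (W u) \<and> L u + 1 = L v} = {x, y}" .
  have "X \<in> {x, y}" "Y \<in> {x, y}" using p unfolding *[symmetric] by (auto simp: is_parents_def)
  moreover have "X \<noteq> Y" using p by (simp add: is_parents_def)
  ultimately show ?thesis using * by auto
qed

text \<open>The parents of a path with one diagonal are the hull paths of its two gaps, and these
  gaps are not adjacent. Conversely, two disjoint hull edges are the gaps of such a path.\<close>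

lemma common_parents_iff:
  assumes s: "layered s" and ab: "a < N" "b < N" "W a = hull_path n k" "W b = hull_path n l" "k < n" "l < n"
  shows "(\<exists>v<N. L v = 1 \<and> {arrays s ''PX'' v, arrays s ''PY'' v} = {a, b}) \<longleftrightarrow> nonadj n k l"
proof
  assume "\<exists>v<N. L v = 1 \<and> {arrays s ''PX'' v, arrays s ''PY'' v} = {a, b}"
  then obtain v where v: "v < N" "L v = 1" "{arrays s ''PX'' v, arrays s ''PY'' v} = {a, b}" by blast
  then have p: "is_parents v (arrays s ''PX'' v) (arrays s ''PY'' v)" using s by (simp add: layered_def)
  then have abv: "exchange (W v) (W a)" "exchange (W v) (W b)" "a \<noteq> b"
    using v(3) by (auto simp: is_parents_def doubleton_eq_iff)
  obtain t k' l' where D: "k' < n" "l' < n" "nonadj n k' l'" "W v = one_diagonal n t k' l'"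
    using lay_1_ex[of "W v" n] v n by (auto simp: L_def)
  have "k = k' \<or> k = l'" "l = k' \<or> l = l'"
    using exch_Dg_Hp_iff[OF D(1-3)] abv ab n unfolding D(4) ab(3,4) by auto
  moreover have "k \<noteq> l" using abv(3) ab W_eq by metis
  ultimately show "nonadj n k l" using D(3) nadj_sym by blast
next
  assume na: "nonadj n k l"
  have n3: "3 \<le> n" using n by simp
  obtain v where v: "v < N" "W v = one_diagonal n True k l" using W_ex[OF Dg_ncpaths[OF ab(5,6) na n3]] by blast
  have L: "L v = 1" "L a = 0" "L b = 0" unfolding L_def v(2) ab(3,4) using lay_Dg[OF ab(5,6) na] by simp_all
  then have p: "is_parents v (arrays s ''PX'' v) (arrays s ''PY'' v)" using s v by (simp add: layered_def)
  have "a \<in> {u. u < N \<and> exchange (W v) (W u) \<and> L u + 1 = L v}" "b \<in> {u. u < N \<and> exchange (W v) (W u) \<and> L u + 1 = L v}"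
    using exch_Dg_Hp_iff[OF ab(5,6) na _ n3] ab L by (simp_all add: v)
  then have "a \<in> {arrays s ''PX'' v, arrays s ''PY'' v}" "b \<in> {arrays s ''PX'' v, arrays s ''PY'' v}"
    unfolding is_parents_nbrs[OF p v(1)] .
  moreover have "k \<noteq> l" using na by (simp add: nonadj_def)
  then have "a \<noteq> b" using ab Hp_inj[OF ab(5,6) n3] by auto
  ultimately have "{arrays s ''PX'' v, arrays s ''PY'' v} = {a, b}" by auto
  then show "\<exists>v<N. L v = 1 \<and> {arrays s ''PX'' v, arrays s ''PY'' v} = {a, b}" using v L by blast
qed

text \<open>Row \<open>N\<close> is included because of the start value of
  \<open>cur\<close>.\<close>

definition pairs_marked :: "state \<Rightarrow> bool" where
  "pairs_marked s \<longleftrightarrow> (\<forall>a\<le>N. \<forall>b<N. arrays s ''T'' (a * N + b) \<noteq> 0 \<longleftrightarrow>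
     (\<exists>v<N. L v = 1 \<and> {arrays s ''PX'' v, arrays s ''PY'' v} = {a, b}))"

lemma runs_mark_pairs:
  assumes s: "ready s" "layered s" "\<forall>x. arrays s ''T'' x = 0"
  shows "runs w mark_pairs s (60 * N + 20) pairs_marked"
  unfolding mark_pairs_def
proof (rule runs_For[where l = 0 and h = N and B = "\<lambda>_. 40" and
      I = "\<lambda>i s'. \<forall>a\<le>N. \<forall>b<N. arrays s' ''T'' (a * N + b) \<noteq> 0 \<longleftrightarrow>
        (\<exists>v<i. L v = 1 \<and> {arrays s ''PX'' v, arrays s ''PY'' v} = {a, b})"], goal_cases)
  case (7 i s')
  let ?X = "arrays s ''PX'' i" and ?Y = "arrays s ''PY'' i"
  have st: "vars s' ''N'' = N" "arrays s' ''dist'' i = L i + 1" "arrays s' ''PX'' = arrays s ''PX''"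
      "arrays s' ''PY'' = arrays s ''PY''"
    using 7(2,4) s ready_N by (auto simp: agree_def layered_def)
  have Li: "L i + 1 < 2 ^ w" using L_less[OF 7(2)] n_le_N by (intro fits_N) simp
  show ?case
  proof (cases "L i = 1")
    case True
    then have XY: "?X < N" "?Y < N" using s(2) 7(2) by (auto simp: layered_def is_parents_def)
    then have "?X * N + ?Y < Suc ?X * N" "?Y * N + ?X < Suc ?Y * N" by simp_all
    moreover have "Suc ?X * N \<le> N * N" "Suc ?Y * N \<le> N * N"
      by (rule mult_right_mono; use XY in simp)+
    ultimately have bound: "?X * N + ?Y < 2 ^ w" "?Y * N + ?X < 2 ^ w" "?X * N < 2 ^ w" "?Y * N < 2 ^ w"
      using fits[of "N * N"] by linarith+
    have ex: "exec w pair_body s' = s'\<lparr>arrays := (arrays s')(''T'' := (arrays s' ''T'')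
        (?X * N + ?Y := 1, ?Y * N + ?X := 1))\<rparr>"
      using True st 7(3) bound word_bounds(2) by (simp add: pair_body_def)
    have idx: "a * N + b = ?X * N + ?Y \<longleftrightarrow> a = ?X \<and> b = ?Y" "a * N + b = ?Y * N + ?X \<longleftrightarrow> a = ?Y \<and> b = ?X"
      if "b < N" for a b using index_inj[OF that] XY by simp_all
    show ?thesis
    proof (rule runs_loopfree)
      show "\<forall>a\<le>N. \<forall>b<N. arrays (exec w pair_body s'\<lparr>vars := (vars (exec w pair_body s'))(''v'' := Suc i)\<rparr>)
          ''T'' (a * N + b) \<noteq> 0 \<longleftrightarrow>
          (\<exists>v<Suc i. L v = 1 \<and> {arrays s ''PX'' v, arrays s ''PY'' v} = {a, b})"
      proof (intro allI impI)
        fix a b assume ab: "a \<le> N" "b < N"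
        have "(\<exists>v<Suc i. L v = 1 \<and> {arrays s ''PX'' v, arrays s ''PY'' v} = {a, b}) \<longleftrightarrow>
            (\<exists>v<i. L v = 1 \<and> {arrays s ''PX'' v, arrays s ''PY'' v} = {a, b}) \<or> {?X, ?Y} = {a, b}"
          using True by (auto simp: less_Suc_eq)
        moreover have "{?X, ?Y} = {a, b} \<longleftrightarrow> a = ?X \<and> b = ?Y \<or> a = ?Y \<and> b = ?X"
          by (auto simp: doubleton_eq_iff)
        moreover have "arrays s' ''T'' (a * N + b) \<noteq> 0 \<longleftrightarrow>
            (\<exists>v<i. L v = 1 \<and> {arrays s ''PX'' v, arrays s ''PY'' v} = {a, b})"
          using 7(5) ab by blast
        ultimately show "arrays (exec w pair_body s'\<lparr>vars := (vars (exec w pair_body s'))(''v'' := Suc i)\<rparr>)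
          ''T'' (a * N + b) \<noteq> 0 \<longleftrightarrow>
          (\<exists>v<Suc i. L v = 1 \<and> {arrays s ''PX'' v, arrays s ''PY'' v} = {a, b})"
          unfolding ex using idx[OF ab(2), of a] by simp blast
      qed
    qed (simp_all add: pair_body_def)
  next
    case False
    have ex: "exec w pair_body s' = s'" using False st 7(3) Li by (simp add: pair_body_def)
    have "(\<exists>v<Suc i. L v = 1 \<and> {arrays s ''PX'' v, arrays s ''PY'' v} = {a, b}) \<longleftrightarrow>
        (\<exists>v<i. L v = 1 \<and> {arrays s ''PX'' v, arrays s ''PY'' v} = {a, b})" for a b
      using False less_Suc_eq by auto
    then show ?thesis using 7(5) ex by (intro runs_loopfree) (simp_all add: pair_body_def)
  qed
next
  case (8 s')
  then show ?case by (simp add: pairs_marked_def agree_def)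
qed (use s ready_N fits_N[of N] in \<open>auto simp: agree_def\<close>)


definition labelled :: "nat list \<Rightarrow> state \<Rightarrow> bool" where
  "labelled hs s \<longleftrightarrow> distinct hs \<and> (\<forall>v\<in>set hs. v < N \<and> L v = 0) \<and>
     (\<forall>v<N. arrays s ''lab'' v \<noteq> 0 \<longleftrightarrow> v \<in> set hs) \<and>
     vars s ''cur'' = last (N # hs) \<and>
     (\<forall>v<N. \<forall>g<n. arrays s ''gp'' (v * n + g) = of_bool (g < length hs \<and> hs ! g = v))"

text \<open>The true number of the missing hull edge. It is known to the analysis only; the program
  computes labels that agree with it up to a symmetry.\<close>

definition hull_index :: "nat \<Rightarrow> nat" where
  "hull_index v = (SOME k. k < n \<and> W v = hull_path n k)"

lemma hull_index: "v < N \<Longrightarrow> L v = 0 \<Longrightarrow> hull_index v < n \<and> W v = hull_path n (hull_index v)"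
  unfolding hull_index_def
  by (rule someI_ex) (use lay_0_ex[of "W v" n] n in \<open>auto simp: L_def\<close>)

lemma hull_index_inj: "u < N \<Longrightarrow> v < N \<Longrightarrow> L u = 0 \<Longrightarrow> L v = 0 \<Longrightarrow> hull_index u = hull_index v \<longleftrightarrow> u = v"
  using hull_index W_eq by metis

definition hull_step :: "nat \<Rightarrow> nat \<Rightarrow> bool" where
  "hull_step u v \<longleftrightarrow> hull_index v = next_pt n (hull_index u) \<or> hull_index u = next_pt n (hull_index v)"

definition candidate :: "nat list \<Rightarrow> nat \<Rightarrow> bool" where
  "candidate hs x \<longleftrightarrow> x < N \<and> L x = 0 \<and> x \<notin> set hs \<and> (hs \<noteq> [] \<longrightarrow> hull_step (last hs) x)"

lemma candidate_ex:
  assumes hs: "distinct hs" "\<forall>v\<in>set hs. v < N \<and> L v = 0" "successively hull_step hs" "length hs < n"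
  shows "\<exists>x<N. candidate hs x"
proof (cases "length hs")
  case 0
  then show ?thesis using hull_vertex_ex[of 0] n by (auto simp: candidate_def)
next
  case (Suc m)
  let ?\<kappa> = "\<lambda>j. hull_index (hs ! j)"
  have mem: "hs ! j < N" "L (hs ! j) = 0" if "j < length hs" for j using hs(2) that by auto
  have "\<exists>y<n. y \<notin> ?\<kappa> ` {..<Suc m} \<and> (y = next_pt n (?\<kappa> m) \<or> ?\<kappa> m = next_pt n y)"
  proof (rule walk_extend)
    show "inj_on ?\<kappa> {..<Suc m}"
      using hull_index_inj mem hs(1) Suc by (auto simp: inj_on_def nth_eq_iff_index_eq)
    show "?\<kappa> j < n" if "j < Suc m" for j using hull_index mem that Suc by auto
    show "?\<kappa> (Suc j) = next_pt n (?\<kappa> j) \<or> ?\<kappa> j = next_pt n (?\<kappa> (Suc j))" if "Suc j < Suc m" for j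
      using hs(3) that Suc by (simp add: successively_conv_nth hull_step_def)
    show "Suc m < n" using hs(4) Suc by simp
  qed
  then obtain y where y: "y < n" "y \<notin> ?\<kappa> ` {..<Suc m}" "y = next_pt n (?\<kappa> m) \<or> ?\<kappa> m = next_pt n y" by blast
  obtain x where x: "x < N" "W x = hull_path n y" "L x = 0" using hull_vertex_ex[OF y(1)] by blast
  have n3: "3 \<le> n" using n by simp
  have ix: "hull_index x = y" using hull_index[OF x(1,3)] x(2) Hp_inj[OF _ y(1) n3] by metis
  have "x \<notin> set hs"
  proof
    assume "x \<in> set hs"
    then obtain j where "j < Suc m" "hs ! j = x" using Suc by (auto simp: in_set_conv_nth)
    then show False using y(2) ix by blast
  qed
  moreover have "last hs = hs ! m" using Suc by (cases hs rule: rev_cases) auto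
  ultimately show ?thesis using x ix y(3) by (auto simp: candidate_def hull_step_def)
qed

text \<open>Two hull vertices that are not marked as a pair miss adjacent or equal hull edges, and
  equality is excluded since \<open>cur\<close> itself is labelled. Before the first step
  \<open>cur\<close> is \<open>N\<close>, which is no parent of any vertex, so nothing is
  excluded.\<close>

lemma candidate_iff:
  assumes s: "layered s" "pairs_marked s" "labelled hs s" and x: "x < N"
  shows "candidate hs x \<longleftrightarrow> L x = 0 \<and> arrays s ''lab'' x = 0 \<and> arrays s ''T'' (vars s ''cur'' * N + x) = 0"
proof -
  have lab: "arrays s ''lab'' x = 0 \<longleftrightarrow> x \<notin> set hs" using s(3) x unfolding labelled_def by blast
  show ?thesis
  proof (cases "hs = []")
    case True
    then have "vars s ''cur'' = N" using s(3) by (simp add: labelled_def)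
    moreover have "arrays s ''T'' (N * N + x) = 0"
    proof (rule ccontr)
      assume "arrays s ''T'' (N * N + x) \<noteq> 0"
      then obtain v where "v < N" "L v = 1" "{arrays s ''PX'' v, arrays s ''PY'' v} = {N, x}"
        using s(2) x unfolding pairs_marked_def by (metis order_refl)
      moreover from this have "is_parents v (arrays s ''PX'' v) (arrays s ''PY'' v)"
        using s(1) by (simp add: layered_def)
      ultimately show False by (auto simp: is_parents_def doubleton_eq_iff)
    qed
    ultimately show ?thesis using True x lab by (simp add: candidate_def)
  next
    case False
    define c where "c = last hs"
    have c: "vars s ''cur'' = c" "c < N" "L c = 0" "c \<in> set hs"
      using False s(3) by (auto simp: labelled_def c_def)
    have "arrays s ''T'' (c * N + x) = 0 \<longleftrightarrow> hull_step c x" if "L x = 0" "x \<notin> set hs"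
    proof -
      have h: "hull_index c < n" "W c = hull_path n (hull_index c)" "hull_index x < n" "W x = hull_path n (hull_index x)"
        using hull_index c x that by auto
      have "hull_index c \<noteq> hull_index x" using hull_index_inj[of c x] c x that by auto
      moreover have "arrays s ''T'' (c * N + x) \<noteq> 0 \<longleftrightarrow> nonadj n (hull_index c) (hull_index x)"
        using s(2) c(2) x common_parents_iff[OF s(1) c(2) x h(2,4,1,3)]
        unfolding pairs_marked_def by (meson less_imp_le)
      ultimately show ?thesis by (auto simp: nonadj_def hull_step_def)
    qed
    then show ?thesis using lab x c(1) False by (auto simp: candidate_def c_def)
  qed
qed

lemma runs_find:
  assumes s: "ready s" "layered s" "pairs_marked s" "labelled hs s" and ex: "\<exists>x<N. candidate hs x"
  shows "runs w (For ''x'' (Const 0) (Var ''N'') find_body) s (60 * N + 20) (\<lambda>s'. candidate hs (vars s' ''nx''))"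
proof (rule runs_For[where l = 0 and h = N and B = "\<lambda>_. 40" and
      I = "\<lambda>i s'. (\<exists>x<i. candidate hs x) \<longrightarrow> candidate hs (vars s' ''nx'')"], goal_cases)
  case (7 i s')
  have "layered s'" "pairs_marked s'" "labelled hs s'" "vars s' ''N'' = N" "vars s' ''cur'' = vars s ''cur''"
    using 7(4) s ready_N by (auto simp: agree_def layered_def pairs_marked_def labelled_def)
  note st = this candidate_iff[OF this(1-3) 7(2)]
  have c: "vars s ''cur'' \<le> N"
    using s(4) by (cases hs rule: rev_cases) (auto simp: labelled_def)
  have "vars s ''cur'' * N \<le> N * N" using c by (intro mult_right_mono) auto
  then have "vars s ''cur'' * N + i < 2 ^ w" "vars s ''cur'' * N < 2 ^ w"
    using 7(2) fits_sum[of "vars s ''cur'' * N" i] by simp_all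
  moreover have "arrays s' ''dist'' i = L i + 1" using st(1) 7(2) by (simp add: layered_def)
  ultimately have ex: "exec w find_body s' =
      (if candidate hs i then s'\<lparr>vars := (vars s')(''nx'' := i)\<rparr> else s')"
    using st 7(3) word_bounds(2) by (simp add: find_body_def)
  show ?case
  proof (rule runs_loopfree)
    show "loopfree find_body" "time_bound find_body \<le> 40" by (simp_all add: find_body_def)
  qed (use 7(5) in \<open>auto simp: ex less_Suc_eq\<close>)
qed (use s ex ready_N fits_N[of N] in \<open>auto simp: agree_def\<close>)

lemma runs_label_body:
  assumes s: "ready s" "vars s ''n'' = n" "layered s" "pairs_marked s" "labelled hs s" "successively hull_step hs"
    and j: "vars s ''j'' = length hs" "length hs < n"
  shows "runs w label_body s (60 * N + 60)
    (\<lambda>s'. \<exists>x. labelled (hs @ [x]) s' \<and> successively hull_step (hs @ [x]))"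
proof -
  have ex: "\<exists>x<N. candidate hs x"
    by (rule candidate_ex) (use s j in \<open>auto simp: labelled_def\<close>)
  have "runs w label_body s ((60 * N + 20) + 40)
    (\<lambda>s'. \<exists>x. labelled (hs @ [x]) s' \<and> successively hull_step (hs @ [x]))"
    unfolding label_body_def
  proof (rule runs_Seq[OF runs_agree[OF runs_find[OF s(1,3,4,5) ex]]], rule runs_loopfree)
    fix s' assume s': "candidate hs (vars s' ''nx'') \<and> agree (mod_vars (For ''x'' (Const 0) (Var ''N'') find_body))
      (mod_arrays (For ''x'' (Const 0) (Var ''N'') find_body)) s s'"
    define x where "x = vars s' ''nx''"
    have x: "x < N" "L x = 0" "x \<notin> set hs" "hs \<noteq> [] \<longrightarrow> hull_step (last hs) x"
      using s' by (auto simp: candidate_def x_def)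
    have st: "vars s' ''n'' = n" "vars s' ''j'' = length hs" "arrays s' = arrays s"
      using s' s j by (auto simp: agree_def)
    have "x * n \<le> N * N" "length hs \<le> N" using x n_le_N j by (auto intro!: mult_mono)
    then have "x * n + length hs < 2 ^ w" "x * n < 2 ^ w"
      using fits_sum[of "x * n" "length hs"] by simp_all
    then have e: "exec w (Seq (Assign ''cur'' (Var ''nx''))
     (Seq (Store ''lab'' (Var ''cur'') (Const 1))
          (Store ''gp'' (Op Add (Op Mul (Var ''cur'') (Var ''n'')) (Var ''j'')) (Const 1)))) s' =
      s'\<lparr>vars := (vars s')(''cur'' := x), arrays := (arrays s')(''lab'' := (arrays s' ''lab'')(x := 1),
        ''gp'' := (arrays s' ''gp'')(x * n + length hs := 1))\<rparr>" (is "exec w ?c s' = ?s")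
      using st word_bounds(2) by (simp add: x_def)
    have "labelled (hs @ [x]) ?s"
    proof -
      have "arrays ?s ''gp'' (v * n + g) = of_bool (g < length (hs @ [x]) \<and> (hs @ [x]) ! g = v)"
        if vg: "v < N" "g < n" for v g
      proof -
        have idx: "v * n + g = x * n + length hs \<longleftrightarrow> v = x \<and> g = length hs"
          by (rule index_inj[OF vg(2) j(2)])
        have "arrays s ''gp'' (v * n + g) = of_bool (g < length hs \<and> hs ! g = v)"
          using s(5) vg by (simp add: labelled_def)
        then show ?thesis using idx st by (auto simp: nth_append)
      qed
      then show ?thesis using s(5) x st by (auto simp: labelled_def)
    qed
    moreover have "successively hull_step (hs @ [x])"
      using s(6) x(4) by (auto simp: successively_append_iff)
    ultimately show "\<exists>x. labelled (hs @ [x]) (exec w ?c s') \<and> successively hull_step (hs @ [x])"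
      unfolding e by blast
  qed simp_all
  then show ?thesis by (rule runs_mono) simp_all
qed

lemma runs_label_hull:
  assumes s: "ready s" "vars s ''n'' = n" "layered s" "pairs_marked s"
    and zero: "\<forall>x. arrays s ''lab'' x = 0" "\<forall>x. arrays s ''gp'' x = 0"
  shows "runs w label_hull s (n * (60 * N + 80) + 20)
    (\<lambda>s'. \<exists>hs. length hs = n \<and> labelled hs s' \<and> successively hull_step hs)"
proof -
  let ?s = "s\<lparr>vars := (vars s)(''cur'' := N)\<rparr>"
  have "runs w (Assign ''cur'' (Var ''N'')) s 2 (\<lambda>s'. s' = ?s)"
    by (rule runs_loopfree) (use s ready_N in simp_all)
  then have "runs w label_hull s (2 + (n * (60 * N + 80) + 10))
    (\<lambda>s'. \<exists>hs. length hs = n \<and> labelled hs s' \<and> successively hull_step hs)"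
    unfolding label_hull_def
  proof (rule runs_Seq)
    fix s0 assume s0: "s0 = ?s"
    show "runs w (For ''j'' (Const 0) (Var ''n'') label_body) s0 (n * (60 * N + 80) + 10)
      (\<lambda>s'. \<exists>hs. length hs = n \<and> labelled hs s' \<and> successively hull_step hs)"
    proof (rule runs_For[where l = 0 and h = n and B = "\<lambda>_. 60 * N + 60" and
        I = "\<lambda>i s'. \<exists>hs. length hs = i \<and> labelled hs s' \<and> successively hull_step hs"], goal_cases)
      case 3
      then show ?case by (rule fits_N) (use n_le_N in simp)
    next
      case 6
      then show ?case using zero s0 by (auto simp: labelled_def)
    next
      case (7 i s')
      then obtain hs where hs: "length hs = i" "labelled hs s'" "successively hull_step hs" by blast
      have st: "ready s'" "vars s' ''n'' = n" "layered s'" "pairs_marked s'"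
        using 7(4) s s0 by (auto simp: agree_def layered_def pairs_marked_def ready_def)
      from runs_label_body[OF st hs(2,3)] 7(2,3) hs(1)
      have "runs w label_body s' (60 * N + 60)
        (\<lambda>s'. \<exists>x. labelled (hs @ [x]) s' \<and> successively hull_step (hs @ [x]))" by simp
      then show ?case
      proof (rule runs_mono)
        fix s'' assume "\<exists>x. labelled (hs @ [x]) s'' \<and> successively hull_step (hs @ [x])"
        then obtain x where "labelled (hs @ [x]) s''" "successively hull_step (hs @ [x])" by blast
        then show "\<exists>hs. length hs = Suc i \<and> labelled hs (s''\<lparr>vars := (vars s'')(''j'' := Suc i)\<rparr>) \<and>
            successively hull_step hs"
          using hs(1) by (intro exI[of _ "hs @ [x]"]) (simp add: labelled_def)
      qed simp
    qed (use s s0 in \<open>auto simp: agree_def algebra_simps\<close>)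
  qed
  then show ?thesis by (rule runs_mono) simp_all
qed

end

section \<open>Gaps of all paths and initial slots\<close>

definition idx :: "expr \<Rightarrow> expr" where
  "idx v = Op Add (Op Mul v (Var ''n'')) (Var ''g'')"

text \<open>The comparison turns a sum of two bits into their disjunction, which is the union of the
  parents' gaps.\<close>

definition gap_body :: com where
  "gap_body = For ''g'' (Const 0) (Var ''n'') (Store ''gp'' (idx (Var ''v''))
     (Op Less (Const 0) (Op Add (Elem ''gp'' (idx (Elem ''PX'' (Var ''v'')))) (Elem ''gp'' (idx (Elem ''PY'' (Var ''v'')))))))"

text \<open>The slot of a gap is filled with the following hull edge. For a hull path this repeats
  an edge of the path, so its row is final. In the other layers the slots of gaps are overwritten
  later.\<close>

definition init_cell :: com where
  "init_cell = Seq
     (Store ''ea'' (idx (Var ''v'')) (Op Mod (Op Add (Var ''g'') (Elem ''gp'' (idx (Var ''v'')))) (Var ''n'')))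
     (Store ''eb'' (idx (Var ''v''))
       (Op Mod (Op Add (Op Add (Var ''g'') (Elem ''gp'' (idx (Var ''v'')))) (Const 1)) (Var ''n'')))"

definition init_row :: com where
  "init_row = For ''g'' (Const 0) (Var ''n'') init_cell"

definition init_slots :: com where
  "init_slots = Seq
     (For ''v'' (Const 0) (Var ''N'') (Seq (Store ''eoff'' (Var ''v'') (Op Mul (Var ''v'') (Var ''n''))) init_row))
     (Store ''eoff'' (Var ''N'') (Op Mul (Var ''N'') (Var ''n'')))"

lemma cost_idx [simp]: "cost (idx e) = cost e + 4"
  by (simp add: idx_def)

lemma mod_init_cell [simp]: "mod_vars init_cell = {}" "mod_arrays init_cell = {''ea'', ''eb''}"
  by (auto simp: init_cell_def)

lemma mod_gap_body [simp]: "mod_vars gap_body = {''g''}" "mod_arrays gap_body = {''gp''}"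
  by (auto simp: gap_body_def)

lemma mod_init_row [simp]: "mod_vars init_row = {''g''}" "mod_arrays init_row = {''ea'', ''eb''}"
  by (auto simp: init_row_def)

definition slot :: "nat \<Rightarrow> state \<Rightarrow> nat \<Rightarrow> nat \<Rightarrow> nat set" where
  "slot n s v g = {arrays s ''ea'' (v * n + g), arrays s ''eb'' (v * n + g)}"

context numbered_paths
begin

lemma idx_fits: "X < N \<Longrightarrow> g < n \<Longrightarrow> X * n + g < 2 ^ w \<and> X * n < 2 ^ w"
proof -
  assume "X < N" "g < n"
  then have "X * n \<le> N * N" "g \<le> N" using n_le_N by (auto intro!: mult_mono)
  then show ?thesis using fits_sum[of "X * n" g] by simp
qed

lemma eval_idx:
  assumes "eval w e s = X" "vars s ''n'' = n" "vars s ''g'' = g" "X < N" "g < n"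
  shows "eval w (idx e) s = X * n + g"
  using assms idx_fits[of X g] by (simp add: idx_def)

text \<open>The labels are the true numbers up to a symmetry \<open>\<tau>\<close>. Applying
  \<open>\<tau>\<close> to all paths gives another valid interpretation of the same adjacency lists
  with the same layers, and under this one the labels are the true numbers.\<close>

lemma relabel:
  assumes s: "labelled hs s" "length hs = n" "successively hull_step hs"
  shows "\<exists>\<tau>. hull_aut n \<tau> \<and> numbered_paths n N w (\<lambda>v. (`) \<tau> ` W v) A \<and>
    (\<forall>v<N. layer n ((`) \<tau> ` W v) = L v) \<and>
    (\<forall>v<N. \<forall>g<n. arrays s ''gp'' (v * n + g) = of_bool (L v = 0 \<and> g \<in> gaps n ((`) \<tau> ` W v)))"
proof -
  let ?\<kappa> = "\<lambda>j. hull_index (hs ! j)"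
  have n3: "3 \<le> n" using n by simp
  have mem: "hs ! j < N" "L (hs ! j) = 0" if "j < n" for j
    using s that by (auto simp: labelled_def)
  have hi: "?\<kappa> j < n" "W (hs ! j) = hull_path n (?\<kappa> j)" if "j < n" for j
    using hull_index mem[OF that] by auto
  have "\<exists>\<tau>. hull_aut n \<tau> \<and> (\<forall>j<n. \<tau> ` hull_edge n (?\<kappa> j) = hull_edge n j)"
  proof (rule hull_walk[OF _ hi(1) _ n3])
    show "inj_on ?\<kappa> {..<n}"
      using hull_index_inj mem s by (auto simp: inj_on_def nth_eq_iff_index_eq labelled_def)
    show "?\<kappa> (Suc j) = next_pt n (?\<kappa> j) \<or> ?\<kappa> j = next_pt n (?\<kappa> (Suc j))" if "Suc j < n" for j
      using s that by (simp add: successively_conv_nth hull_step_def)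
  qed
  then obtain \<tau> where \<tau>: "hull_aut n \<tau>" "\<And>j. j < n \<Longrightarrow> \<tau> ` hull_edge n (?\<kappa> j) = hull_edge n j" by blast
  have Wsub: "W v \<subseteq> Pow {..<n}" if "v < N" for v using W_in[OF that] ncpaths_subset by blast
  note inj = inj_on_edge_image(1)[OF \<tau>(1)]
  have layer: "layer n ((`) \<tau> ` W v) = L v" if "v < N" for v
    using hull_aut_lay[OF \<tau>(1) W_in[OF that]] by (simp add: L_def)
  have num: "numbered_paths n N w (\<lambda>v. (`) \<tau> ` W v) A"
  proof
    have "bij_betw ((\<lambda>v. (`) \<tau> ` v) \<circ> W) {..<N} (ncpaths n)"
      by (rule bij_betw_trans[OF bij hull_aut_bij_ncpaths[OF \<tau>(1)]])
    then show "bij_betw (\<lambda>v. (`) \<tau> ` W v) {..<N} (ncpaths n)" by (simp add: comp_def)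
    show "distinct (A ! v) \<and> set (A ! v) = {u. u < N \<and> exchange ((`) \<tau> ` W v) ((`) \<tau> ` W u)}" if "v < N" for v
      using nbrs[OF that] exch_image_iff[OF inj Wsub[OF that] Wsub] by auto
  qed (use n length_A word in auto)
  have hull: "(`) \<tau> ` W (hs ! j) = hull_path n j" if "j < n" for j
  proof -
    have "(`) \<tau> ` (hull_edges n - {hull_edge n (?\<kappa> j)}) = (`) \<tau> ` hull_edges n - (`) \<tau> ` {hull_edge n (?\<kappa> j)}"
      by (rule inj_on_image_set_diff[OF inj]) (use hull_edges_subset he_subset[OF hi(1)[OF that]] in auto)
    then show ?thesis
      using hull_aut_image_hull[OF \<tau>(1)] \<tau>(2)[OF that] hi(2)[OF that] by (simp add: hull_path_def)
  qed
  have gp: "arrays s ''gp'' (v * n + g) = of_bool (L v = 0 \<and> g \<in> gaps n ((`) \<tau> ` W v))"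
    if vg: "v < N" "g < n" for v g
  proof -
    have "arrays s ''gp'' (v * n + g) = of_bool (hs ! g = v)"
      using s vg by (simp add: labelled_def)
    moreover have "hs ! g = v \<longleftrightarrow> L v = 0 \<and> g \<in> gaps n ((`) \<tau> ` W v)"
    proof
      assume "hs ! g = v"
      then show "L v = 0 \<and> g \<in> gaps n ((`) \<tau> ` W v)"
        using mem(2)[OF vg(2)] hull[OF vg(2)] gaps_Hp[OF vg(2) n3] by auto
    next
      assume v: "L v = 0 \<and> g \<in> gaps n ((`) \<tau> ` W v)"
      \<comment> \<open>There are \<open>n\<close> different labelled vertices and \<open>n\<close>
        hull vertices, so every hull vertex has a label.\<close>
      have "set hs = {v. v < N \<and> L v = 0}"
      proof (rule card_subset_eq)
        show "set hs \<subseteq> {v. v < N \<and> L v = 0}" using s by (auto simp: labelled_def)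
        show "card (set hs) = card {v. v < N \<and> L v = 0}"
          using card_hull_vertices s distinct_card[of hs] by (simp add: labelled_def)
      qed simp
      then have "v \<in> set hs" using v vg by blast
      then obtain j where j: "j < n" "hs ! j = v" using s(2) by (auto simp: in_set_conv_nth)
      then show "hs ! g = v" using v hull[OF j(1)] gaps_Hp[OF j(1) n3] by auto
    qed
    ultimately show ?thesis by simp
  qed
  show ?thesis using \<tau>(1) num layer gp by blast
qed

lemma gaps_parents:
  assumes "is_parents v X Y" "v < N"
  shows "gaps n (W v) = gaps n (W X) \<union> gaps n (W Y)"
proof -
  have "layer n (W v) \<noteq> 0" using assms by (auto simp: is_parents_def L_def)
  then obtain S T where ST: "S \<noteq> T" "{u \<in> ncpaths n. exchange (W v) u \<and> layer n u + 1 = layer n (W v)} = {S, T}"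
      "gaps n (W v) = gaps n S \<union> gaps n T"
    using parents[of "W v" n] assms(2) n by auto
  have "W X \<in> {S, T}" "W Y \<in> {S, T}" unfolding ST(2)[symmetric] using assms by (auto simp: is_parents_def L_def)
  moreover have "W X \<noteq> W Y" using assms W_eq by (auto simp: is_parents_def)
  ultimately show ?thesis using ST(3) by auto
qed

definition gaps_known :: "state \<Rightarrow> bool" where
  "gaps_known s \<longleftrightarrow> (\<forall>v<N. \<forall>g<n. arrays s ''gp'' (v * n + g) = of_bool (g \<in> gaps n (W v)))"

lemma runs_gap_body:
  assumes s: "vars s ''n'' = n" "vars s ''v'' = v" "v < N" "is_parents v (arrays s ''PX'' v) (arrays s ''PY'' v)"
    and gp: "\<forall>u<N. \<forall>g<n. arrays s ''gp'' (u * n + g) = of_bool (Z u \<and> g \<in> gaps n (W u))"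
    and Z: "Z (arrays s ''PX'' v)" "Z (arrays s ''PY'' v)" "\<not> Z v"
  shows "runs w gap_body s (60 * n + 20)
    (\<lambda>s'. \<forall>u<N. \<forall>g<n. arrays s' ''gp'' (u * n + g) = of_bool ((Z u \<or> u = v) \<and> g \<in> gaps n (W u)))"
  unfolding gap_body_def
proof (rule runs_For[where l = 0 and h = n and B = "\<lambda>_. 40" and
      I = "\<lambda>i s'. \<forall>u<N. \<forall>g<n. arrays s' ''gp'' (u * n + g) = of_bool ((Z u \<or> u = v \<and> g < i) \<and> g \<in> gaps n (W u))"],
    goal_cases)
  case 3
  then show ?case by (rule fits_N) (use n_le_N in simp)
next
  case 6
  then show ?case using gp by simp
next
  case (7 i s')
  let ?X = "arrays s ''PX'' v" and ?Y = "arrays s ''PY'' v"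
  have XY: "?X < N" "?Y < N" using s(4) by (auto simp: is_parents_def)
  have st: "vars s' ''n'' = n" "vars s' ''v'' = v" "arrays s' ''PX'' = arrays s ''PX''" "arrays s' ''PY'' = arrays s ''PY''"
    using 7(4) s by (auto simp: agree_def)
  have e: "eval w (idx (Var ''v'')) s' = v * n + i" "eval w (idx (Elem ''PX'' (Var ''v''))) s' = ?X * n + i"
      "eval w (idx (Elem ''PY'' (Var ''v''))) s' = ?Y * n + i"
    by (rule eval_idx; use st 7 XY s in simp)+
  have val: "arrays s' ''gp'' (?X * n + i) = of_bool (i \<in> gaps n (W ?X))"
      "arrays s' ''gp'' (?Y * n + i) = of_bool (i \<in> gaps n (W ?Y))"
    using 7(2,5) XY Z by auto
  have g: "i \<in> gaps n (W v) \<longleftrightarrow> i \<in> gaps n (W ?X) \<or> i \<in> gaps n (W ?Y)"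
    using gaps_parents[OF s(4,3)] by blast
  have inj: "u * n + g = v * n + i \<longleftrightarrow> u = v \<and> g = i" if "g < n" for u g
    using index_inj[OF that 7(2)] .
  show ?case
    by (rule runs_loopfree)
      (use 7(2,5) e val g inj Z word_bounds in \<open>auto simp: less_Suc_eq\<close>)
next
  case (8 s')
  then show ?case by auto
qed (use s n in \<open>auto simp: agree_def\<close>)

lemma runs_gaps:
  assumes s: "ready s" "vars s ''n'' = n" "layered s"
    and gp: "\<forall>v<N. \<forall>g<n. arrays s ''gp'' (v * n + g) = of_bool (L v = 0 \<and> g \<in> gaps n (W v))"
  shows "runs w (visit_layers 2 gap_body) s (N * (60 * n + 20) + n * (60 * N + 60) + 60) gaps_known"
proof -
  \<comment> \<open>Already treated are the earlier layers and, in the current one, the smaller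
    numbers.\<close>
  let ?Z = "\<lambda>d v u. L u + 1 < d \<or> L u + 1 = d \<and> u < v"
  let ?J = "\<lambda>d v s. layered s \<and>
    (\<forall>u<N. \<forall>g<n. arrays s ''gp'' (u * n + g) = of_bool (?Z d v u \<and> g \<in> gaps n (W u)))"
  have "runs w (visit_layers 2 gap_body) s (N * (60 * n + 20) + n * (60 * N + 60) + 60) (?J (Suc n) 0)"
  proof (rule runs_visit_layers[where J = ?J, OF s(1,2)], goal_cases)
    case 2
    then show ?case using s gp by (auto simp: less_Suc_eq)
  next
    case (9 d v s s')
    then show ?case by (simp add: layered_def)
  next
    case (10 d v s')
    then show ?case by (auto simp: layered_def)
  next
    case (11 d v s')
    then have "?Z d v u = ?Z d (Suc v) u" for u by (auto simp: less_Suc_eq)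
    then show ?case using 11(3) by simp
  next
    case (12 v s')
    have p: "is_parents v (arrays s' ''PX'' v) (arrays s' ''PY'' v)" using 12 by (auto simp: layered_def)
    then have LXY: "L (arrays s' ''PX'' v) + 1 = L v" "L (arrays s' ''PY'' v) + 1 = L v"
      by (auto simp: is_parents_def)
    have "runs w gap_body s' (60 * n + 20)
      (\<lambda>s'. \<forall>u<N. \<forall>g<n. arrays s' ''gp'' (u * n + g) = of_bool ((?Z (L v + 1) v u \<or> u = v) \<and> g \<in> gaps n (W u)))"
      by (rule runs_gap_body) (use 12 p LXY in auto)
    from runs_agree[OF this] show ?case
    proof (rule runs_mono)
      fix s'' assume s'': "(\<forall>u<N. \<forall>g<n. arrays s'' ''gp'' (u * n + g) =
          of_bool ((?Z (L v + 1) v u \<or> u = v) \<and> g \<in> gaps n (W u))) \<and>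
        agree (mod_vars gap_body) (mod_arrays gap_body) s' s''"
      have "?Z (L v + 1) v u \<or> u = v \<longleftrightarrow> ?Z (L v + 1) (Suc v) u" for u by (auto simp: less_Suc_eq)
      moreover have "layered s''" using s'' 12(3) by (auto simp: agree_def layered_def)
      ultimately show "?J (L v + 1) (Suc v) s''" using s'' by simp
    qed simp
  next
    case (13 d s')
    have "?Z d N u \<longleftrightarrow> ?Z (Suc d) 0 u" if "u < N" for u using that by auto
    then show ?case using 13(3) by simp
  qed (use n in simp_all)
  then show ?thesis
  proof (rule runs_mono)
    fix s' assume J: "?J (Suc n) 0 s'"
    have "?Z (Suc n) 0 u" if "u < N" for u using L_less[OF that] by simp
    then show "gaps_known s'" using J by (simp add: gaps_known_def)
  qed simp
qed

definition hull_slot :: "nat \<Rightarrow> nat \<Rightarrow> nat set" where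
  "hull_slot v g = (if g \<in> gaps n (W v) then hull_edge n (next_pt n g) else hull_edge n g)"

definition slots_lt :: "state \<Rightarrow> bool" where
  "slots_lt s \<longleftrightarrow> (\<forall>v<N. \<forall>g<n. arrays s ''ea'' (v * n + g) < n \<and> arrays s ''eb'' (v * n + g) < n)"

definition offsets_ok :: "state \<Rightarrow> bool" where
  "offsets_ok s \<longleftrightarrow> (\<forall>v\<le>N. arrays s ''eoff'' v = v * n)"

definition slots_init :: "state \<Rightarrow> bool" where
  "slots_init s \<longleftrightarrow> slots_lt s \<and> (\<forall>v<N. \<forall>g<n. slot n s v g = hull_slot v g)"

definition init_pair :: "nat \<Rightarrow> nat \<Rightarrow> nat \<times> nat" where
  "init_pair v g = ((g + of_bool (g \<in> gaps n (W v))) mod n, (g + of_bool (g \<in> gaps n (W v)) + 1) mod n)"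

lemma init_pair_slot:
  assumes "g < n" "init_pair v g = (a, b)"
  shows "{a, b} = hull_slot v g" "a < n" "b < n"
proof -
  show "a < n" "b < n" using assms n by (auto simp: init_pair_def)
  have "next_pt n (next_pt n g) = Suc (Suc g) mod n" using assms(1) n nx_mod nx_lt by (simp add: mod_Suc_eq)
  then show "{a, b} = hull_slot v g"
    using assms nx_mod[OF assms(1)] by (auto simp: init_pair_def hull_slot_def hull_edge_def)
qed

lemma runs_init_row:
  assumes s: "vars s ''n'' = n" "vars s ''v'' = v" "v < N" "gaps_known s"
  shows "runs w init_row s (100 * n + 20)
    (\<lambda>s'. \<forall>u<N. \<forall>g<n. (arrays s' ''ea'' (u * n + g), arrays s' ''eb'' (u * n + g)) =
      (if u = v then init_pair v g
       else (arrays s ''ea'' (u * n + g), arrays s ''eb'' (u * n + g))))"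
  unfolding init_row_def
proof (rule runs_For[where l = 0 and h = n and B = "\<lambda>_. 60" and
      I = "\<lambda>i s'. \<forall>u<N. \<forall>g<n. (arrays s' ''ea'' (u * n + g), arrays s' ''eb'' (u * n + g)) =
      (if u = v \<and> g < i then init_pair v g
       else (arrays s ''ea'' (u * n + g), arrays s ''eb'' (u * n + g)))"], goal_cases)
  case 3
  then show ?case by (rule fits_N) (use n_le_N in simp)
next
  case (7 i s')
  have st: "vars s' ''n'' = n" "vars s' ''v'' = v" "gaps_known s'"
    using 7(4) s by (auto simp: agree_def gaps_known_def)
  have e: "eval w (idx (Var ''v'')) s'' = v * n + i" if "vars s'' = vars s'" for s''
    by (rule eval_idx) (use st 7 s that in simp_all)
  have gp: "arrays s' ''gp'' (v * n + i) = of_bool (i \<in> gaps n (W v))" using st(3) s(3) 7(2) by (simp add: gaps_known_def)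
  define h where "h = i + of_bool (i \<in> gaps n (W v))"
  have h: "i + of_bool (i \<in> gaps n (W v)) < 2 ^ w" "Suc (i + of_bool (i \<in> gaps n (W v))) < 2 ^ w" "n < 2 ^ w"
    using 7(2) n_le_N by (auto intro!: fits_N simp: of_bool_def)
  have m: "x mod n < 2 ^ w" for x using h(3) n by (meson less_trans mod_less_divisor zero_less_numeral less_le_trans)
  have inj: "u * n + g = v * n + i \<longleftrightarrow> u = v \<and> g = i" if "g < n" for u g
    using index_inj[OF that 7(2)] .
  have ex: "exec w init_cell s' =
    s'\<lparr>arrays := (arrays s')(''ea'' := (arrays s' ''ea'')(v * n + i := h mod n),
        ''eb'' := (arrays s' ''eb'')(v * n + i := (h + 1) mod n))\<rparr>"
    using e gp st 7(3) h m word_bounds(2) by (simp add: h_def init_cell_def)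
  show ?case
  proof (rule runs_loopfree)
    show "\<forall>u<N. \<forall>g<n. (arrays (exec w init_cell s'
        \<lparr>vars := (vars (exec w init_cell s'))(''g'' := Suc i)\<rparr>) ''ea'' (u * n + g),
        arrays (exec w init_cell s'
        \<lparr>vars := (vars (exec w init_cell s'))(''g'' := Suc i)\<rparr>) ''eb'' (u * n + g)) =
      (if u = v \<and> g < Suc i then init_pair v g
       else (arrays s ''ea'' (u * n + g), arrays s ''eb'' (u * n + g)))"
    proof (intro allI impI)
      fix u g assume ug: "u < N" "g < n"
      have "(arrays s' ''ea'' (u * n + g), arrays s' ''eb'' (u * n + g)) =
          (if u = v \<and> g < i then init_pair v g else (arrays s ''ea'' (u * n + g), arrays s ''eb'' (u * n + g)))"
        using 7(5) ug by blast
      then show "(arrays (exec w init_cell s'\<lparr>vars := (vars (exec w init_cell s'))(''g'' := Suc i)\<rparr>) ''ea'' (u * n + g),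
          arrays (exec w init_cell s'\<lparr>vars := (vars (exec w init_cell s'))(''g'' := Suc i)\<rparr>) ''eb'' (u * n + g)) =
        (if u = v \<and> g < Suc i then init_pair v g else (arrays s ''ea'' (u * n + g), arrays s ''eb'' (u * n + g)))"
        unfolding ex using inj[OF ug(2), of u] by (auto simp: less_Suc_eq h_def init_pair_def)
    qed
  qed (simp_all add: init_cell_def)
next
  case (8 s')
  then show ?case by auto
qed (use s n in \<open>auto simp: agree_def\<close>)

lemma runs_init_slots:
  assumes s: "ready s" "vars s ''n'' = n" "gaps_known s"
  shows "runs w init_slots s (N * (100 * n + 60) + 40) (\<lambda>s'. slots_init s' \<and> offsets_ok s')"
proof -
  let ?b = "Seq (Store ''eoff'' (Var ''v'') (Op Mul (Var ''v'') (Var ''n''))) init_row"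
  let ?I = "\<lambda>i s'. (\<forall>v<i. arrays s' ''eoff'' v = v * n) \<and> (\<forall>v<N. \<forall>g<n. v < i \<longrightarrow>
    (arrays s' ''ea'' (v * n + g), arrays s' ''eb'' (v * n + g)) = init_pair v g)"
  have mul: "v * n < 2 ^ w" if "v \<le> N" for v
  proof -
    have "v * n \<le> N * N" using that n_le_N by (intro mult_mono) auto
    then show ?thesis using fits_sum[of "v * n" 0] by simp
  qed
  have "runs w (For ''v'' (Const 0) (Var ''N'') ?b) s (N * (100 * n + 60) + 10) (\<lambda>s'. ?I N s' \<and> ready s' \<and> vars s' ''n'' = n)"
  proof (rule runs_For[where l = 0 and h = N and B = "\<lambda>_. 100 * n + 40" and I = ?I], goal_cases)
    case (7 i s')
    have st: "vars s' ''n'' = n" using 7(4) s by (simp add: agree_def)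
    let ?s = "s'\<lparr>arrays := (arrays s')(''eoff'' := (arrays s' ''eoff'')(i := i * n))\<rparr>"
    have 1: "runs w (Store ''eoff'' (Var ''v'') (Op Mul (Var ''v'') (Var ''n''))) s' 20 (\<lambda>s''. s'' = ?s)"
      by (rule runs_loopfree) (use st 7 mul[of i] in simp_all)
    have gk: "gaps_known ?s" using 7(4) s by (simp add: gaps_known_def agree_def)
    have 2: "runs w init_row ?s (100 * n + 20)
      (\<lambda>s''. \<forall>u<N. \<forall>g<n. (arrays s'' ''ea'' (u * n + g), arrays s'' ''eb'' (u * n + g)) =
      (if u = i then init_pair i g else (arrays ?s ''ea'' (u * n + g), arrays ?s ''eb'' (u * n + g))))"
      by (rule runs_init_row) (use st 7 gk in simp_all)
    have "runs w ?b s' (20 + (100 * n + 20)) (?I (Suc i))"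
    proof (rule runs_Seq[OF 1])
      fix s0 assume "s0 = ?s"
      then show "runs w init_row s0 (100 * n + 20) (?I (Suc i))"
      proof (simp only:, intro runs_mono[OF runs_agree[OF 2]])
        fix s'' assume s'': "(\<forall>u<N. \<forall>g<n. (arrays s'' ''ea'' (u * n + g), arrays s'' ''eb'' (u * n + g)) =
            (if u = i then init_pair i g else (arrays ?s ''ea'' (u * n + g), arrays ?s ''eb'' (u * n + g)))) \<and>
          agree (mod_vars init_row) (mod_arrays init_row) ?s s''"
        have "arrays s'' ''eoff'' v = v * n" if "v < Suc i" for v
          using s'' 7(5) that by (auto simp: agree_def less_Suc_eq)
        moreover have "(arrays s'' ''ea'' (v * n + g), arrays s'' ''eb'' (v * n + g)) = init_pair v g"
          if "v < N" "g < n" "v < Suc i" for v g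
        proof -
          have "(arrays s'' ''ea'' (v * n + g), arrays s'' ''eb'' (v * n + g)) =
            (if v = i then init_pair i g else (arrays ?s ''ea'' (v * n + g), arrays ?s ''eb'' (v * n + g)))"
            using s'' that by blast
          then show ?thesis using 7(5) that by (cases "v = i") auto
        qed
        ultimately show "?I (Suc i) s''" by blast
      qed simp
    qed
    then show ?case by (rule runs_mono) simp_all
  next
    case (8 s')
    then show ?case using ready_agree[OF s(1) 8(2)] s(2) by (simp add: agree_def)
  next
    case 9
    then show ?case by (simp add: algebra_simps)
  qed (use s ready_N fits_N[of N] in \<open>auto simp: agree_def\<close>)
  then have "runs w init_slots s (N * (100 * n + 60) + 10 + 20) (\<lambda>s'. slots_init s' \<and> offsets_ok s')"
    unfolding init_slots_def
  proof (rule runs_Seq)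
    fix s' assume s': "?I N s' \<and> ready s' \<and> vars s' ''n'' = n"
    let ?s = "s'\<lparr>arrays := (arrays s')(''eoff'' := (arrays s' ''eoff'')(N := N * n))\<rparr>"
    have "slots_init ?s"
    proof -
      have "slot n ?s v g = hull_slot v g \<and> arrays ?s ''ea'' (v * n + g) < n \<and> arrays ?s ''eb'' (v * n + g) < n"
        if "v < N" "g < n" for v g
        using init_pair_slot[OF that(2), of v "arrays s' ''ea'' (v * n + g)" "arrays s' ''eb'' (v * n + g)"] s' that
        by (simp add: slot_def)
      then show ?thesis by (simp add: slots_init_def slots_lt_def)
    qed
    moreover have "offsets_ok ?s" using s' by (auto simp: offsets_ok_def le_less)
    ultimately show "runs w (Store ''eoff'' (Var ''N'') (Op Mul (Var ''N'') (Var ''n''))) s' 20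
        (\<lambda>s'. slots_init s' \<and> offsets_ok s')"
      by (intro runs_loopfree) (use s' ready_N[of s'] mul[of N] in simp_all)
  qed
  then show ?thesis by (rule runs_mono) simp_all
qed

end

section \<open>Diagonals of layer 1 and of the higher layers\<close>

definition classify :: com where
  "classify = If (Elem ''gp'' (idx (Var ''X'')))
     (If (Elem ''gp'' (idx (Var ''Y''))) (Assign ''s'' (Var ''g'')) (Assign ''a'' (Var ''g'')))
     (If (Elem ''gp'' (idx (Var ''Y''))) (Assign ''b'' (Var ''g'')) Skip)"

text \<open>A path with one diagonal whose gaps are \<open>a\<close> and \<open>s\<close> has the diagonal with ends \<open>a\<close>, \<open>s\<close> or the one
  with ends \<open>a + 1\<close>, \<open>s + 1\<close>; the value of \<open>t\<close> selects it.\<close>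

definition put_diagonal :: "name \<Rightarrow> name \<Rightarrow> expr \<Rightarrow> com" where
  "put_diagonal v a t = Seq (Seq
     (Assign ''p'' (Op Mod (Op Add (Var a) t) (Var ''n'')))
     (Assign ''q'' (Op Mod (Op Add (Var ''s'') t) (Var ''n''))))
   (Seq (Seq
     (Store ''ea'' (Op Add (Op Mul (Var v) (Var ''n'')) (Var a)) (Var ''p''))
     (Store ''eb'' (Op Add (Op Mul (Var v) (Var ''n'')) (Var a)) (Var ''q'')))
   (Seq
     (Store ''ea'' (Op Add (Op Mul (Var v) (Var ''n'')) (Var ''s'')) (Var ''p''))
     (Store ''eb'' (Op Add (Op Mul (Var v) (Var ''n'')) (Var ''s'')) (Var ''q''))))"

text \<open>The sum is \<open>2\<close> or \<open>1\<close>, according to the orientation of the three gaps on the hull.\<close>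

definition fix_tail :: com where
  "fix_tail = Seq (Assign ''t'' (Op Add (Op Add (Op Less (Var ''a'') (Var ''b'')) (Op Less (Var ''b'') (Var ''s'')))
       (Op Less (Var ''s'') (Var ''a''))))
     (Seq (put_diagonal ''X'' ''a'' (Op Sub (Var ''t'') (Const 1)))
          (put_diagonal ''Y'' ''b'' (Op Sub (Const 2) (Var ''t''))))"

definition fix_body :: com where
  "fix_body = Seq (Seq (Assign ''X'' (Elem ''PX'' (Var ''v''))) (Assign ''Y'' (Elem ''PY'' (Var ''v''))))
     (Seq (For ''g'' (Const 0) (Var ''n'') classify) fix_tail)"

text \<open>Value 3 of \<open>dist\<close> means layer 2. A layer 1 row may be written several
  times, once for each layer 2 neighbour, but always with the same diagonal.\<close>

definition fix_slots :: com where
  "fix_slots = For ''v'' (Const 0) (Var ''N'')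
     (If (Op Equal (Elem ''dist'' (Var ''v'')) (Const 3)) fix_body Skip)"

definition merge_cell :: com where
  "merge_cell = Seq (If (Elem ''gp'' (idx (Elem ''PX'' (Var ''v''))))
       (Assign ''z'' (Elem ''PX'' (Var ''v''))) (Assign ''z'' (Elem ''PY'' (Var ''v''))))
     (Seq (Store ''ea'' (idx (Var ''v'')) (Elem ''ea'' (idx (Var ''z''))))
          (Store ''eb'' (idx (Var ''v'')) (Elem ''eb'' (idx (Var ''z'')))))"

definition merge_row :: com where
  "merge_row = For ''g'' (Const 0) (Var ''n'') merge_cell"

lemma mod_classify [simp]: "mod_vars classify = {''s'', ''a'', ''b''}" "mod_arrays classify = {}"
  by (auto simp: classify_def)

lemma mod_fix_body [simp]: "mod_vars fix_body = {''X'', ''Y'', ''g'', ''s'', ''a'', ''b'', ''t'', ''p'', ''q''}"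
    "mod_arrays fix_body = {''ea'', ''eb''}"
  by (auto simp: fix_body_def fix_tail_def put_diagonal_def)

lemma mod_merge_cell [simp]: "mod_vars merge_cell = {''z''}" "mod_arrays merge_cell = {''ea'', ''eb''}"
  by (auto simp: merge_cell_def)

lemma mod_merge_row [simp]: "mod_vars merge_row = {''g'', ''z''}" "mod_arrays merge_row = {''ea'', ''eb''}"
  by (auto simp: merge_row_def)

lemma slot_cong: "arrays s' = arrays s \<Longrightarrow> slot n s' = slot n s"
  by (intro ext) (simp add: slot_def)

context numbered_paths
begin

lemma runs_classify:
  assumes s: "vars s ''n'' = n" "vars s ''X'' = X" "vars s ''Y'' = Y" "X < N" "Y < N" "gaps_known s"
    and g: "gaps n (W X) = {a, c}" "gaps n (W Y) = {b, c}" "a < n" "b < n" "c < n" "a \<noteq> b" "a \<noteq> c" "b \<noteq> c"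
  shows "runs w (For ''g'' (Const 0) (Var ''n'') classify) s (60 * n + 20)
    (\<lambda>s'. vars s' ''a'' = a \<and> vars s' ''b'' = b \<and> vars s' ''s'' = c)"
proof (rule runs_For[where l = 0 and h = n and B = "\<lambda>_. 40" and
      I = "\<lambda>i s'. (a < i \<longrightarrow> vars s' ''a'' = a) \<and> (b < i \<longrightarrow> vars s' ''b'' = b) \<and> (c < i \<longrightarrow> vars s' ''s'' = c)"],
    goal_cases)
  case 3
  then show ?case by (rule fits_N) (use n_le_N in simp)
next
  case (7 i s')
  have st: "vars s' ''n'' = n" "vars s' ''X'' = X" "vars s' ''Y'' = Y" "gaps_known s'"
    using 7(4) s by (auto simp: agree_def gaps_known_def)
  have e: "eval w (idx (Var ''X'')) s' = X * n + i" "eval w (idx (Var ''Y'')) s' = Y * n + i"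
    by (rule eval_idx; use st 7 s in simp)+
  have val: "arrays s' ''gp'' (X * n + i) = 0 \<longleftrightarrow> i \<noteq> a \<and> i \<noteq> c"
      "arrays s' ''gp'' (Y * n + i) = 0 \<longleftrightarrow> i \<noteq> b \<and> i \<noteq> c"
    using st(4) s(4,5) 7(2) g(1,2) by (auto simp: gaps_known_def)
  have ex: "exec w classify s' =
      (if i = c then s'\<lparr>vars := (vars s')(''s'' := c)\<rparr> else if i = a then s'\<lparr>vars := (vars s')(''a'' := a)\<rparr>
       else if i = b then s'\<lparr>vars := (vars s')(''b'' := b)\<rparr> else s')"
    using e val 7(3) g(6-8) unfolding classify_def
    by (cases "i = c"; cases "i = a"; cases "i = b") simp_all
  show ?case
  proof (rule runs_loopfree)
    show "loopfree classify" "time_bound classify \<le> 40" by (simp_all add: classify_def)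
  qed (use 7(5) g(6-8) in \<open>auto simp: ex less_Suc_eq\<close>)
qed (use s g in \<open>auto simp: agree_def\<close>)

lemma sh_mod: "x < n \<Longrightarrow> (x + of_bool t) mod n = shift n t x"
  by (cases t) (auto simp: shift_def nx_mod)

text \<open>The conditions on the names keep the assignments to \<open>p\<close> and
  \<open>q\<close> from changing what later instructions read.\<close>

lemma exec_put_diagonal:
  assumes st: "vars s ''n'' = n" "vars s v = V" "vars s a = x" "vars s ''s'' = c" "eval w t s = of_bool r"
    and lt: "V < N" "x < n" "c < n"
    and names: "v \<notin> {''p'', ''q''}" "a \<notin> {''p'', ''q''}" "\<And>k. eval w t (s\<lparr>vars := (vars s)(''p'' := k)\<rparr>) = eval w t s"
  shows "exec w (put_diagonal v a t) s = s\<lparr>vars := (vars s)(''p'' := shift n r x, ''q'' := shift n r c),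
     arrays := (arrays s)(''ea'' := (arrays s ''ea'')(V * n + x := shift n r x, V * n + c := shift n r x),
       ''eb'' := (arrays s ''eb'')(V * n + x := shift n r c, V * n + c := shift n r c))\<rparr>"
proof -
  have f: "Suc x < 2 ^ w" "Suc c < 2 ^ w" "n < 2 ^ w" using lt n_le_N by (auto intro!: fits_N)
  have f': "(x + of_bool r) mod 2 ^ w = x + of_bool r" "(c + of_bool r) mod 2 ^ w = c + of_bool r"
    using f by (cases r; simp)+
  have sh_lt: "shift n r x < 2 ^ w" "shift n r c < 2 ^ w" using lt nx_lt f(3) by (auto simp: shift_def intro: less_trans)
  have i: "V * n + x < 2 ^ w" "V * n + c < 2 ^ w" "V * n < 2 ^ w" using idx_fits lt by auto
  show ?thesis
    using st lt names f' sh_mod[OF lt(2), of r] sh_mod[OF lt(3), of r] sh_lt i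
    by (simp add: put_diagonal_def fun_upd_twist)
qed

text \<open>While the layer-2 vertices are processed, the slots of a layer-1 vertex become correct as soon
  as one of its layer-2 neighbours has been processed.\<close>

definition fixed :: "(nat \<Rightarrow> bool) \<Rightarrow> state \<Rightarrow> bool" where
  "fixed Z s \<longleftrightarrow> slots_lt s \<and>
     (\<forall>u<N. \<forall>g<n. L u \<noteq> 1 \<or> g \<notin> gaps n (W u) \<longrightarrow> slot n s u g = hull_slot u g) \<and>
     (\<forall>u<N. L u = 1 \<and> Z u \<longrightarrow> slots_ok n (W u) (slot n s u))"

lemma slots_ok_cong:
  assumes "\<And>g. g < n \<Longrightarrow> sl g = sl' g" "slots_ok n v sl"
  shows "slots_ok n v sl'"
proof -
  have "sl' ` gaps n v = sl ` gaps n v" using assms(1) by (intro image_cong) (auto simp: gaps_def)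
  moreover have "sl' g = sl g" if "g \<in> gaps n v" for g using assms(1) that by (auto simp: gaps_def)
  ultimately show ?thesis using assms unfolding slots_ok_def by simp
qed

lemma runs_fix_body:
  assumes s: "ready s" "vars s ''n'' = n" "vars s ''v'' = v" "v < N" "L v = 2" "layered s" "gaps_known s" "fixed Z s"
  shows "runs w fix_body s (60 * n + 200) (fixed (\<lambda>u. Z u \<or> is_parents v (arrays s ''PX'' v) (arrays s ''PY'' v) \<and>
      u \<in> {arrays s ''PX'' v, arrays s ''PY'' v}))"
proof -
  define X Y where XY_def: "X = arrays s ''PX'' v" "Y = arrays s ''PY'' v"
  have p: "is_parents v X Y" using s by (auto simp: layered_def XY_def)
  then have XY: "X < N" "Y < N" "X \<noteq> Y" "L X = 1" "L Y = 1" using s by (auto simp: is_parents_def)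
  have n3: "3 \<le> n" using n by simp
  have "\<exists>a b c t. a < n \<and> b < n \<and> c < n \<and> a \<noteq> b \<and> a \<noteq> c \<and> b \<noteq> c \<and> nonadj n a c \<and> nonadj n b c \<and>
    W X = one_diagonal n t a c \<and> W Y = one_diagonal n (\<not> t) b c \<and>
    of_bool (a < b) + of_bool (b < c) + of_bool (c < a) = (if t then 2 else 1 :: nat)"
    by (rule layer2_parents[of "W v"]) (use s p XY n W_eq in \<open>auto simp: is_parents_def L_def\<close>)
  then obtain a b c t where abc: "a < n" "b < n" "c < n" "a \<noteq> b" "a \<noteq> c" "b \<noteq> c" "nonadj n a c" "nonadj n b c"
    "W X = one_diagonal n t a c" "W Y = one_diagonal n (\<not> t) b c"
    "of_bool (a < b) + of_bool (b < c) + of_bool (c < a) = (if t then 2 else 1 :: nat)" by blast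
  have gX: "gaps n (W X) = {a, c}" and gY: "gaps n (W Y) = {b, c}"
    using gaps_Dg abc n3 by simp_all
  let ?s = "s\<lparr>vars := (vars s)(''X'' := X, ''Y'' := Y)\<rparr>"
  have 1: "runs w (Seq (Assign ''X'' (Elem ''PX'' (Var ''v''))) (Assign ''Y'' (Elem ''PY'' (Var ''v'')))) s 10 (\<lambda>s'. s' = ?s)"
    by (rule runs_loopfree) (use s in \<open>simp_all add: XY_def\<close>)
  have 2: "runs w (For ''g'' (Const 0) (Var ''n'') classify) ?s (60 * n + 20)
    (\<lambda>s'. (vars s' ''a'' = a \<and> vars s' ''b'' = b \<and> vars s' ''s'' = c) \<and>
      agree (mod_vars (For ''g'' (Const 0) (Var ''n'') classify)) (mod_arrays (For ''g'' (Const 0) (Var ''n'') classify)) ?s s')"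
    by (rule runs_agree, rule runs_classify[OF _ _ _ XY(1,2) _ gX gY abc(1-6)])
       (use s in \<open>simp_all add: gaps_known_def\<close>)
  have 3: "runs w fix_tail s' 170 (fixed (\<lambda>u. Z u \<or> u \<in> {X, Y}))"
    if s': "(vars s' ''a'' = a \<and> vars s' ''b'' = b \<and> vars s' ''s'' = c) \<and>
      agree (mod_vars (For ''g'' (Const 0) (Var ''n'') classify)) (mod_arrays (For ''g'' (Const 0) (Var ''n'') classify)) ?s s'" for s'
  proof (rule runs_loopfree)
    have st: "vars s' ''a'' = a" "vars s' ''b'' = b" "vars s' ''s'' = c" "vars s' ''n'' = n" "vars s' ''X'' = X"
        "vars s' ''Y'' = Y" "arrays s' = arrays s"
      using s' s by (auto simp: agree_def)
    \<comment> \<open>\<open>k\<close> is the computed sum; \<open>k - 1\<close> and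
      \<open>2 - k\<close> are the two complementary bits for the diagonals of \<open>X\<close> and
      \<open>Y\<close>.\<close>
    define k where "k = (if t then 2 else 1 :: nat)"
    let ?s1 = "s'\<lparr>vars := (vars s')(''t'' := k)\<rparr>"
    have k: "(of_bool (a < b) + of_bool (b < c)) mod 2 ^ w = (of_bool (a < b) + of_bool (b < c) :: nat)"
      "(of_bool (a < b) + of_bool (b < c) + of_bool (c < a)) mod 2 ^ w = k"
      using abc(11) word_bounds by (auto simp: k_def of_bool_def split: if_splits)
    have e1: "exec w (Assign ''t'' (Op Add (Op Add (Op Less (Var ''a'') (Var ''b'')) (Op Less (Var ''b'') (Var ''s'')))
       (Op Less (Var ''s'') (Var ''a'')))) s' = ?s1"
      using st k by (simp add: of_bool_def)
    let ?s2 = "?s1\<lparr>vars := (vars ?s1)(''p'' := shift n t a, ''q'' := shift n t c),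
     arrays := (arrays ?s1)(''ea'' := (arrays ?s1 ''ea'')(X * n + a := shift n t a, X * n + c := shift n t a),
       ''eb'' := (arrays ?s1 ''eb'')(X * n + a := shift n t c, X * n + c := shift n t c))\<rparr>"
    have e2: "exec w (put_diagonal ''X'' ''a'' (Op Sub (Var ''t'') (Const 1))) ?s1 = ?s2"
      by (rule exec_put_diagonal) (use st XY abc word_bounds in \<open>auto simp: k_def\<close>)
    let ?s3 = "?s2\<lparr>vars := (vars ?s2)(''p'' := shift n (\<not> t) b, ''q'' := shift n (\<not> t) c),
     arrays := (arrays ?s2)(''ea'' := (arrays ?s2 ''ea'')(Y * n + b := shift n (\<not> t) b, Y * n + c := shift n (\<not> t) b),
       ''eb'' := (arrays ?s2 ''eb'')(Y * n + b := shift n (\<not> t) c, Y * n + c := shift n (\<not> t) c))\<rparr>"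
    have e3: "exec w (put_diagonal ''Y'' ''b'' (Op Sub (Const 2) (Var ''t''))) ?s2 = ?s3"
      by (rule exec_put_diagonal) (use st XY abc word_bounds in \<open>auto simp: k_def\<close>)
    have ex: "exec w fix_tail s' = ?s3"
      unfolding fix_tail_def exec.simps(4) e1 e2 e3 ..
    have inj: "u * n + g = V * n + x \<longleftrightarrow> u = V \<and> g = x" if "g < n" "x < n" for u g V x
      using index_inj that by metis
    have ea: "arrays ?s3 ''ea'' (u * n + g) =
        (if u = X \<and> (g = a \<or> g = c) then shift n t a else if u = Y \<and> (g = b \<or> g = c) then shift n (\<not> t) b
         else arrays s ''ea'' (u * n + g))" if "g < n" for u g
      using XY(3) n by (simp add: inj that abc st(7))
    have eb: "arrays ?s3 ''eb'' (u * n + g) =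
        (if u = X \<and> (g = a \<or> g = c) then shift n t c else if u = Y \<and> (g = b \<or> g = c) then shift n (\<not> t) c
         else arrays s ''eb'' (u * n + g))" if "g < n" for u g
      using XY(3) n by (simp add: inj that abc st(7))
    have sl: "slot n ?s3 u g =
        (if u = X \<and> (g = a \<or> g = c) then {shift n t a, shift n t c}
         else if u = Y \<and> (g = b \<or> g = c) then {shift n (\<not> t) b, shift n (\<not> t) c} else slot n s u g)" if "g < n" for u g
    proof (cases "u = X \<and> (g = a \<or> g = c)")
      case True
      show ?thesis unfolding slot_def ea[OF that] eb[OF that] if_P[OF True] ..
    next
      case nX: False
      show ?thesis
      proof (cases "u = Y \<and> (g = b \<or> g = c)")
        case True
        show ?thesis unfolding slot_def ea[OF that] eb[OF that] if_not_P[OF nX] if_P[OF True] ..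
      next
        case False
        show ?thesis unfolding slot_def ea[OF that] eb[OF that] if_not_P[OF nX] if_not_P[OF False] ..
      qed
    qed
    have fx: "slots_lt s" "\<And>u g. u < N \<Longrightarrow> g < n \<Longrightarrow> L u \<noteq> 1 \<or> g \<notin> gaps n (W u) \<Longrightarrow> slot n s u g = hull_slot u g"
        "\<And>u. u < N \<Longrightarrow> L u = 1 \<Longrightarrow> Z u \<Longrightarrow> slots_ok n (W u) (slot n s u)"
      using s(8) by (auto simp: fixed_def)
    have shlt: "shift n r x < n" if "x < n" for r x using that nx_lt by (simp add: shift_def)
    have "slots_lt ?s3"
      unfolding slots_lt_def
    proof (intro allI impI)
      fix u g assume ug: "u < N" "g < n"
      then show "arrays ?s3 ''ea'' (u * n + g) < n \<and> arrays ?s3 ''eb'' (u * n + g) < n"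
        unfolding ea[OF ug(2)] eb[OF ug(2)] using fx(1) shlt abc(1-3) by (simp add: slots_lt_def)
    qed
    moreover have "slot n ?s3 u g = hull_slot u g" if "u < N" "g < n" "L u \<noteq> 1 \<or> g \<notin> gaps n (W u)" for u g
    proof -
      have "\<not> (u = X \<and> (g = a \<or> g = c))" "\<not> (u = Y \<and> (g = b \<or> g = c))"
        using that(3) XY(4,5) gX gY by auto
      then show ?thesis using fx(2)[OF that] by (simp only: sl[OF that(2)] if_False)
    qed
    moreover have "slots_ok n (W u) (slot n ?s3 u)" if u: "u < N" "L u = 1" "Z u \<or> u \<in> {X, Y}" for u
    proof -
      consider "u = X" | "u = Y" | "u \<noteq> X" "u \<noteq> Y" "Z u" using u(3) by blast
      then show ?thesis
      proof cases
        case 1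
        show ?thesis unfolding 1 abc(9)
        proof (rule slots_Dg[OF abc(1,3,7) n3])
          fix g assume g: "g < n" "g \<noteq> a" "g \<noteq> c"
          then have "g \<notin> gaps n (W X)" using gX by simp
          then show "slot n ?s3 X g = hull_edge n g"
            using fx(2)[OF XY(1) g(1)] g XY(3) unfolding sl[OF g(1)] by (simp add: hull_slot_def)
        qed (simp_all only: sl[OF abc(1)] sl[OF abc(3)], simp_all)
      next
        case 2
        show ?thesis unfolding 2 abc(10)
        proof (rule slots_Dg[OF abc(2,3,8) n3])
          fix g assume g: "g < n" "g \<noteq> b" "g \<noteq> c"
          then have "g \<notin> gaps n (W Y)" using gY by simp
          then show "slot n ?s3 Y g = hull_edge n g"
            using fx(2)[OF XY(2) g(1)] g XY(3) unfolding sl[OF g(1)] by (simp add: hull_slot_def)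
        qed (use XY(3) in \<open>simp_all only: sl[OF abc(2)] sl[OF abc(3)]\<close>, use XY(3) in simp_all)
      next
        case 3
        show ?thesis
          by (rule slots_ok_cong[OF _ fx(3)[OF u(1,2) 3(3)]]) (use 3 in \<open>simp only: sl if_False simp_thms\<close>)
      qed
    qed
    ultimately show "fixed (\<lambda>u. Z u \<or> u \<in> {X, Y}) (exec w fix_tail s')"
      unfolding fixed_def ex by blast
  qed (simp_all add: fix_tail_def put_diagonal_def)
  have "runs w fix_body s (10 + ((60 * n + 20) + 170)) (fixed (\<lambda>u. Z u \<or> u \<in> {X, Y}))"
    unfolding fix_body_def
  proof (rule runs_Seq[OF 1])
    fix s0 assume "s0 = ?s"
    then show "runs w (Seq (For ''g'' (Const 0) (Var ''n'') classify) fix_tail) s0 (60 * n + 20 + 170)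
        (fixed (\<lambda>u. Z u \<or> u \<in> {X, Y}))"
      using runs_Seq[OF 2 3] by simp
  qed
  then show ?thesis
    by (rule runs_mono) (use p in \<open>simp_all add: XY_def\<close>)
qed

lemma runs_fix_slots:
  assumes s: "ready s" "vars s ''n'' = n" "layered s" "gaps_known s" "slots_init s"
  shows "runs w fix_slots s (N * (60 * n + 250) + 20) (fixed (\<lambda>_. True))"
proof -
  let ?par = "\<lambda>v u. u \<in> {arrays s ''PX'' v, arrays s ''PY'' v}"
  let ?Z = "\<lambda>i u. \<exists>v<i. L v = 2 \<and> ?par v u"
  show ?thesis
    unfolding fix_slots_def
  proof (rule runs_For[where l = 0 and h = N and B = "\<lambda>_. 60 * n + 230" and I = "\<lambda>i. fixed (?Z i)"], goal_cases)
    case 6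
    then show ?case using s(5) by (simp add: fixed_def slots_init_def slots_lt_def slot_def)
  next
    case (7 i s')
    have st: "ready s'" "vars s' ''n'' = n" "layered s'" "gaps_known s'" "arrays s' ''PX'' = arrays s ''PX''"
        "arrays s' ''PY'' = arrays s ''PY''"
      using ready_agree[OF s(1) 7(4)] 7(4) s by (auto simp: agree_def layered_def gaps_known_def)
    have d: "arrays s' ''dist'' i = L i + 1" using st(3) 7(2) by (simp add: layered_def)
    have upd: "fixed Z (s''\<lparr>vars := f\<rparr>) \<longleftrightarrow> fixed Z s''" for Z s'' f
      by (simp add: fixed_def slots_lt_def slot_cong[of "s''\<lparr>vars := f\<rparr>" s''])
    show ?case
    proof (cases "L i = 2")
      case True
      have p: "is_parents i (arrays s' ''PX'' i) (arrays s' ''PY'' i)"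
        using st(3) 7(2) True by (auto simp: layered_def)
      have eq: "?Z i u \<or> is_parents i (arrays s' ''PX'' i) (arrays s' ''PY'' i) \<and>
          u \<in> {arrays s' ''PX'' i, arrays s' ''PY'' i} \<longleftrightarrow> ?Z (Suc i) u" for u
        using p True st(5,6) by (auto simp: less_Suc_eq)
      have "runs w fix_body s' (60 * n + 200) (fixed (?Z (Suc i)))"
        using runs_fix_body[OF st(1,2) 7(3,2) True st(3,4) 7(5)] unfolding eq .
      then have "runs w fix_body s' (60 * n + 200) (\<lambda>s''. fixed (?Z (Suc i)) (s''\<lparr>vars := (vars s'')(''v'' := Suc i)\<rparr>))"
        unfolding upd .
      then have "runs w (If (Op Equal (Elem ''dist'' (Var ''v'')) (Const 3)) fix_body Skip) s'
          (1 + cost (Op Equal (Elem ''dist'' (Var ''v'')) (Const 3)) + (60 * n + 200))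
          (\<lambda>s''. fixed (?Z (Suc i)) (s''\<lparr>vars := (vars s'')(''v'' := Suc i)\<rparr>))"
        by (rule runs_If) (use True d 7(3) in simp_all)
      then show ?thesis by (rule runs_mono) simp_all
    next
      case False
      have eq: "?Z i = ?Z (Suc i)" using False by (intro ext) (auto simp: less_Suc_eq)
      have "fixed (?Z (Suc i)) s'" using 7(5) unfolding eq .
      then have "runs w Skip s' 1 (\<lambda>s''. fixed (?Z (Suc i)) (s''\<lparr>vars := (vars s'')(''v'' := Suc i)\<rparr>))"
        by (intro runs_loopfree) (simp_all only: upd exec.simps loopfree.simps time_bound.simps order_refl)
      then have "runs w (If (Op Equal (Elem ''dist'' (Var ''v'')) (Const 3)) fix_body Skip) s'
          (1 + cost (Op Equal (Elem ''dist'' (Var ''v'')) (Const 3)) + 1)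
          (\<lambda>s''. fixed (?Z (Suc i)) (s''\<lparr>vars := (vars s'')(''v'' := Suc i)\<rparr>))"
        by (rule runs_If[rotated]) (use False d 7(3) in simp_all)
      then show ?thesis by (rule runs_mono) simp_all
    qed
  next
    case (8 s')
    \<comment> \<open>Each layer 1 path has a neighbour in layer 2 and is one of the two parents of
      that neighbour.\<close>
    have "?Z N u" if u: "u < N" "L u = 1" for u
    proof -
      obtain S where S: "S \<in> ncpaths n" "exchange S (W u)" "layer n S = 2"
        using layer2_ex[of "W u" n] u n by (auto simp: L_def)
      obtain v where v: "v < N" "W v = S" using W_ex[OF S(1)] by blast
      then have p: "is_parents v (arrays s ''PX'' v) (arrays s ''PY'' v)"
        using s(3) S by (auto simp: layered_def L_def)
      have "u \<in> {u. u < N \<and> exchange (W v) (W u) \<and> L u + 1 = L v}" using u v S by (simp add: L_def)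
      then show ?thesis using is_parents_nbrs[OF p v(1)] v S by (auto simp: L_def)
    qed
    then show ?case using 8(3) by (auto simp: fixed_def)
  next
    case 9
    then show ?case by (simp add: algebra_simps)
  qed (use s ready_N fits_N[of N] in \<open>auto simp: agree_def\<close>)
qed

text \<open>Layer 0 is treated apart: a hull path has a gap but no diagonal for its slot, so
  \<open>slots_ok\<close> cannot hold for it.\<close>

definition solved :: "(nat \<Rightarrow> bool) \<Rightarrow> state \<Rightarrow> bool" where
  "solved Z s \<longleftrightarrow> slots_lt s \<and>
     (\<forall>u<N. L u = 0 \<longrightarrow> (\<forall>g<n. slot n s u g = hull_slot u g)) \<and>
     (\<forall>u<N. L u \<noteq> 0 \<and> Z u \<longrightarrow> slots_ok n (W u) (slot n s u))"

lemma solved_cong: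
  assumes "solved Z s" "slots_lt s'"
    and "\<And>u g. u < N \<Longrightarrow> g < n \<Longrightarrow> L u = 0 \<or> Z u \<Longrightarrow> slot n s' u g = slot n s u g"
    and "\<And>u. u < N \<Longrightarrow> L u \<noteq> 0 \<Longrightarrow> Z' u \<Longrightarrow> \<not> Z u \<Longrightarrow> slots_ok n (W u) (slot n s' u)"
  shows "solved Z' s'"
  unfolding solved_def
proof (intro conjI allI impI)
  fix u assume u: "u < N" "L u \<noteq> 0 \<and> Z' u"
  show "slots_ok n (W u) (slot n s' u)"
  proof (cases "Z u")
    case True
    then have "slots_ok n (W u) (slot n s u)" using assms(1) u by (simp add: solved_def)
    then show ?thesis by (rule slots_ok_cong[rotated]) (use assms(3) u True in simp)
  qed (use assms(4) u in blast)
qed (use assms in \<open>auto simp: solved_def\<close>)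

lemma runs_merge_row:
  assumes s: "vars s ''n'' = n" "vars s ''v'' = v" "v < N" "gaps_known s" "slots_lt s"
    and XY: "arrays s ''PX'' v = X" "arrays s ''PY'' v = Y" "X < N" "Y < N" "X \<noteq> v" "Y \<noteq> v"
  shows "runs w merge_row s (100 * n + 20)
    (\<lambda>s'. slots_lt s' \<and> (\<forall>u<N. \<forall>g<n. slot n s' u g =
      (if u = v then slot n s (if g \<in> gaps n (W X) then X else Y) g else slot n s u g)))"
  unfolding merge_row_def
proof (rule runs_For[where l = 0 and h = n and B = "\<lambda>_. 60" and
      I = "\<lambda>i s'. slots_lt s' \<and> (\<forall>u<N. \<forall>g<n. slot n s' u g =
      (if u = v \<and> g < i then slot n s (if g \<in> gaps n (W X) then X else Y) g else slot n s u g))"], goal_cases)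
  case 3
  then show ?case by (rule fits_N) (use n_le_N in simp)
next
  case 6
  then show ?case using s(5) by (simp add: slots_lt_def slot_def)
next
  case (7 i s')
  define z where "z = (if i \<in> gaps n (W X) then X else Y)"
  have z: "z < N" "z \<noteq> v" using XY by (auto simp: z_def)
  have st: "vars s' ''n'' = n" "vars s' ''v'' = v" "gaps_known s'" "arrays s' ''PX'' v = X" "arrays s' ''PY'' v = Y"
    using 7(4) s XY by (auto simp: agree_def gaps_known_def)
  let ?s = "s'\<lparr>vars := (vars s')(''z'' := z)\<rparr>"
  have e0: "eval w (idx (Elem ''PX'' (Var ''v''))) s' = X * n + i"
    by (rule eval_idx) (use st 7 XY in simp_all)
  have ev: "eval w (idx (Var ''v'')) s'' = v * n + i" "eval w (idx (Var ''z'')) s'' = z * n + i"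
    if "vars s'' = vars ?s" for s''
    by (rule eval_idx; use st 7 s z that in simp)+
  have gp: "arrays s' ''gp'' (X * n + i) = 0 \<longleftrightarrow> i \<notin> gaps n (W X)" using st(3) XY(3) 7(2) by (auto simp: gaps_known_def)
  let ?s1 = "?s\<lparr>arrays := (arrays s')(''ea'' := (arrays s' ''ea'')(v * n + i := arrays s' ''ea'' (z * n + i)),
      ''eb'' := (arrays s' ''eb'')(v * n + i := arrays s' ''eb'' (z * n + i)))\<rparr>"
  have ex1: "exec w (If (Elem ''gp'' (idx (Elem ''PX'' (Var ''v''))))
       (Assign ''z'' (Elem ''PX'' (Var ''v''))) (Assign ''z'' (Elem ''PY'' (Var ''v'')))) s' = ?s"
    using e0 gp st by (simp add: z_def)
  have ex: "exec w merge_cell s' = ?s1"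
    unfolding merge_cell_def exec.simps(4) ex1 using ev by simp
  have inj: "u * n + g = v * n + i \<longleftrightarrow> u = v \<and> g = i" if "g < n" for u g
    using index_inj[OF that 7(2)] .
  have lt: "slots_lt s'" and I: "\<And>u g. u < N \<Longrightarrow> g < n \<Longrightarrow> slot n s' u g =
      (if u = v \<and> g < i then slot n s (if g \<in> gaps n (W X) then X else Y) g else slot n s u g)"
    using 7(5) by auto
  show ?case
  proof (rule runs_loopfree)
    show "loopfree merge_cell" "time_bound merge_cell \<le> 60" by (simp_all add: merge_cell_def)
    have "slots_lt ?s1" using lt z 7(2) by (auto simp: slots_lt_def inj)
    moreover have "slot n ?s1 u g =
        (if u = v \<and> g < Suc i then slot n s (if g \<in> gaps n (W X) then X else Y) g else slot n s u g)"
      if ug: "u < N" "g < n" for u g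
    proof -
      have "slot n ?s1 u g = (if u = v \<and> g = i then slot n s' z i else slot n s' u g)"
        by (auto simp: slot_def inj[OF ug(2)])
      also have "slot n s' z i = slot n s z i" using I[OF z(1) 7(2)] z(2) by simp
      finally have eq: "slot n ?s1 u g = (if u = v \<and> g = i then slot n s z i else slot n s' u g)" .
      show ?thesis
      proof (cases "u = v \<and> g = i")
        case True
        then show ?thesis unfolding eq if_P[OF True] by (simp add: z_def)
      next
        case False
        then have "u = v \<and> g < Suc i \<longleftrightarrow> u = v \<and> g < i" by auto
        then show ?thesis unfolding eq if_not_P[OF False] I[OF ug] by simp
      qed
    qed
    ultimately show "slots_lt (exec w merge_cell s'\<lparr>vars := (vars (exec w merge_cell s'))(''g'' := Suc i)\<rparr>) \<and>
      (\<forall>u<N. \<forall>g<n. slot n (exec w merge_cell s'\<lparr>vars := (vars (exec w merge_cell s'))(''g'' := Suc i)\<rparr>) u g =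
      (if u = v \<and> g < Suc i then slot n s (if g \<in> gaps n (W X) then X else Y) g else slot n s u g))"
      unfolding ex by (simp add: slots_lt_def slot_def)
  qed
qed (use s in \<open>auto simp: agree_def\<close>)

lemma runs_merge:
  assumes s: "ready s" "vars s ''n'' = n" "layered s" "gaps_known s" "fixed (\<lambda>_. True) s"
  shows "runs w (visit_layers 3 merge_row) s (N * (100 * n + 20) + n * (60 * N + 60) + 60) (solved (\<lambda>_. True))"
proof -
  let ?Z = "\<lambda>d v u. L u + 1 < d \<or> L u + 1 = d \<and> u < v"
  let ?J = "\<lambda>d v s. layered s \<and> gaps_known s \<and> solved (?Z d v) s"
  have "runs w (visit_layers 3 merge_row) s (N * (100 * n + 20) + n * (60 * N + 60) + 60) (?J (Suc n) 0)"
  proof (rule runs_visit_layers[where J = ?J, OF s(1,2)], goal_cases)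
    case 2
    \<comment> \<open>Round 3 treats layer 2, so at its start only layers 0 and 1 have to be
      finished.\<close>
    have "L u = 1" if "L u \<noteq> 0" "?Z 3 0 u" for u using that by auto
    then have "solved (?Z 3 0) s" using s(5) unfolding fixed_def solved_def by auto
    then show ?case using s by blast
  next
    case (9 d v s s')
    then show ?case by (simp add: layered_def gaps_known_def solved_def slots_lt_def slot_cong[of s' s])
  next
    case (10 d v s')
    then show ?case by (auto simp: layered_def)
  next
    case (11 d v s')
    then have "?Z d v u = ?Z d (Suc v) u" for u by (auto simp: less_Suc_eq)
    then show ?case using 11(3) by simp
  next
    case (12 v s')
    define X Y where XY_def: "X = arrays s' ''PX'' v" "Y = arrays s' ''PY'' v"
    have Lv: "2 \<le> L v" using 12(1) by simp
    have layer: "layered s'" and gk: "gaps_known s'" and so: "solved (?Z (L v + 1) v) s'" using 12(3) by blast+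
    have p: "is_parents v X Y" using layer Lv 12(2) by (auto simp: layered_def XY_def)
    then have XY: "X < N" "Y < N" "X \<noteq> Y" "L X + 1 = L v" "L Y + 1 = L v" "exchange (W v) (W X)" "exchange (W v) (W Y)"
      by (auto simp: is_parents_def)
    have nv: "X \<noteq> v" "Y \<noteq> v" using XY by auto
    have lt: "slots_lt s'" using so by (simp add: solved_def)
    have okX: "slots_ok n (W X) (slot n s' X)" and okY: "slots_ok n (W Y) (slot n s' Y)"
      using so XY Lv by (auto simp: solved_def)
    have "runs w merge_row s' (100 * n + 20)
      (\<lambda>s''. slots_lt s'' \<and> (\<forall>u<N. \<forall>g<n. slot n s'' u g =
        (if u = v then slot n s' (if g \<in> gaps n (W X) then X else Y) g else slot n s' u g)))"
      by (rule runs_merge_row) (use 12 gk lt XY nv in \<open>simp_all add: XY_def\<close>)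
    from runs_agree[OF this] show ?case
    proof (rule runs_mono)
      fix s'' assume s'': "(slots_lt s'' \<and> (\<forall>u<N. \<forall>g<n. slot n s'' u g =
          (if u = v then slot n s' (if g \<in> gaps n (W X) then X else Y) g else slot n s' u g))) \<and>
        agree (mod_vars merge_row) (mod_arrays merge_row) s' s''"
      have "layered s''" "gaps_known s''" using s'' layer gk by (auto simp: agree_def layered_def gaps_known_def)
      moreover have "solved (?Z (L v + 1) (Suc v)) s''"
      proof (rule solved_cong[OF so])
        show "slots_lt s''" using s'' by blast
        show "slot n s'' u g = slot n s' u g" if "u < N" "g < n" "L u = 0 \<or> ?Z (L v + 1) v u" for u g
        proof -
          have "u \<noteq> v" using that(3) Lv by auto
          then show ?thesis using s'' that by simp
        qed
        fix u assume u: "u < N" "?Z (L v + 1) (Suc v) u" "\<not> ?Z (L v + 1) v u"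
        then have uv: "u = v" by (auto simp: less_Suc_eq)
        show "slots_ok n (W u) (slot n s'' u)"
          unfolding uv
        proof (rule slots_merge[OF W_in[OF 12(2)] _ _ W_in[OF XY(1)] XY(6) _ W_in[OF XY(2)] XY(7) _ _ okX okY])
          show "2 \<le> layer n (W v)" "layer n (W X) + 1 = layer n (W v)" "layer n (W Y) + 1 = layer n (W v)"
            using Lv XY by (simp_all add: L_def)
          show "3 \<le> n" using n by simp
          show "W X \<noteq> W Y" using XY W_eq by auto
          show "slot n s'' v g = (if g \<in> gaps n (W X) then slot n s' X g else slot n s' Y g)" if "g < n" for g
            using s'' that 12(2) by simp
        qed
      qed
      ultimately show "?J (L v + 1) (Suc v) s''" by blast
    qed simp
  next
    case (13 d s')
    have "?Z d N u \<longleftrightarrow> ?Z (Suc d) 0 u" if "u < N" for u using that by auto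
    then have "solved (?Z (Suc d) 0) s'" using 13(3) by (simp add: solved_def)
    then show ?case using 13(3) by blast
  qed (use n in simp_all)
  then show ?thesis
  proof (rule runs_mono)
    fix s' assume J: "?J (Suc n) 0 s'"
    have "?Z (Suc n) 0 u" if "u < N" for u using L_less[OF that] by simp
    then show "solved (\<lambda>_. True) s'" using J by (simp add: solved_def)
  qed simp
qed

text \<open>A row has \<open>n\<close> slots for \<open>n - 1\<close> edges, so one edge occurs
  twice, which is harmless because only the set of entries counts.\<close>

lemma solved_slots:
  assumes s: "solved (\<lambda>_. True) s" and v: "v < N"
  shows "slot n s v ` {..<n} = W v"
proof (cases "L v = 0")
  case False
  then show ?thesis using s v slots_image by (simp add: solved_def)
next
  case True
  then obtain k where k: "k < n" "W v = hull_path n k" using lay_0_ex[of "W v" n] v n by (auto simp: L_def)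
  have n3: "3 \<le> n" using n by simp
  have g: "gaps n (W v) = {k}" using gaps_Hp[OF k(1) n3] k(2) by simp
  have sl: "slot n s v g = (if g = k then hull_edge n (next_pt n g) else hull_edge n g)" if "g < n" for g
    using s v True that g by (simp add: solved_def hull_slot_def)
  have "slot n s v ` {..<n} = slot n s v ` ({..<n} - {k}) \<union> {slot n s v k}" using k(1) by blast
  also have "slot n s v ` ({..<n} - {k}) = hull_edge n ` ({..<n} - {k})" using sl by (intro image_cong) auto
  also have "\<dots> = W v"
  proof -
    have "hull_edge n ` ({..<n} - {k}) = hull_edge n ` {..<n} - hull_edge n ` {k}"
      by (rule inj_on_image_set_diff[where C = "{..<n}"]) (use k(1) he_inj[OF n3] in \<open>auto simp: inj_on_def\<close>)
    then show ?thesis by (simp add: k(2) hull_path_def hull_edges_def)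
  qed
  \<comment> \<open>The slot of the gap holds the next hull edge, which differs from the missing one
    and so belongs to the path.\<close>
  also have "W v \<union> {slot n s v k} = W v"
  proof -
    have "hull_edge n (next_pt n k) \<in> W v"
      using k nx_lt[OF k(1)] nx_neq[of n k] he_inj[OF n3 nx_lt[OF k(1)] k(1)] n3 by (simp add: hull_path_def)
    then show ?thesis using sl[OF k(1)] by auto
  qed
  finally show ?thesis .
qed

lemma output_pairs_slots:
  assumes "solved (\<lambda>_. True) s" "offsets_ok s" "v < N"
  shows "output_pairs s v = (\<lambda>g. (arrays s ''ea'' (v * n + g), arrays s ''eb'' (v * n + g))) ` {..<n}"
    and "output_pairs s v \<subseteq> {..<n} \<times> {..<n}"
    and "{{i, j} | i j. (i, j) \<in> output_pairs s v} = W v"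
proof -
  have o: "arrays s ''eoff'' v = v * n" "arrays s ''eoff'' (Suc v) = v * n + n"
    using assms by (auto simp: offsets_ok_def)
  show eq: "output_pairs s v = (\<lambda>g. (arrays s ''ea'' (v * n + g), arrays s ''eb'' (v * n + g))) ` {..<n}"
  proof -
    have "{k. v * n \<le> k \<and> k < v * n + n} = (+) (v * n) ` {..<n}"
      by (metis image_add_atLeastLessThan' atLeast0LessThan atLeastLessThan_def add.commute
          add.right_neutral Collect_conj_eq atLeast_def lessThan_def image_add_atLeastLessThan)
    then show ?thesis unfolding output_pairs_def o by (auto simp: set_eq_iff image_iff)
  qed
  show "output_pairs s v \<subseteq> {..<n} \<times> {..<n}"
    unfolding eq using assms(1,3) by (auto simp: solved_def slots_lt_def)
  have "{{i, j} | i j. (i, j) \<in> output_pairs s v} = slot n s v ` {..<n}"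
    unfolding eq slot_def by auto
  then show "{{i, j} | i j. (i, j) \<in> output_pairs s v} = W v" using solved_slots assms by simp
qed

end

section \<open>The whole program\<close>

definition label_phase :: com where
  "label_phase = Seq max_degree (Seq mark_hull (Seq (visit_layers 1 layer_body) (Seq mark_pairs label_hull)))"

definition edge_phase :: com where
  "edge_phase = Seq (visit_layers 2 gap_body) (Seq init_slots (Seq fix_slots (visit_layers 3 merge_row)))"

definition recover :: com where
  "recover = Seq label_phase edge_phase"

lemma mod_max_degree [simp]: "mod_vars max_degree = {''v'', ''m''}" "mod_arrays max_degree = {}"
  by (auto simp: max_degree_def)

lemma mod_mark_hull [simp]: "mod_vars mark_hull = {''v'', ''n''}" "mod_arrays mark_hull = {''dist''}"
  by (auto simp: mark_hull_def)

lemma mod_visit_layers [simp]: "mod_vars (visit_layers d body) = {''d'', ''v''} \<union> mod_vars body"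
    "mod_arrays (visit_layers d body) = mod_arrays body"
  by (auto simp: visit_layers_def)

lemma mod_mark_pairs [simp]: "mod_vars mark_pairs = {''v''}" "mod_arrays mark_pairs = {''T''}"
  by (auto simp: mark_pairs_def)

lemma mod_label_hull [simp]: "mod_vars label_hull = {''cur'', ''j'', ''x'', ''nx''}"
    "mod_arrays label_hull = {''lab'', ''gp''}"
  by (auto simp: label_hull_def)

lemma mod_init_slots [simp]: "mod_vars init_slots = {''v'', ''g''}"
    "mod_arrays init_slots = {''eoff'', ''ea'', ''eb''}"
  by (auto simp: init_slots_def)

lemma mod_fix_slots [simp]: "mod_vars fix_slots = {''v'', ''X'', ''Y'', ''g'', ''s'', ''a'', ''b'', ''t'', ''p'', ''q''}"
    "mod_arrays fix_slots = {''ea'', ''eb''}"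
  by (auto simp: fix_slots_def)

lemma agree_var: "agree V B s s' \<Longrightarrow> x \<notin> V \<Longrightarrow> vars s' x = vars s x"
  by (simp add: agree_def)

lemma agree_array: "agree V B s s' \<Longrightarrow> a \<notin> B \<Longrightarrow> arrays s' a = arrays s a"
  by (simp add: agree_def)

lemma runs_Seq_agree:
  assumes "runs w c s t R"
    and "\<And>s'. R s' \<Longrightarrow> agree (mod_vars c) (mod_arrays c) s s' \<Longrightarrow> runs w d s' u Q"
  shows "runs w (Seq c d) s (t + u) Q"
  by (rule runs_Seq[OF runs_agree[OF assms(1)]]) (use assms(2) in blast)

context numbered_paths
begin

lemma layered_agree:
  "layered s \<Longrightarrow> agree V B s s' \<Longrightarrow> ''dist'' \<notin> B \<Longrightarrow> ''PX'' \<notin> B \<Longrightarrow> ''PY'' \<notin> B \<Longrightarrow> layered s'"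
  unfolding layered_def agree_def by simp

lemma gaps_known_agree: "gaps_known s \<Longrightarrow> agree V B s s' \<Longrightarrow> ''gp'' \<notin> B \<Longrightarrow> gaps_known s'"
  unfolding gaps_known_def agree_def by simp

lemma offsets_ok_agree: "offsets_ok s \<Longrightarrow> agree V B s s' \<Longrightarrow> ''eoff'' \<notin> B \<Longrightarrow> offsets_ok s'"
  unfolding offsets_ok_def agree_def by simp

lemma runs_edge_phase:
  assumes s: "ready s" "vars s ''n'' = n" "layered s"
    and gp: "\<forall>v<N. \<forall>g<n. arrays s ''gp'' (v * n + g) = of_bool (L v = 0 \<and> g \<in> gaps n (W v))"
  shows "runs w edge_phase s ((N * (60 * n + 20) + n * (60 * N + 60) + 60) + ((N * (100 * n + 60) + 40) +
      ((N * (60 * n + 250) + 20) + (N * (100 * n + 20) + n * (60 * N + 60) + 60))))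
    (\<lambda>s. solved (\<lambda>_. True) s \<and> offsets_ok s)"
  unfolding edge_phase_def
proof (rule runs_Seq_agree[OF runs_gaps[OF s gp]])
  fix s1 assume 1: "gaps_known s1" and a1: "agree (mod_vars (visit_layers 2 gap_body)) (mod_arrays (visit_layers 2 gap_body)) s s1"
  have r1: "ready s1" "vars s1 ''n'' = n" "layered s1"
    using ready_agree[OF s(1) a1] agree_var[OF a1, of "''n''"] layered_agree[OF s(3) a1] s(2) by simp_all
  show "runs w (Seq init_slots (Seq fix_slots (visit_layers 3 merge_row))) s1 ((N * (100 * n + 60) + 40) +
      ((N * (60 * n + 250) + 20) + (N * (100 * n + 20) + n * (60 * N + 60) + 60)))
      (\<lambda>s. solved (\<lambda>_. True) s \<and> offsets_ok s)"
  proof (rule runs_Seq_agree[OF runs_init_slots[OF r1(1,2) 1]])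
    fix s2 assume 2: "slots_init s2 \<and> offsets_ok s2" and a2: "agree (mod_vars init_slots) (mod_arrays init_slots) s1 s2"
    have r2: "ready s2" "vars s2 ''n'' = n" "layered s2" "gaps_known s2"
      using ready_agree[OF r1(1) a2] agree_var[OF a2, of "''n''"] layered_agree[OF r1(3) a2] r1(2)
        gaps_known_agree[OF 1 a2] by simp_all
    show "runs w (Seq fix_slots (visit_layers 3 merge_row)) s2
      ((N * (60 * n + 250) + 20) + (N * (100 * n + 20) + n * (60 * N + 60) + 60))
      (\<lambda>s. solved (\<lambda>_. True) s \<and> offsets_ok s)"
    proof (rule runs_Seq_agree[OF runs_fix_slots[OF r2]])
      show "slots_init s2" using 2 by blast
      fix s3 assume 3: "fixed (\<lambda>_. True) s3" and a3: "agree (mod_vars fix_slots) (mod_arrays fix_slots) s2 s3"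
      have r3: "ready s3" "vars s3 ''n'' = n" "layered s3" "gaps_known s3" "offsets_ok s3"
        using ready_agree[OF r2(1) a3] agree_var[OF a3, of "''n''"] layered_agree[OF r2(3) a3] r2(2)
          gaps_known_agree[OF r2(4) a3] offsets_ok_agree[OF conjunct2[OF 2] a3] by simp_all
      show "runs w (visit_layers 3 merge_row) s3 (N * (100 * n + 20) + n * (60 * N + 60) + 60)
        (\<lambda>s. solved (\<lambda>_. True) s \<and> offsets_ok s)"
      proof (rule runs_mono[OF runs_agree[OF runs_merge[OF r3(1-4) 3]]])
        fix s4 assume 4: "solved (\<lambda>_. True) s4 \<and>
          agree (mod_vars (visit_layers 3 merge_row)) (mod_arrays (visit_layers 3 merge_row)) s3 s4"
        then show "solved (\<lambda>_. True) s4 \<and> offsets_ok s4"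
          using offsets_ok_agree[OF r3(5) conjunct2[OF 4]] by simp
      qed simp
    qed
  qed
qed

lemma runs_label_phase:
  "runs w label_phase (input_state A) ((60 * N + 20) + ((60 * N + 20) + ((N * (300 * n + 40) + n * (60 * N + 60) + 60) +
      ((60 * N + 20) + (n * (60 * N + 80) + 20)))))
    (\<lambda>s. ready s \<and> vars s ''n'' = n \<and> layered s \<and>
      (\<exists>hs. length hs = n \<and> labelled hs s \<and> successively hull_step hs))"
  unfolding label_phase_def
proof (rule runs_Seq_agree[OF runs_max_degree[OF ready_input]])
  show "vars (input_state A) ''m'' = 0" by (simp add: input_state_def)
  fix s1 assume 1: "vars s1 ''m'' = 3 * n - 7"
    and a1: "agree (mod_vars max_degree) (mod_arrays max_degree) (input_state A) s1"
  have r1: "ready s1" "vars s1 ''n'' = 0" "\<And>v. arrays s1 ''dist'' v = 0" "arrays s1 = arrays (input_state A)"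
  proof -
    show "ready s1" using ready_agree[OF ready_input a1] by simp
    show arr: "arrays s1 = arrays (input_state A)" by (rule ext) (rule agree_array[OF a1], simp)
    show "vars s1 ''n'' = 0" using agree_var[OF a1, of "''n''"] by (simp add: input_state_def)
    show "arrays s1 ''dist'' v = 0" for v unfolding arr by (simp add: input_state_def)
  qed
  show "runs w (Seq mark_hull (Seq (visit_layers 1 layer_body) (Seq mark_pairs label_hull))) s1
    ((60 * N + 20) + ((N * (300 * n + 40) + n * (60 * N + 60) + 60) + ((60 * N + 20) + (n * (60 * N + 80) + 20))))
    (\<lambda>s. ready s \<and> vars s ''n'' = n \<and> layered s \<and>
      (\<exists>hs. length hs = n \<and> labelled hs s \<and> successively hull_step hs))"
  proof (rule runs_Seq_agree[OF runs_mark_hull[OF r1(1) 1 r1(2,3)]])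
    fix s2 assume 2: "vars s2 ''n'' = n \<and> (\<forall>v<N. arrays s2 ''dist'' v = of_bool (L v = 0))"
      and a2: "agree (mod_vars mark_hull) (mod_arrays mark_hull) s1 s2"
    have r2: "ready s2" "vars s2 ''n'' = n" "\<forall>v<N. arrays s2 ''dist'' v = of_bool (L v = 0)"
      using ready_agree[OF r1(1) a2] 2 by simp_all
    show "runs w (Seq (visit_layers 1 layer_body) (Seq mark_pairs label_hull)) s2
      ((N * (300 * n + 40) + n * (60 * N + 60) + 60) + ((60 * N + 20) + (n * (60 * N + 80) + 20)))
      (\<lambda>s. ready s \<and> vars s ''n'' = n \<and> layered s \<and>
        (\<exists>hs. length hs = n \<and> labelled hs s \<and> successively hull_step hs))"
    proof (rule runs_Seq_agree[OF runs_layers[OF r2]])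
      fix s3 assume 3: "layered s3"
        and a3: "agree (mod_vars (visit_layers 1 layer_body)) (mod_arrays (visit_layers 1 layer_body)) s2 s3"
      have r3: "ready s3" "vars s3 ''n'' = n" "\<forall>x. arrays s3 ''T'' x = 0" "\<forall>x. arrays s3 ''lab'' x = 0"
          "\<forall>x. arrays s3 ''gp'' x = 0"
        using ready_agree[OF r2(1) a3] agree_var[OF a3, of "''n''"] r2(2) r1(4)
          agree_array[OF a2] agree_array[OF a3]
        by (simp_all add: input_state_def)
      show "runs w (Seq mark_pairs label_hull) s3 ((60 * N + 20) + (n * (60 * N + 80) + 20))
        (\<lambda>s. ready s \<and> vars s ''n'' = n \<and> layered s \<and>
          (\<exists>hs. length hs = n \<and> labelled hs s \<and> successively hull_step hs))"
      proof (rule runs_Seq_agree[OF runs_mark_pairs[OF r3(1) 3 r3(3)]])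
        fix s4 assume 4: "pairs_marked s4" and a4: "agree (mod_vars mark_pairs) (mod_arrays mark_pairs) s3 s4"
        have r4: "ready s4" "vars s4 ''n'' = n" "layered s4" "\<forall>x. arrays s4 ''lab'' x = 0" "\<forall>x. arrays s4 ''gp'' x = 0"
          using ready_agree[OF r3(1) a4] agree_var[OF a4, of "''n''"] r3 layered_agree[OF 3 a4]
            agree_array[OF a4]
          by simp_all
        show "runs w label_hull s4 (n * (60 * N + 80) + 20)
          (\<lambda>s. ready s \<and> vars s ''n'' = n \<and> layered s \<and>
            (\<exists>hs. length hs = n \<and> labelled hs s \<and> successively hull_step hs))"
        proof (rule runs_mono[OF runs_agree[OF runs_label_hull[OF r4(1,2,3) 4 r4(4,5)]]])
          fix s5 assume 5: "(\<exists>hs. length hs = n \<and> labelled hs s5 \<and> successively hull_step hs) \<and>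
            agree (mod_vars label_hull) (mod_arrays label_hull) s4 s5"
          note a5 = conjunct2[OF this]
          show "ready s5 \<and> vars s5 ''n'' = n \<and> layered s5 \<and>
            (\<exists>hs. length hs = n \<and> labelled hs s5 \<and> successively hull_step hs)"
            using 5 ready_agree[OF r4(1) a5] agree_var[OF a5, of "''n''"] r4(2) layered_agree[OF r4(3) a5]
            by simp
        qed simp
      qed
    qed
  qed
qed

text \<open>In this form parenthood depends on \<open>A\<close> and the layers only, so it does not
  change when the paths are renamed.\<close>

lemma is_parents_iff:
  "v < N \<Longrightarrow> is_parents v X Y \<longleftrightarrow>
    X \<in> set (A ! v) \<and> Y \<in> set (A ! v) \<and> X \<noteq> Y \<and> L X + 1 = L v \<and> L Y + 1 = L v"
  using nbrs by (auto simp: is_parents_def)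

text \<open>The labelling is analysed with the given \<open>W\<close>, the recovery of the edges
  with the renamed paths from \<open>relabel\<close>. Both concern the same state, since neither the
  program nor the memory refers to \<open>W\<close>.\<close>

lemma runs_recover:
  "runs w recover (input_state A) (2000 * (N * n))
    (\<lambda>s. \<exists>\<tau>. hull_aut n \<tau> \<and> (\<forall>v<N. output_pairs s v \<subseteq> {..<n} \<times> {..<n} \<and>
      {{i, j} | i j. (i, j) \<in> output_pairs s v} = (`) \<tau> ` W v))"
proof -
  let ?P = "\<lambda>s. \<exists>\<tau>. hull_aut n \<tau> \<and> (\<forall>v<N. output_pairs s v \<subseteq> {..<n} \<times> {..<n} \<and>
      {{i, j} | i j. (i, j) \<in> output_pairs s v} = (`) \<tau> ` W v)"
  let ?t1 = "(60 * N + 20) + ((60 * N + 20) + ((N * (300 * n + 40) + n * (60 * N + 60) + 60) +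
      ((60 * N + 20) + (n * (60 * N + 80) + 20))))"
  let ?t2 = "(N * (60 * n + 20) + n * (60 * N + 60) + 60) + ((N * (100 * n + 60) + 40) +
      ((N * (60 * n + 250) + 20) + (N * (100 * n + 20) + n * (60 * N + 60) + 60)))"
  have "runs w recover (input_state A) (?t1 + ?t2) ?P"
    unfolding recover_def
  proof (rule runs_Seq[OF runs_label_phase])
    fix s assume s: "ready s \<and> vars s ''n'' = n \<and> layered s \<and>
      (\<exists>hs. length hs = n \<and> labelled hs s \<and> successively hull_step hs)"
    then obtain hs where hs: "length hs = n" "labelled hs s" "successively hull_step hs" by blast
    obtain \<tau> where \<tau>: "hull_aut n \<tau>" "numbered_paths n N w (\<lambda>v. (`) \<tau> ` W v) A"
      "\<And>v. v < N \<Longrightarrow> layer n ((`) \<tau> ` W v) = L v"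
      "\<forall>v<N. \<forall>g<n. arrays s ''gp'' (v * n + g) = of_bool (L v = 0 \<and> g \<in> gaps n ((`) \<tau> ` W v))"
      using relabel[OF hs(2,1,3)] by blast
    interpret R: numbered_paths n N w "\<lambda>v. (`) \<tau> ` W v" A by (rule \<tau>(2))
    have L: "R.L v = L v" if "v < N" for v using \<tau>(3)[OF that] by (simp add: R.L_def)
    have "R.is_parents v X Y \<longleftrightarrow> is_parents v X Y" if v: "v < N" for v X Y
    proof (cases "X \<in> set (A ! v) \<and> Y \<in> set (A ! v)")
      case True
      have XY: "X < N" "Y < N" using True nbr_L[OF v] by blast+
      show ?thesis
        unfolding R.is_parents_iff[OF v] is_parents_iff[OF v] L[OF v] L[OF XY(1)] L[OF XY(2)] ..
    next
      case False
      then show ?thesis unfolding R.is_parents_iff[OF v] is_parents_iff[OF v] by blast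
    qed
    then have layer: "R.layered s" using s L by (simp add: R.layered_def layered_def)
    have "runs w edge_phase s ?t2 (\<lambda>s. R.solved (\<lambda>_. True) s \<and> R.offsets_ok s)"
    proof (rule R.runs_edge_phase)
      show "ready s" "vars s ''n'' = n" using s by blast+
      show "R.layered s" by (rule layer)
      show "\<forall>v<N. \<forall>g<n. arrays s ''gp'' (v * n + g) = of_bool (R.L v = 0 \<and> g \<in> gaps n ((`) \<tau> ` W v))"
        by (intro allI impI) (simp only: L \<tau>(4)[rule_format])
    qed
    then show "runs w edge_phase s ?t2 ?P"
    proof (rule runs_mono)
      fix s' assume "R.solved (\<lambda>_. True) s' \<and> R.offsets_ok s'"
      then have "\<forall>v<N. output_pairs s' v \<subseteq> {..<n} \<times> {..<n} \<and>
        {{i, j} | i j. (i, j) \<in> output_pairs s' v} = (`) \<tau> ` W v"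
        using R.output_pairs_slots(2,3)[of s'] by simp
      then show "?P s'" using \<tau>(1) by (intro exI[of _ \<tau>] conjI)
    qed (rule order_refl)
  qed
  moreover have "?t1 + ?t2 \<le> 2000 * (N * n)"
  proof -
    \<comment> \<open>Since \<open>5 \<le> n\<close> and \<open>8 \<le> N\<close>, the lower-order
      terms can be absorbed into multiples of \<open>N * n\<close>.\<close>
    have "5 * N \<le> N * n" "8 * n \<le> N * n" "40 \<le> N * n"
      using n N_ge mult_le_mono[of 8 N 5 n] by (auto simp: mult.commute)
    moreover have "?t1 + ?t2 = 860 * (N * n) + 570 * N + 260 * n + 320"
      by (simp add: algebra_simps)
    ultimately show ?thesis by linarith
  qed
  ultimately show ?thesis by (rule runs_mono) simp_all
qed

end

section \<open>Points in convex position\<close>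

lemma orient_rot: "orient b c a = orient a b c" and orient_swap: "orient a c b = - orient a b c"
  by (simp_all add: orient_def algebra_simps)

lemma orient_affine: "orient a b ((1 - u) *\<^sub>R c + u *\<^sub>R d) = (1 - u) * orient a b c + u * orient a b d"
  by (simp add: orient_def algebra_simps)

lemma orient_open_segment:
  assumes "x \<in> open_segment a b"
  shows "orient a b x = 0"
proof -
  obtain u where u: "x = (1 - u) *\<^sub>R a + u *\<^sub>R b" using assms by (auto simp: in_segment)
  show ?thesis unfolding u orient_affine by (simp add: orient_def)
qed

text \<open>A common point would have orientation 0 with respect to \<open>a\<close> and
  \<open>b\<close>. But it is also a proper convex combination of \<open>c\<close> and
  \<open>d\<close>, whose orientations have no opposite signs and are not both 0.\<close>

lemma open_segments_disjoint:
  assumes "0 \<le> orient a b c \<and> 0 \<le> orient a b d \<or> orient a b c \<le> 0 \<and> orient a b d \<le> 0"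
    and "orient a b c \<noteq> 0 \<or> orient a b d \<noteq> 0"
  shows "open_segment a b \<inter> open_segment c d = {}"
proof (rule ccontr)
  assume "\<not> ?thesis"
  then obtain x where x: "x \<in> open_segment a b" "x \<in> open_segment c d" by blast
  obtain u where u: "0 < u" "u < 1" "x = (1 - u) *\<^sub>R c + u *\<^sub>R d" using x(2) by (auto simp: in_segment)
  have "(1 - u) * orient a b c + u * orient a b d = 0"
    using orient_open_segment[OF x(1)] unfolding u(3) orient_affine .
  moreover have "0 < (1 - u) * orient a b c + u * orient a b d"
    if "0 \<le> orient a b c" "0 \<le> orient a b d"
    using that u assms(2) by (metis add_nonneg_pos add_pos_nonneg diff_gt_0_iff_gt less_eq_real_def mult_nonneg_nonneg mult_pos_pos)
  moreover have "(1 - u) * orient a b c + u * orient a b d < 0"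
    if "orient a b c \<le> 0" "orient a b d \<le> 0"
  proof -
    have "0 < (1 - u) * (- orient a b c) + u * (- orient a b d)"
      using that u assms(2)
      by (metis add_nonneg_pos add_pos_nonneg diff_gt_0_iff_gt less_eq_real_def mult_nonneg_nonneg
          mult_pos_pos neg_0_less_iff_less neg_0_le_iff_le)
    then show ?thesis by (simp add: algebra_simps)
  qed
  ultimately show False using assms(1) by linarith
qed

lemma open_segments_meet:
  assumes "orient a b c * orient a b d < 0" "orient c d a * orient c d b < 0"
  shows "open_segment a b \<inter> open_segment c d \<noteq> {}"
proof -
  \<comment> \<open>By Cramer's rule, \<open>t\<close> and \<open>u\<close> are the parameters of
    the point where the two lines meet. The sign conditions put both strictly between 0 and
    1.\<close>
  define D where "D = orient c d a - orient c d b"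
  have D: "D = - (orient a b c - orient a b d)" by (simp add: D_def orient_def algebra_simps)
  define t u where "t = orient c d a / D" and "u = - orient a b c / D"
  have frac: "0 < p / (p - q) \<and> p / (p - q) < 1" if "p * q < 0" for p q :: real
    using that by (auto simp: mult_less_0_iff field_simps)
  have t: "0 < t" "t < 1" using frac[OF assms(2)] by (simp_all add: t_def D_def)
  have u: "0 < u" "u < 1"
  proof -
    have "u = orient a b c / (orient a b c - orient a b d)" unfolding u_def D by (rule minus_divide_divide)
    then show "0 < u" "u < 1" using frac[OF assms(1)] by simp_all
  qed
  have D0: "D \<noteq> 0" using t by (auto simp: t_def)
  have "((1 - t) *\<^sub>R a + t *\<^sub>R b) $ i = ((1 - u) *\<^sub>R c + u *\<^sub>R d) $ i" if "i = 1 \<or> i = 2" for i :: 2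
  proof -
    have Dt: "D * t = orient c d a" "D * u = - orient a b c" using D0 by (simp_all add: t_def u_def)
    have "D * (((1 - t) *\<^sub>R a + t *\<^sub>R b) $ i) = D * a $ i + (D * t) * (b $ i - a $ i)"
      by (simp add: algebra_simps)
    also have "\<dots> = D * c $ i + (D * u) * (d $ i - c $ i)"
      unfolding Dt unfolding D_def orient_def using that by (auto simp: algebra_simps)
    also have "\<dots> = D * (((1 - u) *\<^sub>R c + u *\<^sub>R d) $ i)" by (simp add: algebra_simps)
    finally show ?thesis using D0 by simp
  qed
  then have eq: "(1 - t) *\<^sub>R a + t *\<^sub>R b = (1 - u) *\<^sub>R c + u *\<^sub>R d"
    unfolding vec_eq_iff forall_2 by blast
  have "a \<noteq> b" "c \<noteq> d" using assms by (auto simp: orient_def algebra_simps)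
  then have "(1 - t) *\<^sub>R a + t *\<^sub>R b \<in> open_segment a b" "(1 - t) *\<^sub>R a + t *\<^sub>R b \<in> open_segment c d"
    using t u eq by (auto simp: in_segment)
  then show ?thesis by blast
qed

lemma crossing_doubleton:
  "crossing {a, b} {c, d} \<longleftrightarrow> {a, b} \<noteq> {c, d} \<and> open_segment a b \<inter> open_segment c d \<noteq> {}"
proof -
  have "open_segment a b = open_segment a' b'" if "{a, b} = {a', b'}" for a b a' b' :: point
    using that by (auto simp: doubleton_eq_iff open_segment_commute)
  then show ?thesis unfolding crossing_def by metis
qed

lemma path_edges_pedges: "path_edges xs = pedges xs"
proof (induction xs rule: pedges.induct)
  case (1 x y zs)
  have "path_edges (x # y # zs) = insert {x, y} (path_edges (y # zs))"
  proof (intro equalityI subsetI)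
    fix e assume "e \<in> path_edges (x # y # zs)"
    then obtain i where i: "e = {(x # y # zs) ! i, (x # y # zs) ! Suc i}" "Suc i < length (x # y # zs)"
      by (auto simp: path_edges_def)
    then show "e \<in> insert {x, y} (path_edges (y # zs))" by (cases i) (auto simp: path_edges_def)
  next
    fix e assume "e \<in> insert {x, y} (path_edges (y # zs))"
    then consider "e = {x, y}" | i where "e = {(y # zs) ! i, (y # zs) ! Suc i}" "Suc i < length (y # zs)"
      by (auto simp: path_edges_def)
    then show "e \<in> path_edges (x # y # zs)"
    proof cases
      case 1
      then show ?thesis unfolding path_edges_def by (intro CollectI exI[of _ 0]) simp
    next
      case 2
      then show ?thesis unfolding path_edges_def by (intro CollectI exI[of _ "Suc i"]) simp
    qed
  qed
  then show ?case using 1 by simp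
qed (auto simp: path_edges_def)

text \<open>Triples with increasing indices are counterclockwise by assumption; a cyclic shift keeps
  the orientation and a swap negates it. In particular no three points are collinear.\<close>

lemma orient_cyc:
  assumes ps: "ccw_order P ps" and ijk: "i < length ps" "j < length ps" "k < length ps"
    and ne: "i \<noteq> j" "j \<noteq> k" "i \<noteq> k"
  shows "0 < orient (ps ! i) (ps ! j) (ps ! k) \<longleftrightarrow> cyc i j k" "orient (ps ! i) (ps ! j) (ps ! k) \<noteq> 0"
proof -
  have o: "0 < orient (ps ! x) (ps ! y) (ps ! z)" if "x < y" "y < z" "z < length ps" for x y z
    using ps that by (auto simp: ccw_order_def)
  have pos: "0 < orient (ps ! x) (ps ! y) (ps ! z)"
    if "cyc x y z" "x < length ps" "y < length ps" "z < length ps" for x y z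
    using that(1) unfolding cyc_def
  proof (elim disjE conjE)
    assume "y < z" "z < x"
    then show ?thesis using o[of y z x] orient_rot that by simp
  next
    assume "z < x" "x < y"
    then show ?thesis using o[of z x y] orient_rot that by metis
  qed (use o that in blast)
  have "cyc i j k \<or> cyc i k j" using ne by (auto simp: cyc_def)
  moreover have "\<not> (cyc i j k \<and> cyc i k j)" by (auto simp: cyc_def)
  moreover have "orient (ps ! i) (ps ! k) (ps ! j) = - orient (ps ! i) (ps ! j) (ps ! k)" by (rule orient_swap)
  ultimately show "0 < orient (ps ! i) (ps ! j) (ps ! k) \<longleftrightarrow> cyc i j k" "orient (ps ! i) (ps ! j) (ps ! k) \<noteq> 0"
    using pos[of i j k] pos[of i k j] ijk by linarith+
qed

text \<open>Orientations tell on which side of a chord a point lies. Interleaved chords separate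
  each other's ends, so they meet. Otherwise the ends of the second chord do not lie strictly on
  different sides of the first, a common end counting as 0.\<close>

lemma crossing_interleaved:
  assumes ps: "ccw_order P ps" and lt: "a < length ps" "b < length ps" "c < length ps" "d < length ps"
    and ne: "a \<noteq> b" "c \<noteq> d"
  shows "crossing {ps ! a, ps ! b} {ps ! c, ps ! d} \<longleftrightarrow> interleaved a b c d"
proof -
  have inj: "ps ! x = ps ! y \<longleftrightarrow> x = y" if "x < length ps" "y < length ps" for x y
    using ps that by (auto simp: ccw_order_def nth_eq_iff_index_eq)
  note oc = orient_cyc[OF ps]
  have anti: "cyc x z y \<longleftrightarrow> \<not> cyc x y z" if "x \<noteq> y" "y \<noteq> z" "x \<noteq> z" for x y z
    using that by (auto simp: cyc_def)
  have opp: "orient (ps ! x) (ps ! y) (ps ! u) * orient (ps ! x) (ps ! y) (ps ! v) < 0"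
    if i: "interleaved x y u v" and l: "x < length ps" "y < length ps" "u < length ps" "v < length ps" for x y u v
  proof -
    have n: "x \<noteq> y" "u \<noteq> x" "u \<noteq> y" "v \<noteq> x" "v \<noteq> y" "cyc x u y \<noteq> cyc x v y"
      using i unfolding interleaved_cyc by auto
    have "cyc x y u \<noteq> cyc x y v" using n anti[of x u y] anti[of x v y] by auto
    then show ?thesis
      using oc[of x y u] oc[of x y v] n l unfolding mult_less_0_iff by (metis linorder_neqE_linordered_idom)
  qed
  show ?thesis
  proof
    assume i: "interleaved a b c d"
    then have "open_segment (ps ! a) (ps ! b) \<inter> open_segment (ps ! c) (ps ! d) \<noteq> {}"
      using opp[OF i] opp[of c d a b] lt interleaved_sym by (intro open_segments_meet) auto
    moreover have "{ps ! a, ps ! b} \<noteq> {ps ! c, ps ! d}"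
      using interleaved_distinct[OF i] inj lt by (auto simp: doubleton_eq_iff)
    ultimately show "crossing {ps ! a, ps ! b} {ps ! c, ps ! d}" by (simp add: crossing_doubleton)
  next
    assume cr: "crossing {ps ! a, ps ! b} {ps ! c, ps ! d}"
    show "interleaved a b c d"
    proof (rule ccontr)
      assume ni: "\<not> interleaved a b c d"
      let ?o = "orient (ps ! a) (ps ! b)"
      have zero: "?o (ps ! a) = 0" "?o (ps ! b) = 0" by (simp_all add: orient_def)
      have nz: "?o (ps ! x) \<noteq> 0" if "x < length ps" "x \<noteq> a" "x \<noteq> b" for x
        using oc(2)[of a b x] that lt ne by auto
      \<comment> \<open>Two common ends would mean equal edges, which do not count as
        crossing.\<close>
      have "\<not> (c \<in> {a, b} \<and> d \<in> {a, b})"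
      proof
        assume "c \<in> {a, b} \<and> d \<in> {a, b}"
        then have "{ps ! a, ps ! b} = {ps ! c, ps ! d}" using ne by auto
        then show False using cr by (simp add: crossing_doubleton)
      qed
      then have 1: "?o (ps ! c) \<noteq> 0 \<or> ?o (ps ! d) \<noteq> 0" using nz lt by blast
      have 2: "0 \<le> ?o (ps ! c) \<and> 0 \<le> ?o (ps ! d) \<or> ?o (ps ! c) \<le> 0 \<and> ?o (ps ! d) \<le> 0"
      proof (cases "c \<in> {a, b} \<or> d \<in> {a, b}")
        case True
        then have "?o (ps ! c) = 0 \<or> ?o (ps ! d) = 0" using zero by auto
        then show ?thesis by linarith
      next
        case False
        then have "cyc a c b = cyc a d b" using ni ne by (auto simp: interleaved_cyc)
        then have "cyc a b c = cyc a b d" using anti[of a c b] anti[of a d b] False ne by auto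
        then have "0 < ?o (ps ! c) \<longleftrightarrow> 0 < ?o (ps ! d)" using oc(1)[of a b c] oc(1)[of a b d] False ne lt by auto
        then show ?thesis by linarith
      qed
      show False using open_segments_disjoint[OF 2 1] cr by (simp add: crossing_doubleton)
    qed
  qed
qed

section \<open>From points to indices\<close>

lemma path_graph_adj_exch: "path_graph_adj A B = exchange A B"
  by (auto simp: path_graph_adj_def exchange_def)

lemma ccw_order_nth:
  assumes "ccw_order P ps"
  shows "bij_betw ((!) ps) {..<length ps} P"
  using assms by (auto simp: ccw_order_def intro!: bij_betw_nth)

lemma inj_on_edge_sets:
  assumes "inj_on f {..<n}"
  shows "inj_on (\<lambda>S. (`) f ` S) (Pow (Pow {..<n}))"
  by (intro inj_on_image_Pow assms)

lemma path_graph_verts_image: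
  assumes ps: "ccw_order P ps" and n: "length ps = n"
  shows "path_graph_verts P = (\<lambda>S. (`) ((!) ps) ` S) ` ncpaths n"
proof -
  let ?q = "(!) ps"
  have bij: "bij_betw ?q {..<n} P" using ccw_order_nth[OF ps] n by simp
  have nc_iff: "(\<forall>e\<in>pedges (map ?q xs). \<forall>f\<in>pedges (map ?q xs). \<not> crossing e f) \<longleftrightarrow>
      (\<forall>e\<in>pedges xs. \<forall>f\<in>pedges xs. \<not> crosses e f)" if xs: "distinct xs" "set xs = {..<n}" for xs
  proof -
    have "crossing (?q ` e) (?q ` f) \<longleftrightarrow> crosses e f" if ef: "e \<in> pedges xs" "f \<in> pedges xs" for e f
    proof -
      obtain a b where e: "e = {a, b}" "a \<noteq> b" "a \<in> {..<n}" "b \<in> {..<n}" using pedges_doubleton[OF ef(1) xs(1)] unfolding xs(2) by blast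
      obtain c d where f: "f = {c, d}" "c \<noteq> d" "c \<in> {..<n}" "d \<in> {..<n}" using pedges_doubleton[OF ef(2) xs(1)] unfolding xs(2) by blast
      show ?thesis using crossing_interleaved[OF ps, of a b c d] e f n by simp
    qed
    then show ?thesis unfolding pedges_map by blast
  qed
  show ?thesis
  proof (intro equalityI subsetI)
    fix S assume "S \<in> path_graph_verts P"
    then obtain ys where ys: "S = pedges ys" "distinct ys" "set ys = P" "\<forall>e\<in>pedges ys. \<forall>f\<in>pedges ys. \<not> crossing e f"
      by (auto simp: path_graph_verts_def path_edges_pedges)
    define xs where "xs = map (inv_into {..<n} ?q) ys"
    have "map ?q xs = ys"
      unfolding xs_def map_map using bij ys(3) by (intro map_idI) (auto simp: bij_betw_def f_inv_into_f)
    moreover have "distinct xs" "set xs = {..<n}"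
      using bij_betw_inv_into[OF bij] ys(2,3) by (auto simp: xs_def distinct_map bij_betw_def)
    ultimately show "S \<in> (\<lambda>S. (`) ?q ` S) ` ncpaths n"
      using nc_iff[of xs] ys
      by (intro image_eqI[of _ _ "pedges xs"]) (auto simp: ncpaths_nc noncrossing_def simp flip: pedges_map)
  next
    fix S assume "S \<in> (\<lambda>S. (`) ?q ` S) ` ncpaths n"
    then obtain xs where xs: "S = pedges (map ?q xs)" "distinct xs" "set xs = {..<n}"
        "\<forall>e\<in>pedges xs. \<forall>f\<in>pedges xs. \<not> crosses e f"
      by (auto simp: ncpaths_nc noncrossing_def pedges_map)
    then have "distinct (map ?q xs)" "set (map ?q xs) = P"
      using bij by (auto simp: distinct_map bij_betw_def)
    then show "S \<in> path_graph_verts P"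
      using nc_iff[OF xs(2,3)] xs(1,4)
      unfolding path_graph_verts_def path_edges_pedges by blast
  qed
qed

text \<open>Under every counterclockwise tour the same relation on indices describes crossings. So a
  symmetry of the indices gives an automorphism even if points are numbered by one tour and images
  by another.\<close>

lemma geometric_automorphismI:
  assumes qs: "ccw_order P qs" and ps: "ccw_order P ps" and \<tau>: "hull_aut n \<tau>"
    and n: "length qs = n" "length ps = n"
    and \<sigma>: "\<And>i. i < n \<Longrightarrow> \<sigma> (qs ! i) = ps ! \<tau> i"
  shows "geometric_automorphism P \<sigma>"
proof -
  have bq: "bij_betw ((!) qs) {..<n} P" and bp: "bij_betw ((!) ps) {..<n} P"
    using ccw_order_nth[OF qs] ccw_order_nth[OF ps] n by simp_all
  have bt: "bij_betw \<tau> {..<n} {..<n}" using \<tau> by (simp add: hull_aut_def)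
  have lt: "\<tau> i < n" if "i < n" for i using bt that by (auto simp: bij_betw_def)
  have "bij_betw (\<lambda>i. ps ! \<tau> i) {..<n} P" using bij_betw_trans[OF bt bp] by (simp add: comp_def)
  then have "bij_betw (\<lambda>i. \<sigma> (qs ! i)) {..<n} P" using \<sigma> by (subst bij_betw_cong[where g = "\<lambda>i. ps ! \<tau> i"]) auto
  then have "bij_betw (\<sigma> \<circ> (!) qs) {..<n} P" by (simp add: comp_def)
  then have "bij_betw \<sigma> P P" using bij_betw_comp_iff[OF bq] by blast
  moreover have "crossing (\<sigma> ` e) (\<sigma> ` f) \<longleftrightarrow> crossing e f" if "e \<in> K_edges P" "f \<in> K_edges P" for e f
  proof -
    have ex: "\<exists>a b. e = {qs ! a, qs ! b} \<and> a < n \<and> b < n \<and> a \<noteq> b" if "e \<in> K_edges P" for e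
    proof -
      obtain x y where xy: "e = {x, y}" "x \<in> P" "y \<in> P" "x \<noteq> y" using \<open>e \<in> K_edges P\<close> by (auto simp: K_edges_def)
      moreover obtain a b where "a < n" "x = qs ! a" "b < n" "y = qs ! b"
        using xy bq by (auto simp: bij_betw_def)
      ultimately show ?thesis by blast
    qed
    obtain a b where e: "e = {qs ! a, qs ! b}" "a < n" "b < n" "a \<noteq> b" using ex \<open>e \<in> K_edges P\<close> by blast
    obtain c d where f: "f = {qs ! c, qs ! d}" "c < n" "d < n" "c \<noteq> d" using ex \<open>f \<in> K_edges P\<close> by blast
    have "crossing e f \<longleftrightarrow> interleaved a b c d"
      unfolding e(1) f(1) by (rule crossing_interleaved[OF qs]) (use e f n in auto)
    moreover have "crossing (\<sigma> ` e) (\<sigma> ` f) \<longleftrightarrow> interleaved (\<tau> a) (\<tau> b) (\<tau> c) (\<tau> d)"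
    proof -
      have "\<tau> a \<noteq> \<tau> b" "\<tau> c \<noteq> \<tau> d" using bt e f by (auto simp: bij_betw_def inj_on_def)
      then show ?thesis
        using crossing_interleaved[OF ps, of "\<tau> a" "\<tau> b" "\<tau> c" "\<tau> d"] lt e f n \<sigma> by simp
    qed
    ultimately show ?thesis using \<tau> e f by (simp add: hull_aut_def)
  qed
  ultimately show ?thesis by (simp add: geometric_automorphism_def)
qed

text \<open>As \<open>2 ^ (n - 2) \<le> N\<close>, the logarithm plus 2 replaces \<open>n\<close> in
  the bound \<open>2000 * (N * n)\<close>.\<close>

definition time_limit :: "nat \<Rightarrow> nat" where
  "time_limit N = 2000 * (N * (nat \<lfloor>log 2 (real N)\<rfloor> + 2))"

lemma time_limit_bigo: "(\<lambda>N. real (time_limit N)) \<in> O(\<lambda>N. real N * log 2 (real N))"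
proof (rule bigoI[where c = 6000])
  have "norm (real (time_limit N)) \<le> 6000 * norm (real N * log 2 (real N))" if "2 \<le> N" for N
  proof -
    have l: "1 \<le> log 2 (real N)" using that by (simp add: le_log_iff)
    \<comment> \<open>The logarithm is at least 1, so the summand 2 is at most twice the logarithm;
      this gives 6000 as three times 2000.\<close>
    then have "real (nat \<lfloor>log 2 (real N)\<rfloor> + 2) \<le> 3 * log 2 (real N)" by linarith
    then have "real N * real (nat \<lfloor>log 2 (real N)\<rfloor> + 2) \<le> real N * (3 * log 2 (real N))"
      by (rule mult_left_mono) simp
    moreover have "norm (real (time_limit N)) = 2000 * (real N * real (nat \<lfloor>log 2 (real N)\<rfloor> + 2))"
      by (simp only: time_limit_def of_nat_mult of_nat_numeral real_norm_def abs_mult abs_of_nat abs_numeral)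
    moreover have "norm (real N * log 2 (real N)) = real N * log 2 (real N)" using l by simp
    ultimately show ?thesis by linarith
  qed
  then show "\<forall>\<^sub>F N in at_top. norm (real (time_limit N)) \<le> 6000 * norm (real N * log 2 (real N))"
    using eventually_ge_at_top[of 2] by (rule eventually_mono[rotated])
qed

text \<open>The analysis uses some tour \<open>qs\<close> to turn points into indices. The run and
  its output are fixed before the tour \<open>ps\<close> is chosen; only \<open>\<sigma>\<close>
  depends on it, and it takes the point with index \<open>i\<close> in \<open>qs\<close> to the one
  with index \<open>\<tau> i\<close> in \<open>ps\<close>.\<close>

lemma recover_correct:
  assumes n: "5 \<le> n" "card P = n" and cp: "convex_position P" and N: "N = card (path_graph_verts P)"
    and adj: "adjacency_lists (path_graph_verts P) path_graph_adj vs A" and w: "N ^ 4 \<le> 2 ^ w"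
  shows "\<exists>t s. run w recover (input_state A) t s \<and> t \<le> time_limit N \<and>
    (\<forall>v<N. output_pairs s v \<subseteq> {..<n} \<times> {..<n}) \<and>
    (\<forall>ps. ccw_order P ps \<longrightarrow>
      (\<exists>\<sigma>. geometric_automorphism P \<sigma> \<and> (\<forall>v<N. output_edges ps s v = (\<lambda>e. \<sigma> ` e) ` (vs ! v))))"
proof -
  have "finite P" using n by (metis card.infinite not_numeral_le_zero)
  then obtain qs where qs: "ccw_order P qs" using ex_ccw_order cp by blast
  have len: "length ps = n" if "ccw_order P ps" for ps
    using that n distinct_card by (fastforce simp: ccw_order_def)
  let ?q = "(!) qs"
  let ?Q = "\<lambda>S. (`) ?q ` S"
  have bq: "bij_betw ?q {..<n} P" using ccw_order_nth[OF qs] len[OF qs] by simp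
  then have injq: "inj_on ?q {..<n}" by (simp add: bij_betw_def)
  have verts: "path_graph_verts P = ?Q ` ncpaths n" by (rule path_graph_verts_image[OF qs len[OF qs]])
  have injQ: "inj_on ?Q (ncpaths n)" using inj_on_edge_sets[OF injq] ncpaths_subset by (rule inj_on_subset)
  have vs: "distinct vs" "set vs = path_graph_verts P" "length A = length vs"
    "\<And>v. v < length vs \<Longrightarrow> distinct (A ! v) \<and> set (A ! v) = {u. u < length vs \<and> path_graph_adj (vs ! v) (vs ! u)}"
    using adj by (auto simp: adjacency_lists_def)
  have lenvs: "length vs = N" using distinct_card[OF vs(1)] vs(2) N by simp
  define W where "W v = inv_into (ncpaths n) ?Q (vs ! v)" for v
  have mem: "vs ! v \<in> ?Q ` ncpaths n" if "v < N" for v using that lenvs vs(2) verts nth_mem by metis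
  have QW: "?Q (W v) = vs ! v" if "v < N" for v unfolding W_def using mem[OF that] by (rule f_inv_into_f)
  have Wn: "W v \<in> ncpaths n" if "v < N" for v unfolding W_def using mem[OF that] by (rule inv_into_into)
  interpret numbered_paths n N w W A
  proof
    have "bij_betw ((!) vs) {..<N} (?Q ` ncpaths n)"
      using bij_betw_nth[OF vs(1), of "{..<N}" "?Q ` ncpaths n"] lenvs vs(2) verts by simp
    moreover have "bij_betw (inv_into (ncpaths n) ?Q) (?Q ` ncpaths n) (ncpaths n)"
      using injQ by (intro bij_betw_inv_into) (simp add: bij_betw_def)
    ultimately have "bij_betw (inv_into (ncpaths n) ?Q \<circ> (!) vs) {..<N} (ncpaths n)" by (rule bij_betw_trans)
    then show "bij_betw W {..<N} (ncpaths n)" by (simp add: W_def[abs_def] comp_def)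
    have injE: "inj_on ((`) ?q) (Pow {..<n})" using injq by (rule inj_on_image_Pow)
    have ex: "path_graph_adj (vs ! v) (vs ! u) \<longleftrightarrow> exchange (W v) (W u)" if "v < N" "u < N" for u v
    proof -
      have "W v \<subseteq> Pow {..<n}" "W u \<subseteq> Pow {..<n}" using Wn that ncpaths_subset by blast+
      then show ?thesis
        using exch_image_iff[OF injE, of "W v" "W u"] unfolding QW[OF that(1)] QW[OF that(2)] path_graph_adj_exch by blast
    qed
    show "distinct (A ! v) \<and> set (A ! v) = {u. u < N \<and> exchange (W v) (W u)}" if "v < N" for v
      using vs(4)[of v] that lenvs ex by auto
  qed (use n(1) w vs(3) lenvs in simp_all)
  obtain t s \<tau> where run: "run w recover (input_state A) t s" "t \<le> 2000 * (N * n)"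
    and \<tau>: "hull_aut n \<tau>"
    and out: "\<forall>v<N. output_pairs s v \<subseteq> {..<n} \<times> {..<n} \<and>
      {{i, j} | i j. (i, j) \<in> output_pairs s v} = (`) \<tau> ` W v"
    using runs_recover[unfolded runs_def] by (elim exE conjE)
  have "n \<le> nat \<lfloor>log 2 (real N)\<rfloor> + 2"
  proof -
    have "real (2 ^ (n - 2)) \<le> real N" by (rule of_nat_mono[OF N_lower])
    then have "real (n - 2) \<le> log 2 (real N)" by (simp add: le_log_of_power)
    then show ?thesis by linarith
  qed
  then have "N * n \<le> N * (nat \<lfloor>log 2 (real N)\<rfloor> + 2)" by (rule mult_le_mono2)
  then have "t \<le> time_limit N" using run(2) by (simp add: time_limit_def)
  moreover have "\<exists>\<sigma>. geometric_automorphism P \<sigma> \<and> (\<forall>v<N. output_edges ps s v = (\<lambda>e. \<sigma> ` e) ` (vs ! v))"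
    if ps: "ccw_order P ps" for ps
  proof -
    define \<sigma> where "\<sigma> x = ps ! \<tau> (inv_into {..<n} ?q x)" for x
    have sq: "\<sigma> (qs ! i) = ps ! \<tau> i" if "i < n" for i
      using inv_into_f_f[OF injq] that by (simp add: \<sigma>_def)
    have "geometric_automorphism P \<sigma>"
      by (rule geometric_automorphismI[OF qs ps \<tau> len[OF qs] len[OF ps] sq])
    moreover have "output_edges ps s v = (\<lambda>e. \<sigma> ` e) ` (vs ! v)" if v: "v < N" for v
    proof -
      have "output_edges ps s v = (`) ((!) ps) ` {{i, j} | i j. (i, j) \<in> output_pairs s v}"
        unfolding output_edges_def by (auto simp: image_iff) blast
      also have "\<dots> = (`) ((!) ps) ` (`) \<tau> ` W v" using out v by simp
      also have "\<dots> = (\<lambda>e. \<sigma> ` ?q ` e) ` W v"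
        unfolding image_image[of "(`) ((!) ps)"]
      proof (rule image_cong)
        fix e assume "e \<in> W v"
        then have "e \<subseteq> {..<n}" using Wn[OF v] ncpaths_subset by blast
        then show "(!) ps ` \<tau> ` e = \<sigma> ` ?q ` e" unfolding image_image using sq by (intro image_cong) auto
      qed simp
      also have "\<dots> = (\<lambda>e. \<sigma> ` e) ` ?Q (W v)" by (simp add: image_image)
      finally show ?thesis unfolding QW[OF v] .
    qed
    ultimately show ?thesis by blast
  qed
  moreover have "\<forall>v<N. output_pairs s v \<subseteq> {..<n} \<times> {..<n}" using out by simp
  ultimately show ?thesis using run(1) by (intro exI[of _ t] exI[of _ s] conjI allI impI) simp_all
qed

theorem theorem2:
  "\<exists>(prog :: com) (c :: nat) (T :: nat \<Rightarrow> nat).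
     (\<lambda>N. real (T N)) \<in> O(\<lambda>N. real N * log 2 (real N)) \<and>
     (\<forall>(n :: nat) (P :: point set) (N :: nat) (vs :: point set set list) (A :: nat list list) (w :: nat).
        n \<ge> 5 \<and> card P = n \<and> convex_position P \<and>
        N = card (path_graph_verts P) \<and>
        adjacency_lists (path_graph_verts P) path_graph_adj vs A \<and>
        N ^ c \<le> 2 ^ w \<longrightarrow>
        (\<exists>t s. run w prog (input_state A) t s \<and> t \<le> T N \<and>
           (\<forall>v < N. output_pairs s v \<subseteq> {..<n} \<times> {..<n}) \<and>
           (\<forall>ps. ccw_order P ps \<longrightarrow>
              (\<exists>\<sigma>. geometric_automorphism P \<sigma> \<and>
                 (\<forall>v < N. output_edges ps s v = (\<lambda>e. \<sigma> ` e) ` (vs ! v))))))"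
proof (rule exI[of _ recover], rule exI[of _ 4], rule exI[of _ time_limit], intro conjI allI impI)
  show "(\<lambda>N. real (time_limit N)) \<in> O(\<lambda>N. real N * log 2 (real N))" by (rule time_limit_bigo)
qed (elim conjE, rule recover_correct)

end
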